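(* Let $R$ be a field, and let $\mathsf{X}$ be a subshift over an arbitrary alphabet $\mathscr{A}$. The algebra $\widetilde{\mathcal{A}}_R(\mathsf{X})$ is simple if and only if $\mathsf{X}$ satisfies condition (L) and is compactly cofinal.
   Context: $\mathscr{A}$ is a non-empty set (alphabet), $\omega$ the empty word. A subshift $\mathsf{X}\subseteq\mathscr{A}^{\mathbb{N}}$ is the set of all sequences none of whose finite subwords lies in some given set of words. $\mathcal{L}_{\mathsf{X}}$ is the language: the set of all finite words (including $\omega$) occurring in elements of $\mathsf{X}$. For finite words $\alpha,\beta$, $C(\alpha,\beta)=\{\beta x\in\mathsf{X}:\alpha x\in\mathsf{X}\}$ (empty if $\alpha$ or $\beta$ is not in $\mathcal{L}_{\mathsf{X}}$). $F_\beta=C(\beta,\omega)=\{x\in\mathsf{X}:\beta x\in\mathsf{X}\}$ and, for $B\subseteq\mathcal{L}_{\mathsf{X}}$, $F_B=\bigcap_{\beta\in B}F_\beta$. $\mathcal{U}$ is the Boolean algebra of subsets of $\mathsf{X}$ generated by all $C(\alpha,\beta)$, $\alpha,\beta\in\mathcal{L}_{\mathsf{X}}$. $\widetilde{\mathcal{A}}_R(\mathsf{X})$ (the unital subshift algebra) is the universal unital $R$-algebra with generators $\{p_A:A\in\mathcal{U}\}\cup\{s_a,s_a^*:a\in\mathscr{A}\}$ subject to: (i) $p_{\mathsf{X}}=1$, $p_\emptyset=0$, $p_{A\cap B}=p_Ap_B$, $p_{A\cup B}=p_A+p_B-p_{A\cap B}$ for $A,B\in\mathcal{U}$; (ii) $s_as_a^*s_a=s_a$,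 $s_a^*s_as_a^*=s_a^*$ for $a\in\mathscr{A}$; (iii) $s_\beta s_\alpha^*s_\alpha s_\beta^*=p_{C(\alpha,\beta)}$ for $\alpha,\beta\in\mathcal{L}_{\mathsf{X}}$, where $s_\omega=s_\omega^*=1$, $s_{\alpha_1\cdots\alpha_n}=s_{\alpha_1}\cdots s_{\alpha_n}$, $s_{\alpha_1\cdots\alpha_n}^*=s_{\alpha_n}^*\cdots s_{\alpha_1}^*$. Condition (L): for every finite set $B\subseteq\mathcal{L}_{\mathsf{X}}$ and every $\gamma\in\mathcal{L}_{\mathsf{X}}$ such that the infinite sequence $\gamma^\infty=\gamma\gamma\gamma\cdots$ belongs to $F_B$, there exists an element of $F_B$ other than $\gamma^\infty$. Compactly cofinal: for every finite $B\subseteq\mathcal{L}_{\mathsf{X}}$ with $F_B\neq\emptyset$ and every net $(x_i)_{i\in I}$ in $\mathsf{X}$, there are $\alpha,\gamma\in\mathcal{L}_{\mathsf{X}}$ and a subnet $(x_{i_j})_{j\in J}$ such that $x_{i_j}\in C(\beta\gamma,\alpha)$ for all $j\in J$ and all $\beta\in B$.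
   Formalization: The formal theorem also assumes that every letter of the alphabet occurs in X (so X is non-empty); otherwise the claim fails, e.g. for X = {a,b}^N over {a,b,c}, where s_c generates a proper nonzero ideal although (L) and compact cofinality hold. *)

theory Defs
  imports
    "HOL-Library.FuncSet"
    "HOL-Library.Poly_Mapping"
    "HOL-Library.Omega_Words_Fun"
    "HOL-Algebra.QuotRing"
    "HOL-Algebra.Algebraic_Closure_Type"
begin

section \<open>Subshifts\<close>

text \<open>The alphabet is the type \<open>'a\<close>; finite words are lists.\<close>

definition subshift :: "'a word set \<Rightarrow> bool" where
  "subshift \<X> \<longleftrightarrow> (\<exists>F :: 'a list set. \<X> = {x. \<forall>i j. subsequence x i j \<notin> F})"

definition language :: "'a word set \<Rightarrow> 'a list set" where
  "language \<X> = {subsequence x i j | x i j. x \<in> \<X>}"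

definition cyl :: "'a word set \<Rightarrow> 'a list \<Rightarrow> 'a list \<Rightarrow> 'a word set" where
  "cyl \<X> \<alpha> \<beta> = {\<beta> \<frown> x | x. \<beta> \<frown> x \<in> \<X> \<and> \<alpha> \<frown> x \<in> \<X>}"

text \<open>The empty intersection is taken inside \<open>\<X>\<close>, so \<open>followers \<X> {} = \<X>\<close>.\<close>

definition followers :: "'a word set \<Rightarrow> 'a list set \<Rightarrow> 'a word set" where
  "followers \<X> B = \<X> \<inter> (\<Inter>\<beta>\<in>B. cyl \<X> \<beta> [])"

inductive_set bool_alg :: "'a word set \<Rightarrow> 'a word set set" for \<X> where
  cyl: "\<alpha> \<in> language \<X> \<Longrightarrow> \<beta> \<in> language \<X> \<Longrightarrow> cyl \<X> \<alpha> \<beta> \<in> bool_alg \<X>"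
| whole: "\<X> \<in> bool_alg \<X>"
| compl: "A \<in> bool_alg \<X> \<Longrightarrow> \<X> - A \<in> bool_alg \<X>"
| union: "A \<in> bool_alg \<X> \<Longrightarrow> B \<in> bool_alg \<X> \<Longrightarrow> A \<union> B \<in> bool_alg \<X>"

text \<open>The periodic sequence \<open>\<gamma>\<^sup>\<omega>\<close> only makes sense for nonempty \<open>\<gamma>\<close>.\<close>

definition condition_L :: "'a word set \<Rightarrow> bool" where
  "condition_L \<X> \<longleftrightarrow>
    (\<forall>B \<gamma>. finite B \<and> B \<subseteq> language \<X> \<and> \<gamma> \<in> language \<X> \<and> \<gamma> \<noteq> [] \<and> \<gamma>\<^sup>\<omega> \<in> followers \<X> B
       \<longrightarrow> (\<exists>y \<in> followers \<X> B. y \<noteq> \<gamma>\<^sup>\<omega>))"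


section \<open>Nets and compact cofinality\<close>

definition directed_set :: "'i set \<Rightarrow> ('i \<Rightarrow> 'i \<Rightarrow> bool) \<Rightarrow> bool" where
  "directed_set I r \<longleftrightarrow> I \<noteq> {} \<and> reflp_on I r \<and> transp_on I r \<and>
     (\<forall>i\<in>I. \<forall>j\<in>I. \<exists>k\<in>I. r i k \<and> r j k)"

text \<open>\<open>j \<mapsto> x (h j)\<close> is a subnet of the net \<open>i \<mapsto> x i\<close>.\<close>

definition subnet_map ::
  "'i set \<Rightarrow> ('i \<Rightarrow> 'i \<Rightarrow> bool) \<Rightarrow> 'j set \<Rightarrow> ('j \<Rightarrow> 'j \<Rightarrow> bool) \<Rightarrow> ('j \<Rightarrow> 'i) \<Rightarrow> bool" where
  "subnet_map I r J r' h \<longleftrightarrow> directed_set J r' \<and> h \<in> J \<rightarrow> I \<and>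
     monotone_on J r' r h \<and> (\<forall>i\<in>I. \<exists>j\<in>J. r i (h j))"

text \<open>
  A formula cannot quantify over all index types. Indices here are pairs of a point and a set:
  every net in \<open>\<X>\<close> has the same tails as one indexed by the pairs \<open>(y, T)\<close> with \<open>T\<close> a tail
  and \<open>y \<in> T\<close>. The lemma \<open>compactly_cofinal_any_index\<close> below shows that
  the property then holds for nets over arbitrary index types.
\<close>

definition compactly_cofinal :: "'a word set \<Rightarrow> bool" where
  "compactly_cofinal \<X> \<longleftrightarrow>
    (\<forall>B. finite B \<and> B \<subseteq> language \<X> \<and> followers \<X> B \<noteq> {} \<longrightarrow>
      (\<forall>(I :: ('a word \<times> 'a word set) set) r x. directed_set I r \<and> x \<in> I \<rightarrow> \<X> \<longrightarrow>
        (\<exists>\<alpha>\<in>language \<X>. \<exists>\<gamma>\<in>language \<X>.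
          \<exists>(J :: ('a word \<times> 'a word set) set) r' h. subnet_map I r J r' h \<and>
            (\<forall>j\<in>J. \<forall>\<beta>\<in>B. x (h j) \<in> cyl \<X> (\<beta> @ \<gamma>) \<alpha>))))"

lemma compactly_cofinal_any_index:
  fixes \<X> :: "'a word set" and I :: "'i set"
  assumes cc: "compactly_cofinal \<X>"
    and B: "finite B" "B \<subseteq> language \<X>" "followers \<X> B \<noteq> {}"
    and I: "directed_set I r" and x: "x \<in> I \<rightarrow> \<X>"
  shows "\<exists>\<alpha>\<in>language \<X>. \<exists>\<gamma>\<in>language \<X>. \<exists>(J :: 'i set) r' h. subnet_map I r J r' h \<and>
           (\<forall>j\<in>J. \<forall>\<beta>\<in>B. x (h j) \<in> cyl \<X> (\<beta> @ \<gamma>) \<alpha>)"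
proof -
  have refl: "r i i" if "i \<in> I" for i
    using I that by (auto simp: directed_set_def reflp_on_def)
  have trans: "r i k" if "r i j" "r j k" "i \<in> I" "j \<in> I" "k \<in> I" for i j k
    using I that unfolding directed_set_def transp_on_def by blast
  have ub: "\<exists>k\<in>I. r i k \<and> r j k" if "i \<in> I" "j \<in> I" for i j
    using I that unfolding directed_set_def by blast
  define T where "T i = {x k | k. k \<in> I \<and> r i k}" for i
  have T_mono: "T j \<subseteq> T i" if "r i j" "i \<in> I" "j \<in> I" for i j
    unfolding T_def using trans[OF that(1)] that by blast
  have x_T: "x i \<in> T i" if "i \<in> I" for i
    unfolding T_def using refl that by blast
  define I' where "I' = {(y, T i) | y i. i \<in> I \<and> y \<in> T i}"
  define r2 where "r2 = (\<lambda>(p :: 'a word \<times> 'a word set) (q :: 'a word \<times> 'a word set). snd q \<subseteq> snd p)"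
  have "\<exists>t\<in>I'. r2 p t \<and> r2 q t" if pq: "p \<in> I'" "q \<in> I'" for p q
  proof -
    obtain i j where ij: "i \<in> I" "j \<in> I" "snd p = T i" "snd q = T j"
      using pq unfolding I'_def by auto
    obtain k where k: "k \<in> I" "r i k" "r j k" using ub ij by blast
    have "(x k, T k) \<in> I'" unfolding I'_def using k x_T by blast
    moreover have "r2 p (x k, T k)" "r2 q (x k, T k)"
      using T_mono k ij by (auto simp: r2_def)
    ultimately show ?thesis by blast
  qed
  moreover have "I' \<noteq> {}"
    using I x_T unfolding I'_def directed_set_def by blast
  moreover have "reflp_on I' r2" "transp_on I' r2"
    unfolding reflp_on_def transp_on_def r2_def by blast+
  ultimately have dir: "directed_set I' r2" unfolding directed_set_def by blast
  have "fst \<in> I' \<rightarrow> \<X>" using x unfolding I'_def T_def by auto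
  then have "\<exists>\<alpha>\<in>language \<X>. \<exists>\<gamma>\<in>language \<X>.
      \<exists>(J :: ('a word \<times> 'a word set) set) r' h. subnet_map I' r2 J r' h \<and>
        (\<forall>j\<in>J. \<forall>\<beta>\<in>B. fst (h j) \<in> cyl \<X> (\<beta> @ \<gamma>) \<alpha>)"
    using cc[unfolded compactly_cofinal_def, rule_format, of B I' r2 fst] B dir by simp
  then obtain \<alpha> \<gamma> and J :: "('a word \<times> 'a word set) set" and r' h
    where ag: "\<alpha> \<in> language \<X>" "\<gamma> \<in> language \<X>" and J: "subnet_map I' r2 J r' h"
      and mem: "\<forall>j\<in>J. \<forall>\<beta>\<in>B. fst (h j) \<in> cyl \<X> (\<beta> @ \<gamma>) \<alpha>"
    by (elim bexE exE conjE)
  define K where "K = {k \<in> I. \<forall>\<beta>\<in>B. x k \<in> cyl \<X> (\<beta> @ \<gamma>) \<alpha>}"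
  have cof: "\<exists>k\<in>K. r i k" if i: "i \<in> I" for i
  proof -
    have "(x i, T i) \<in> I'" unfolding I'_def using i x_T by blast
    then obtain j where j: "j \<in> J" "r2 (x i, T i) (h j)" "h j \<in> I'"
      using J unfolding subnet_map_def by blast
    then have "fst (h j) \<in> T i" unfolding r2_def I'_def by auto
    then obtain k where k: "k \<in> I" "r i k" "fst (h j) = x k" unfolding T_def by blast
    have "\<forall>\<beta>\<in>B. fst (h j) \<in> cyl \<X> (\<beta> @ \<gamma>) \<alpha>" using mem j(1) by blast
    then have "k \<in> K" using k unfolding K_def by simp
    then show ?thesis using k by blast
  qed
  have KI: "K \<subseteq> I" unfolding K_def by blast
  have "\<exists>k\<in>K. r i k \<and> r j k" if ij: "i \<in> K" "j \<in> K" for i j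
  proof -
    have ijI: "i \<in> I" "j \<in> I" using ij KI by blast+
    obtain k where k: "k \<in> I" "r i k" "r j k" using ub ijI by blast
    obtain l where l: "l \<in> K" "r k l" using cof k by blast
    then have "l \<in> I" using KI by blast
    then show ?thesis using l k ijI trans by blast
  qed
  moreover have "K \<noteq> {}" using cof I unfolding directed_set_def by blast
  moreover have "reflp_on K r" "transp_on K r"
    using I KI unfolding directed_set_def reflp_on_def transp_on_def by blast+
  ultimately have "subnet_map I r K r (\<lambda>k. k)"
    unfolding subnet_map_def directed_set_def monotone_on_def using cof KI by blast
  then show ?thesis using ag unfolding K_def by blast
qed


section \<open>Free algebras and the unital subshift algebra\<close>

text \<open>
  The free monoid on \<open>'g\<close>, as a separate type so that lists do not become additive. The monoid
  operation is written additively because \<open>poly_mapping\<close> expects its exponents that way;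
  \<open>'g monomial \<Rightarrow>\<^sub>0 'r\<close> is then the ring of noncommutative polynomials over \<open>'r\<close>.
\<close>

datatype 'g monomial = Monomial (factors: "'g list")

instantiation monomial :: (type) monoid_add
begin

definition zero_monomial :: "'a monomial" where
  "0 = Monomial []"

definition plus_monomial :: "'a monomial \<Rightarrow> 'a monomial \<Rightarrow> 'a monomial" where
  "u + v = Monomial (factors u @ factors v)"

instance
  by standard (simp_all add: zero_monomial_def plus_monomial_def)

end

definition free_algebra :: "'g set \<Rightarrow> ('g monomial \<Rightarrow>\<^sub>0 'r::comm_ring_1) ring" where
  "free_algebra G =
     ring_of_type_algebra \<lparr>carrier := {f. \<forall>w \<in> Poly_Mapping.keys f. set (factors w) \<subseteq> G}\<rparr>"

definition free_gen :: "'g \<Rightarrow> ('g monomial \<Rightarrow>\<^sub>0 'r::comm_ring_1)" where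
  "free_gen g = Poly_Mapping.single (Monomial [g]) 1"

datatype 'a generator = Proj "'a word set" | Iso 'a | Iso_star 'a

definition generators :: "'a word set \<Rightarrow> 'a generator set" where
  "generators \<X> = Proj ` bool_alg \<X> \<union> range Iso \<union> range Iso_star"

type_synonym ('a, 'r) subshift_free = "'a generator monomial \<Rightarrow>\<^sub>0 'r"

abbreviation gen_p :: "'a word set \<Rightarrow> ('a, 'r::comm_ring_1) subshift_free" where
  "gen_p A \<equiv> free_gen (Proj A)"

abbreviation gen_s :: "'a \<Rightarrow> ('a, 'r::comm_ring_1) subshift_free" where
  "gen_s a \<equiv> free_gen (Iso a)"

abbreviation gen_s_star :: "'a \<Rightarrow> ('a, 'r::comm_ring_1) subshift_free" where
  "gen_s_star a \<equiv> free_gen (Iso_star a)"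

definition s_word :: "'a list \<Rightarrow> ('a, 'r::comm_ring_1) subshift_free" where
  "s_word \<alpha> = prod_list (map gen_s \<alpha>)"

definition s_star_word :: "'a list \<Rightarrow> ('a, 'r::comm_ring_1) subshift_free" where
  "s_star_word \<alpha> = prod_list (map gen_s_star (rev \<alpha>))"

text \<open>
  A relation \<open>f = g\<close> is represented by \<open>f - g\<close>. A letter \<open>a\<close> that does not occur in
  \<open>\<X>\<close> is constrained only by the two partial isometry relations, so its generator does not vanish.
\<close>

inductive_set subshift_relations :: "'a word set \<Rightarrow> ('a, 'r::comm_ring_1) subshift_free set"
  for \<X> where
  p_whole: "gen_p \<X> - 1 \<in> subshift_relations \<X>"
| p_empty: "gen_p {} \<in> subshift_relations \<X>"
| p_inter: "A \<in> bool_alg \<X> \<Longrightarrow> B \<in> bool_alg \<X> \<Longrightarrow>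
    gen_p (A \<inter> B) - gen_p A * gen_p B \<in> subshift_relations \<X>"
| p_union: "A \<in> bool_alg \<X> \<Longrightarrow> B \<in> bool_alg \<X> \<Longrightarrow>
    gen_p (A \<union> B) - (gen_p A + gen_p B - gen_p (A \<inter> B)) \<in> subshift_relations \<X>"
| s_partial_iso: "gen_s a * gen_s_star a * gen_s a - gen_s a \<in> subshift_relations \<X>"
| s_star_partial_iso: "gen_s_star a * gen_s a * gen_s_star a - gen_s_star a \<in> subshift_relations \<X>"
| s_cyl: "\<alpha> \<in> language \<X> \<Longrightarrow> \<beta> \<in> language \<X> \<Longrightarrow>
    s_word \<beta> * s_star_word \<alpha> * s_word \<alpha> * s_star_word \<beta> - gen_p (cyl \<X> \<alpha> \<beta>) \<in> subshift_relations \<X>"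

text \<open>\<open>genideal\<close> is the two-sided ideal generated by a set.\<close>

definition unital_subshift_algebra ::
    "'a word set \<Rightarrow> ('a, 'r::comm_ring_1) subshift_free set ring" where
  "unital_subshift_algebra \<X> =
     free_algebra (generators \<X>) Quot genideal (free_algebra (generators \<X>)) (subshift_relations \<X>)"

text \<open>
  An algebra over a field with \<open>1\<close> is simple iff its underlying ring is, since the scalars
  lie in the centre and so every two-sided ideal is a linear subspace.
\<close>

definition simple_ring :: "('b, 'm) ring_scheme \<Rightarrow> bool" where
  "simple_ring A \<longleftrightarrow> ring A \<and> carrier A \<noteq> {\<zero>\<^bsub>A\<^esub>} \<and>
     (\<forall>I. ideal I A \<longrightarrow> I = {\<zero>\<^bsub>A\<^esub>} \<or> I = carrier A)"

lemma ring_free_algebra: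
  "ring (free_algebra G :: ('g monomial \<Rightarrow>\<^sub>0 'r::comm_ring_1) ring)"
proof -
  define K where "K = {f :: 'g monomial \<Rightarrow>\<^sub>0 'r. \<forall>w \<in> Poly_Mapping.keys f. set (factors w) \<subseteq> G}"
  have mult: "f * g \<in> K" if fg: "f \<in> K" "g \<in> K" for f g
  proof -
    have "set (factors w) \<subseteq> G" if w: "w \<in> Poly_Mapping.keys (f * g)" for w
    proof -
      obtain u v where uv: "w = u + v" "u \<in> Poly_Mapping.keys f" "v \<in> Poly_Mapping.keys g"
        using w keys_mult[of f g] by blast
      then have "set (factors u) \<subseteq> G" "set (factors v) \<subseteq> G"
        using fg unfolding K_def by blast+
      then show ?thesis by (simp add: uv(1) plus_monomial_def)
    qed
    then show ?thesis unfolding K_def by blast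
  qed
  have add: "f + g \<in> K" if "f \<in> K" "g \<in> K" for f g
    using that Poly_Mapping.keys_add[of f g] unfolding K_def by blast
  have neg: "- f \<in> K" if "f \<in> K" for f
    using that unfolding K_def by (simp add: in_keys_iff)
  have zero: "0 \<in> K" and one: "1 \<in> K"
    unfolding K_def by (simp_all add: zero_monomial_def)
  let ?R = "ring_of_type_algebra\<lparr>carrier := K\<rparr>"
  have R: "carrier ?R = K" "monoid.mult ?R = (*)" "add ?R = (+)" "one ?R = 1" "zero ?R = 0"
    by (simp_all add: ring_of_type_algebra_def fun_eq_iff)
  have "abelian_group ?R"
    by (rule abelian_groupI, unfold R)
      (simp_all add: add zero add_ac, metis neg add.right_inverse)
  moreover have "monoid ?R"
    by (rule monoidI, unfold R) (simp_all add: mult one mult.assoc)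
  ultimately have "ring ?R"
    by (rule ringI, unfold R) (simp_all add: algebra_simps)
  then show ?thesis unfolding free_algebra_def K_def .
qed

end

theory Submission
  imports Defs
begin

text \<open>
  Modulo the relations every element is a combination of terms \<open>s\<^sub>\<alpha> p\<^sub>A s\<^sub>\<beta>\<^sup>*\<close>. Right multiplication by
  \<open>s\<^sub>a\<close> or \<open>1 - s\<^sub>a s\<^sub>a\<^sup>*\<close> shortens the words \<open>\<beta>\<close>, and at least one of the two keeps the element nonzero. Then (L)
  provides a nonperiodic point along which all but one summand are removed, so that a nonzero ideal contains some
  \<open>p\<^sub>Q\<close> with \<open>Q \<noteq> {}\<close>. Such a \<open>Q\<close> contains a translate of some \<open>F\<^sub>B \<noteq> {}\<close>, and compact cofinality covers
  \<open>\<X>\<close> by finitely many sets whose projections lie in the ideal; hence the ideal contains \<open>1\<close>.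

  Conversely, the algebra acts on functions on \<open>\<X> \<times> \<int>\<close>. If \<open>F\<^sub>B = {\<gamma>\<^sup>\<omega>}\<close>, the element
  \<open>s\<^sub>\<gamma> p - p\<close> with \<open>p\<close> the projection of \<open>F\<^sub>B\<close> dies in the ungraded representation but not in the graded one. If
  the sets \<open>\<Inter>\<beta>\<in>B. C(\<beta>\<gamma>, \<alpha>)\<close> admit no finite cover of \<open>\<X>\<close>, the elements that map every function to one
  supported on a finitely covered set form a proper ideal containing the projection of \<open>F\<^sub>B\<close>.
\<close>

section \<open>Combinatorics of subshifts\<close>

text \<open>Neither linear independence of the terms \<open>s_\<alpha> p_A s_\<beta>\<^sup>*\<close>
  nor faithfulness of a representation is established. If an ideal \<open>J\<close> properly
  contains the ideal \<open>I\<close> of the relations, an element of \<open>J\<close> outside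
  \<open>I\<close> is multiplied into some \<open>p_Q\<close> modulo \<open>I\<close>, and
  \<open>I \<subseteq> J\<close> puts \<open>p_Q\<close> into \<open>J\<close>; whether
  \<open>p_Q\<close> lies in \<open>I\<close> is never asked. Conversely, simplicity itself forces
  every kernel that omits \<open>1\<close> to equal \<open>I\<close>, so two kernels that differ are
  already a contradiction.

  The arbitrary alphabet shapes both directions. With infinitely many letters \<open>1\<close> is
  not a finite sum of the \<open>s_a s_a\<^sup>*\<close>, so stars are removed one letter at a time
  with the complement as second choice; and \<X> need not be compact, so finite covers must come
  from compact cofinality.

  The free algebra is cut out of a type that has a projection symbol for every set of sequences.
  Computations run in the whole type, modulo ideals that absorb the surplus symbols, and return to
  the carrier only at the end.\<close>

lemma conc_prefix_ext: "length u \<le> n \<Longrightarrow> prefix n (u \<frown> x) = u @ prefix (n - length u) x"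
  by (rule nth_equalityI) (auto simp: nth_append)

text \<open>The relative range of \<open>A\<close> along \<open>u\<close>: for \<open>A\<close> in
  \<open>bool_alg \<X>\<close> it is the set whose projection is
  \<open>s_u\<^sup>* p_A s_u\<close>.\<close>

definition preshift :: "'a word set \<Rightarrow> 'a list \<Rightarrow> 'a word set \<Rightarrow> 'a word set" where
  "preshift \<X> u A = {x \<in> \<X>. u \<frown> x \<in> A}"

locale shift_space =
  fixes \<X> :: "'a word set"
  assumes subshift: "subshift \<X>"
begin

lemma tail_in: "u \<frown> x \<in> \<X> \<Longrightarrow> x \<in> \<X>"
proof -
  assume *: "u \<frown> x \<in> \<X>"
  obtain F where F: "\<X> = {x. \<forall>i j. subsequence x i j \<notin> F}"
    using subshift unfolding subshift_def by blast
  have "subsequence x i j = subsequence (u \<frown> x) (length u + i) (length u + j)" for i j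
    by (rule nth_equalityI) auto
  then show ?thesis using * unfolding F by auto
qed

lemma tail_in_Cons: "a ## x \<in> \<X> \<Longrightarrow> x \<in> \<X>"
  using tail_in[of "[a]" x] by simp

lemma suffix_in: "x \<in> \<X> \<Longrightarrow> suffix n x \<in> \<X>"
  using tail_in[of "prefix n x" "suffix n x"] prefix_suffix[of x n] by simp

text \<open>\<X> is closed in the product of discrete topologies: a forbidden word in
  \<open>x\<close> sits inside a finite prefix and survives every change of the tail.\<close>

lemma prefix_not_in:
  assumes "x \<notin> \<X>"
  obtains N where "\<And>n z. n \<ge> N \<Longrightarrow> prefix n x \<frown> z \<notin> \<X>"
proof -
  obtain F where F: "\<X> = {x. \<forall>i j. subsequence x i j \<notin> F}"
    using subshift unfolding subshift_def by blast
  then obtain i j where ij: "subsequence x i j \<in> F" using assms by blast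
  have "subsequence (prefix n x \<frown> z) i j = subsequence x i j" if "n \<ge> j" for n z
    using that by (intro nth_equalityI) auto
  then have "prefix n x \<frown> z \<notin> \<X>" if "n \<ge> j" for n z
    using that ij unfolding F mem_Collect_eq by metis
  then show ?thesis using that by blast
qed

text \<open>By shift invariance every subword can be moved to the beginning of a point.\<close>

lemma language_iff: "u \<in> language \<X> \<longleftrightarrow> (\<exists>x. u \<frown> x \<in> \<X>)"
proof
  assume "u \<in> language \<X>"
  then obtain x i j where x: "x \<in> \<X>" "u = subsequence x i j" unfolding language_def by blast
  show "\<exists>x. u \<frown> x \<in> \<X>"
  proof (cases "i \<le> j")
    case True
    then show ?thesis using suffix_in[OF x(1), of i] x(2) subsequence_prefix_suffix
      by (metis suffix_subseq_join)
  next
    case False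
    \<comment> \<open>Here \<open>j < i\<close>, so the subword is empty and any point
      serves.\<close>
    then show ?thesis using x by (intro exI[of _ x]) simp
  qed
next
  assume "\<exists>x. u \<frown> x \<in> \<X>"
  then obtain x where "u \<frown> x \<in> \<X>" ..
  moreover have "u = prefix (length u) (u \<frown> x)" by simp
  ultimately show "u \<in> language \<X>" unfolding language_def by blast
qed

lemma conc_mem_cyl: "\<beta> \<frown> x \<in> cyl \<X> \<alpha> \<beta> \<longleftrightarrow> \<beta> \<frown> x \<in> \<X> \<and> \<alpha> \<frown> x \<in> \<X>"
  unfolding cyl_def by auto

lemma mem_cyl_Nil: "x \<in> cyl \<X> \<alpha> [] \<longleftrightarrow> \<alpha> \<frown> x \<in> \<X>"
  unfolding cyl_def by (auto dest: tail_in)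

lemma followers_iff: "x \<in> followers \<X> B \<longleftrightarrow> x \<in> \<X> \<and> (\<forall>\<beta>\<in>B. \<beta> \<frown> x \<in> \<X>)"
  unfolding followers_def by (auto simp: mem_cyl_Nil)

lemma bool_alg_subset: "A \<in> bool_alg \<X> \<Longrightarrow> A \<subseteq> \<X>"
  by (induction rule: bool_alg.induct) (auto simp: cyl_def)

lemma empty_bool_alg: "{} \<in> bool_alg \<X>"
  using bool_alg.compl[OF bool_alg.whole] by simp

lemma inter_bool_alg:
  assumes "A \<in> bool_alg \<X>" "B \<in> bool_alg \<X>" shows "A \<inter> B \<in> bool_alg \<X>"
proof -
  have "A \<inter> B = \<X> - ((\<X> - A) \<union> (\<X> - B))"
    using assms bool_alg_subset by blast
  then show ?thesis using assms by (simp add: bool_alg.intros)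
qed

lemma diff_bool_alg:
  assumes "A \<in> bool_alg \<X>" "B \<in> bool_alg \<X>" shows "A - B \<in> bool_alg \<X>"
proof -
  have "A - B = A \<inter> (\<X> - B)"
    using assms bool_alg_subset by blast
  then show ?thesis using assms by (simp add: bool_alg.intros inter_bool_alg)
qed

text \<open>A word outside the language gives the empty cylinder, which also belongs to the
  algebra.\<close>

lemma cyl_bool_alg: "cyl \<X> \<alpha> \<beta> \<in> bool_alg \<X>"
proof (cases "\<alpha> \<in> language \<X> \<and> \<beta> \<in> language \<X>")
  case False
  then have "cyl \<X> \<alpha> \<beta> = {}" unfolding language_iff cyl_def by blast
  then show ?thesis using empty_bool_alg by simp
qed (simp add: bool_alg.cyl)

lemma INT_bool_alg:
  assumes "finite B" "\<And>b. b \<in> B \<Longrightarrow> f b \<in> bool_alg \<X>"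
  shows "\<X> \<inter> (\<Inter>b\<in>B. f b) \<in> bool_alg \<X>"
  using assms
proof (induction B rule: finite_induct)
  case (insert b B)
  have "\<X> \<inter> (\<Inter>b\<in>insert b B. f b) = f b \<inter> (\<X> \<inter> (\<Inter>b\<in>B. f b))" by blast
  then show ?case using insert by (simp add: inter_bool_alg)
qed (simp add: bool_alg.whole)

lemma followers_bool_alg: "finite B \<Longrightarrow> followers \<X> B \<in> bool_alg \<X>"
  unfolding followers_def by (intro INT_bool_alg cyl_bool_alg)

lemma preshift_Cons:
  "A \<subseteq> \<X> \<Longrightarrow> preshift \<X> (a # u) A = preshift \<X> u (preshift \<X> [a] A)"
  by (auto simp: preshift_def dest: tail_in_Cons)

lemma preshift_cyl_Cons:
  "preshift \<X> [a] (cyl \<X> \<alpha> (b # \<beta>)) = (if a = b then cyl \<X> [a] [] \<inter> cyl \<X> \<alpha> \<beta> else {})"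
proof -
  have "y \<in> cyl \<X> [a] []" if "a ## y \<in> \<X>" for y using that by (simp add: mem_cyl_Nil)
  moreover have "a ## y \<in> \<X>" if "y \<in> cyl \<X> [a] []" for y using that by (simp add: mem_cyl_Nil)
  ultimately show ?thesis unfolding preshift_def cyl_def[of _ \<alpha>]
    by (auto dest: tail_in_Cons)
qed

lemma preshift_cyl_Nil: "preshift \<X> [a] (cyl \<X> \<alpha> []) = cyl \<X> (\<alpha> @ [a]) []"
proof -
  have "x \<in> \<X>" if "\<alpha> \<frown> a ## x \<in> \<X>" for x
    using that by (rule tail_in_Cons[OF tail_in])
  then show ?thesis by (auto simp: preshift_def mem_cyl_Nil)
qed

lemma preshift_whole: "preshift \<X> u \<X> = cyl \<X> u []"
  by (auto simp: preshift_def mem_cyl_Nil dest: tail_in)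

lemma preshift_compl: "preshift \<X> u (\<X> - A) = cyl \<X> u [] - preshift \<X> u A"
  by (auto simp: preshift_def mem_cyl_Nil dest: tail_in)

lemma preshift_union: "preshift \<X> u (A \<union> B) = preshift \<X> u A \<union> preshift \<X> u B"
  by (auto simp: preshift_def)

text \<open>Prepending \<open>a\<close> is possible only on \<open>cyl \<X> [a] []\<close>. Taking
  preimages therefore respects unions, while a complement has to be formed inside that set.\<close>

lemma preshift_letter_bool_alg: "A \<in> bool_alg \<X> \<Longrightarrow> preshift \<X> [a] A \<in> bool_alg \<X>"
proof (induction rule: bool_alg.induct)
  case (cyl \<alpha> \<beta>)
  then show ?case
    by (cases \<beta>) (auto simp: preshift_cyl_Cons preshift_cyl_Nil cyl_bool_alg inter_bool_alg empty_bool_alg)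
qed (simp_all add: preshift_whole preshift_compl preshift_union cyl_bool_alg diff_bool_alg bool_alg.union)

lemma preshift_bool_alg: "A \<in> bool_alg \<X> \<Longrightarrow> preshift \<X> u A \<in> bool_alg \<X>"
proof (induction u arbitrary: A)
  case Nil
  then show ?case using bool_alg_subset[OF Nil] by (simp add: preshift_def Collect_conj_eq Int_absorb1)
next
  case (Cons a u)
  show ?case
    by (subst preshift_Cons[OF bool_alg_subset[OF Cons.prems]])
      (rule Cons.IH[OF preshift_letter_bool_alg[OF Cons.prems]])
qed

text \<open>With \<open>u = prefix n x\<close>, the points \<open>u \<frown> z\<close> for
  \<open>z \<in> followers \<X> B\<close> form the intersection of the
  \<open>cyl \<X> \<beta> u\<close> over \<open>\<beta> \<in> B\<close>, a basic neighbourhood of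
  \<open>x\<close> in the topology generated by \<open>bool_alg \<X>\<close>. The predicate says
  that \<open>A\<close> is constant on it; \<open>u \<in> B\<close> keeps it inside \<X>.\<close>

definition decides :: "'a word \<Rightarrow> 'a word set \<Rightarrow> nat \<Rightarrow> 'a list set \<Rightarrow> bool" where
  "decides x A n B \<longleftrightarrow> finite B \<and> B \<subseteq> language \<X> \<and> prefix n x \<in> B \<and> suffix n x \<in> followers \<X> B \<and>
    (\<forall>z\<in>followers \<X> B. prefix n x \<frown> z \<in> A \<longleftrightarrow> x \<in> A)"

lemma decides_compl:
  assumes "decides x A n B" "x \<in> \<X>" shows "decides x (\<X> - A) n B"
proof -
  have "prefix n x \<frown> z \<in> \<X>" if "z \<in> followers \<X> B" for z
    using that assms unfolding followers_iff decides_def by blast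
  then show ?thesis using assms unfolding decides_def by simp
qed

lemma followers_Un: "followers \<X> (B \<union> B') = followers \<X> B \<inter> followers \<X> B'"
  unfolding followers_def by blast

lemma decides_Un:
  assumes "decides x A n B" "decides x A' n B'" shows "decides x (A \<union> A') n (B \<union> B')"
proof -
  have "prefix n x \<frown> z \<in> A \<union> A' \<longleftrightarrow> x \<in> A \<union> A'" if z: "z \<in> followers \<X> (B \<union> B')" for z
  proof -
    have "z \<in> followers \<X> B" "z \<in> followers \<X> B'" using z by (simp_all add: followers_Un)
    then have "prefix n x \<frown> z \<in> A \<longleftrightarrow> x \<in> A" "prefix n x \<frown> z \<in> A' \<longleftrightarrow> x \<in> A'"
      using assms unfolding decides_def by meson+
    then show ?thesis by simp
  qed
  moreover have "finite (B \<union> B')" "B \<union> B' \<subseteq> language \<X>" "prefix n x \<in> B \<union> B'"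
      "suffix n x \<in> followers \<X> (B \<union> B')"
    using assms unfolding decides_def followers_Un by simp_all
  ultimately show ?thesis unfolding decides_def by meson
qed

lemma decides_singleton:
  assumes "x \<in> \<X>" "\<And>z. prefix n x \<frown> z \<in> \<X> \<Longrightarrow> prefix n x \<frown> z \<in> A \<longleftrightarrow> x \<in> A"
  shows "decides x A n {prefix n x}"
proof -
  have *: "prefix n x \<frown> suffix n x \<in> \<X>" using assms(1) by (simp flip: prefix_suffix)
  then have "prefix n x \<in> language \<X>" unfolding language_iff by blast
  moreover have "suffix n x \<in> followers \<X> {prefix n x}"
    unfolding followers_iff using * suffix_in[OF assms(1)] by (intro conjI) auto
  moreover have "\<forall>z\<in>followers \<X> {prefix n x}. prefix n x \<frown> z \<in> A \<longleftrightarrow> x \<in> A"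
    using assms(2) by (metis followers_iff singletonI)
  ultimately show ?thesis
    unfolding decides_def by (intro conjI) simp_all
qed

lemma bool_alg_local:
  assumes "A \<in> bool_alg \<X>" "x \<in> \<X>"
  shows "\<exists>N. \<forall>n\<ge>N. \<exists>B. decides x A n B"
  using assms
proof (induction rule: bool_alg.induct)
  case (cyl \<alpha> \<beta>)
  show ?case
  proof (cases "prefix (length \<beta>) x = \<beta>")
    case False
    have "prefix n x \<frown> z \<notin> cyl \<X> \<alpha> \<beta>" if "n \<ge> length \<beta>" for n z
    proof
      assume "prefix n x \<frown> z \<in> cyl \<X> \<alpha> \<beta>"
      then have "prefix (length \<beta>) (prefix n x \<frown> z) = \<beta>" by (auto simp: cyl_def)
      then show False using False that by simp
    qed
    moreover have "x \<notin> cyl \<X> \<alpha> \<beta>" using False by (auto simp: cyl_def)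
    ultimately have "decides x (cyl \<X> \<alpha> \<beta>) n {prefix n x}" if "n \<ge> length \<beta>" for n
      using that \<open>x \<in> \<X>\<close> by (simp add: decides_singleton)
    then show ?thesis by blast
  next
    case True
    define y where "y = suffix (length \<beta>) x"
    have x: "x = \<beta> \<frown> y" using True unfolding y_def by (metis prefix_suffix)
    have px: "prefix n x = \<beta> @ prefix (n - length \<beta>) y" if "n \<ge> length \<beta>" for n
      using that unfolding x by (rule conc_prefix_ext)
    have sx: "suffix n x = suffix (n - length \<beta>) y" if "n \<ge> length \<beta>" for n
      using that unfolding x by simp
    show ?thesis
    proof (cases "\<alpha> \<frown> y \<in> \<X>")
      case True
      then have "x \<in> cyl \<X> \<alpha> \<beta>" using \<open>x \<in> \<X>\<close> unfolding x by (simp add: conc_mem_cyl)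
      \<comment> \<open>The second word is \<alpha> followed by the part of the prefix behind
        \<beta>; that a tail follows it is exactly the remaining condition for the cylinder.\<close>
      have "decides x (cyl \<X> \<alpha> \<beta>) n {prefix n x, \<alpha> @ prefix (n - length \<beta>) y}" (is "decides _ _ _ ?B")
        if n: "n \<ge> length \<beta>" for n
      proof -
        have *: "prefix n x \<frown> suffix n x \<in> \<X>" "(\<alpha> @ prefix (n - length \<beta>) y) \<frown> suffix n x \<in> \<X>"
          using True sx[OF n] \<open>x \<in> \<X>\<close> by (metis conc_conc prefix_suffix)+
        have "prefix n x \<frown> z \<in> cyl \<X> \<alpha> \<beta>" if "z \<in> followers \<X> ?B" for z
          using that n unfolding followers_iff px[OF n]
          by (simp add: conc_mem_cyl flip: conc_conc)
        moreover have "suffix n x \<in> followers \<X> ?B"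
          using * suffix_in[OF \<open>x \<in> \<X>\<close>] unfolding followers_iff by simp
        moreover have "?B \<subseteq> language \<X>" using * language_iff by (metis insert_subset empty_subsetI)
        ultimately show ?thesis using \<open>x \<in> cyl \<X> \<alpha> \<beta>\<close> unfolding decides_def by blast
      qed
      then show ?thesis by blast
    next
      case False
      then have nx: "x \<notin> cyl \<X> \<alpha> \<beta>" unfolding x by (simp add: conc_mem_cyl)
      obtain N where N: "\<And>n z. n \<ge> N \<Longrightarrow> prefix n (\<alpha> \<frown> y) \<frown> z \<notin> \<X>"
        using prefix_not_in[OF False] by blast
      \<comment> \<open>The bound makes the visible part of \<open>\<alpha> \<frown> y\<close> at
        least \<open>N\<close> letters long, so the forbidden word is already in it.\<close>
      have "decides x (cyl \<X> \<alpha> \<beta>) n {prefix n x}" if n: "n \<ge> N + length \<beta>" for n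
      proof -
        have "prefix n x \<frown> z \<notin> cyl \<X> \<alpha> \<beta>" for z
        proof
          assume "prefix n x \<frown> z \<in> cyl \<X> \<alpha> \<beta>"
          then have "\<alpha> \<frown> prefix (n - length \<beta>) y \<frown> z \<in> \<X>"
            using n px[of n] by (simp add: conc_mem_cyl flip: conc_conc)
          then have "prefix (length \<alpha> + (n - length \<beta>)) (\<alpha> \<frown> y) \<frown> z \<in> \<X>"
            by (simp add: conc_prefix_ext)
          moreover have "length \<alpha> + (n - length \<beta>) \<ge> N" using n by simp
          ultimately show False using N by blast
        qed
        then show ?thesis using nx \<open>x \<in> \<X>\<close> by (simp add: decides_singleton)
      qed
      then show ?thesis by blast
    qed
  qed
next
  case whole
  then have "decides x \<X> n {prefix n x}" for n by (simp add: decides_singleton)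
  then show ?case by blast
next
  case (compl A)
  then show ?case using decides_compl by blast
next
  case (union A A')
  then obtain N N' where "\<forall>n\<ge>N. \<exists>B. decides x A n B" "\<forall>n\<ge>N'. \<exists>B. decides x A' n B" by blast
  then have "\<forall>n\<ge>max N N'. \<exists>B. decides x (A \<union> A') n B"
    using decides_Un by (meson max.boundedE)
  then show ?case by blast
qed

lemma iter_in_language:
  assumes "d\<^sup>\<omega> \<in> \<X>" "d \<noteq> []"
  shows "d \<in> language \<X>"
proof -
  have "d \<frown> d\<^sup>\<omega> = d\<^sup>\<omega>" using assms(2) by (intro iter_unroll[symmetric]) simp
  then have "d \<frown> d\<^sup>\<omega> \<in> \<X>" using assms(1) by metis
  then show ?thesis unfolding language_iff by blast
qed

lemma suffix_iter: "d \<noteq> [] \<Longrightarrow> suffix (k * length d) (d\<^sup>\<omega>) = d\<^sup>\<omega>"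
  by (rule ext) simp

text \<open>
  If a nonempty element of the Boolean algebra consisted of finitely many periodic points, a
  long enough prefix of one of them would give a follower set that is a singleton, against (L).
\<close>

lemma condition_L_nonperiodic:
  assumes L: "condition_L \<X>" and A: "A \<in> bool_alg \<X>" "A \<noteq> {}" and D: "finite D" "[] \<notin> D"
  shows "\<exists>x\<in>A. \<forall>d\<in>D. x \<noteq> d\<^sup>\<omega>"
proof (rule ccontr)
  assume "\<not> ?thesis"
  then have sub: "A \<subseteq> iter ` D" by blast
  then have fin: "finite A" using D(1) by (meson finite_imageI finite_subset)
  obtain x d where x: "x \<in> A" "x = d\<^sup>\<omega>" "d \<in> D" using A(2) sub by blast
  have d: "d \<noteq> []" using x D by blast
  have xX: "x \<in> \<X>" using x bool_alg_subset[OF A(1)] by blast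
  obtain N where N: "\<And>n. n\<ge>N \<Longrightarrow> \<exists>B. decides x A n B"
    using bool_alg_local[OF A(1) xX] by blast
  \<comment> \<open>\<open>A\<close> is finite, so one common length separates all its other points
    from \<open>x\<close>.\<close>
  have "\<exists>M. \<forall>y\<in>A. y \<noteq> x \<longrightarrow> (\<exists>i<M. y i \<noteq> x i)"
  proof -
    have "\<forall>y\<in>A - {x}. \<exists>i. y i \<noteq> x i" by auto
    then obtain h where h: "\<forall>y\<in>A - {x}. y (h y) \<noteq> x (h y)" by metis
    have "h y < Suc (Max (h ` A))" if "y \<in> A" for y using that fin by (simp add: less_Suc_eq_le)
    then show ?thesis using h by (intro exI[of _ "Suc (Max (h ` A))"]) auto
  qed
  then obtain M where M: "\<And>y. y\<in>A \<Longrightarrow> y \<noteq> x \<Longrightarrow> (\<exists>i<M. y i \<noteq> x i)" by blast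
  \<comment> \<open>A multiple of the period, so that the tail at \<open>n\<close> is
    \<open>x\<close> again. Beyond \<open>N\<close> the follower set is available; beyond
    \<open>M\<close> a point of \<open>A\<close> with this prefix must be \<open>x\<close>.\<close>
  define n where "n = (N + M) * length d"
  have n: "n \<ge> N" "n \<ge> M" using d by (auto simp: n_def Suc_leI add_increasing2 trans_le_add1)
     (cases d; simp)+
  obtain B where B: "finite B" "B \<subseteq> language \<X>" "suffix n x \<in> followers \<X> B"
      "\<forall>z\<in>followers \<X> B. prefix n x \<frown> z \<in> A" using N[OF n(1)] x(1) unfolding decides_def by blast
  have sx: "suffix n x = x" unfolding n_def x(2) by (rule suffix_iter[OF d])
  have "z = x" if "z \<in> followers \<X> B" for z
  proof -
    have "prefix n x \<frown> z \<in> A" using that B(4) by blast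
    moreover have "(prefix n x \<frown> z) i = x i" if "i < M" for i using that n by simp
    ultimately have "prefix n x \<frown> z = x" using M by blast
    then show ?thesis using sx by (metis prefix_suffix same_concat_eq)
  qed
  moreover have "d\<^sup>\<omega> \<in> followers \<X> B" using B(3) sx x by simp
  moreover have "d \<in> language \<X>" using iter_in_language d xX x by blast
  ultimately show False using L B(1,2) d x unfolding condition_L_def by blast
qed

section \<open>Finite covers and compact cofinality\<close>

definition multi_cyl :: "'a list set \<Rightarrow> 'a list \<Rightarrow> 'a list \<Rightarrow> 'a word set" where
  "multi_cyl B \<gamma> \<alpha> = \<X> \<inter> (\<Inter>\<beta>\<in>B. cyl \<X> (\<beta> @ \<gamma>) \<alpha>)"

lemma multi_cyl_bool_alg: "finite B \<Longrightarrow> multi_cyl B \<gamma> \<alpha> \<in> bool_alg \<X>"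
  unfolding multi_cyl_def by (intro INT_bool_alg cyl_bool_alg)

text \<open>The tail \<open>x\<close> is determined by \<open>y\<close> and \<alpha>, hence is the
  same for all \<beta>. So these are the points \<open>\<alpha> \<frown> x\<close> with
  \<open>\<gamma> \<frown> x \<in> followers \<X> B\<close>: translates of pieces of the follower
  set.\<close>

lemma mem_multi_cyl:
  assumes "B \<noteq> {}"
  shows "y \<in> multi_cyl B \<gamma> \<alpha> \<longleftrightarrow> y \<in> \<X> \<and> (\<exists>x. y = \<alpha> \<frown> x \<and> (\<forall>\<beta>\<in>B. (\<beta> @ \<gamma>) \<frown> x \<in> \<X>))"
proof
  assume y: "y \<in> multi_cyl B \<gamma> \<alpha>"
  obtain \<beta> where "\<beta> \<in> B" using assms by blast
  then have "y \<in> cyl \<X> (\<beta> @ \<gamma>) \<alpha>" using y unfolding multi_cyl_def by blast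
  then obtain x where x: "y = \<alpha> \<frown> x" unfolding cyl_def by blast
  then show "y \<in> \<X> \<and> (\<exists>x. y = \<alpha> \<frown> x \<and> (\<forall>\<beta>\<in>B. (\<beta> @ \<gamma>) \<frown> x \<in> \<X>))"
    using y unfolding multi_cyl_def by (auto simp: conc_mem_cyl)
qed (auto simp: multi_cyl_def conc_mem_cyl)

definition covered :: "'a list set \<Rightarrow> 'a word set \<Rightarrow> bool" where
  "covered B T \<longleftrightarrow> (\<exists>C. finite C \<and> T \<subseteq> (\<Union>(\<gamma>, \<alpha>)\<in>C. multi_cyl B \<gamma> \<alpha>))"

text \<open>Nets enter only here: compact cofinality says that finitely many of the sets
  \<open>\<Inter>\<beta>\<in>B. C(\<beta>\<gamma>, \<alpha>)\<close> cover \<open>\<X>\<close>.\<close>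

lemma compactly_cofinal_cover:
  assumes cc: "compactly_cofinal \<X>"
    and B: "finite B" "B \<subseteq> language \<X>" "followers \<X> B \<noteq> {}" "B \<noteq> {}"
  shows "covered B \<X>"
proof (rule ccontr)
  assume not: "\<not> covered B \<X>"
  \<comment> \<open>The net is indexed by the finite candidate covers, and \<open>x C\<close> is a
    point that \<open>C\<close> misses. A subnet eventually passes the index
    \<open>{(\<gamma>, \<alpha>)}\<close>, where its points must avoid the very set that contains
    them.\<close>
  define I :: "('a list \<times> 'a list) set set" where "I = {C. finite C}"
  have "\<forall>C\<in>I. \<exists>x. x \<in> \<X> \<and> x \<notin> (\<Union>(\<gamma>, \<alpha>)\<in>C. multi_cyl B \<gamma> \<alpha>)"
    using not unfolding covered_def I_def by blast
  then obtain x where x: "\<And>C. C \<in> I \<Longrightarrow> x C \<in> \<X> \<and> x C \<notin> (\<Union>(\<gamma>, \<alpha>)\<in>C. multi_cyl B \<gamma> \<alpha>)" by metis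
  have "C \<union> C' \<in> I" if "C \<in> I" "C' \<in> I" for C C' using that by (simp add: I_def)
  then have "\<forall>C\<in>I. \<forall>C'\<in>I. \<exists>D\<in>I. C \<subseteq> D \<and> C' \<subseteq> D" by (meson Un_upper1 Un_upper2)
  moreover have "I \<noteq> {}" by (auto simp: I_def)
  ultimately have dir: "directed_set I (\<subseteq>)"
    unfolding directed_set_def by (auto simp: reflp_on_def transp_on_def)
  have "x \<in> I \<rightarrow> \<X>" using x by blast
  from compactly_cofinal_any_index[OF cc B(1-3) dir this] obtain \<alpha> \<gamma> J r' h where
    J: "subnet_map I (\<subseteq>) (J :: ('a list \<times> 'a list) set set) r' h"
    and m: "\<forall>j\<in>J. \<forall>\<beta>\<in>B. x (h j) \<in> cyl \<X> (\<beta> @ \<gamma>) \<alpha>" by blast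
  have "{(\<gamma>, \<alpha>)} \<in> I" by (simp add: I_def)
  then obtain j where j: "j \<in> J" "{(\<gamma>, \<alpha>)} \<subseteq> h j" "h j \<in> I" using J unfolding subnet_map_def by blast
  have "x (h j) \<in> multi_cyl B \<gamma> \<alpha>" using m j x unfolding multi_cyl_def by blast
  then show False using x[OF j(3)] j(2) by blast
qed

text \<open>Pigeonhole for nets: if the net finally left each of the finitely many covering sets, a
  common upper bound would give an index whose point is not covered. Some member is thus visited
  cofinally, and restriction to those visits is the subnet.\<close>

lemma cover_compactly_cofinal:
  assumes cov: "\<And>B. finite B \<Longrightarrow> B \<subseteq> language \<X> \<Longrightarrow> followers \<X> B \<noteq> {} \<Longrightarrow> B \<noteq> {} \<Longrightarrow> covered B \<X>"
  shows "compactly_cofinal \<X>"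
  unfolding compactly_cofinal_def
proof (intro allI impI, elim conjE)
  fix B and I :: "('a word \<times> 'a word set) set" and r and x :: "_ \<Rightarrow> 'a word"
  assume B: "finite B" "B \<subseteq> language \<X>" "followers \<X> B \<noteq> {}"
    and dir: "directed_set I r" and x: "x \<in> I \<rightarrow> \<X>"
  have trans: "r i k" if "r i j" "r j k" "i \<in> I" "j \<in> I" "k \<in> I" for i j k
    using dir that unfolding directed_set_def transp_on_def by blast
  have refl: "r i i" if "i \<in> I" for i
    using dir that unfolding directed_set_def reflp_on_def by blast
  have ub: "\<exists>k\<in>I. r i k \<and> r j k" if "i \<in> I" "j \<in> I" for i j
    using dir that unfolding directed_set_def by blast
  have "\<X> \<noteq> {}" using B(3) unfolding followers_def by blast
  then have Nil: "[] \<in> language \<X>" unfolding language_iff by auto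
  have cof: "\<exists>\<alpha>\<in>language \<X>. \<exists>\<gamma>\<in>language \<X>. \<forall>i\<in>I. \<exists>k\<in>I. r i k \<and> (\<forall>\<beta>\<in>B. x k \<in> cyl \<X> (\<beta> @ \<gamma>) \<alpha>)"
  proof (cases "B = {}")
    case True
    then show ?thesis using Nil refl by blast
  next
    case False
    then obtain C where C: "finite C" "\<X> \<subseteq> (\<Union>(\<gamma>, \<alpha>)\<in>C. multi_cyl B \<gamma> \<alpha>)"
      using cov[OF B] unfolding covered_def by blast
    have "\<exists>c\<in>C. \<forall>i\<in>I. \<exists>k\<in>I. r i k \<and> x k \<in> multi_cyl B (fst c) (snd c)"
    proof (rule ccontr)
      assume "\<not> ?thesis"
      then have *: "\<forall>c\<in>C. \<exists>i\<in>I. \<forall>k\<in>I. r i k \<longrightarrow> x k \<notin> multi_cyl B (fst c) (snd c)" by blast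
      have "\<exists>i\<in>I. \<forall>c\<in>C. \<forall>k\<in>I. r i k \<longrightarrow> x k \<notin> multi_cyl B (fst c) (snd c)"
        using C(1) *
      proof (induction C rule: finite_induct)
        case empty
        then show ?case using dir unfolding directed_set_def by blast
      next
        case (insert c C)
        obtain i where i: "i \<in> I" "\<forall>c\<in>C. \<forall>k\<in>I. r i k \<longrightarrow> x k \<notin> multi_cyl B (fst c) (snd c)"
          using insert by blast
        obtain j where j: "j \<in> I" "\<forall>k\<in>I. r j k \<longrightarrow> x k \<notin> multi_cyl B (fst c) (snd c)"
          using insert.prems by blast
        obtain l where l: "l \<in> I" "r i l" "r j l" using ub i j by blast
        show ?case
        proof (intro bexI[of _ l] ballI impI)
          fix c' k assume "c' \<in> insert c C" "k \<in> I" "r l k"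
          moreover have "r i k" "r j k" using trans l i j \<open>r l k\<close> \<open>k \<in> I\<close> by blast+
          ultimately show "x k \<notin> multi_cyl B (fst c') (snd c')" using i j by blast
        qed (use l in blast)
      qed
      then obtain i where "i \<in> I" "\<forall>c\<in>C. x i \<notin> multi_cyl B (fst c) (snd c)" using refl by blast
      moreover have "x i \<in> \<X>" using x \<open>i \<in> I\<close> by blast
      ultimately show False using C(2) by fastforce
    qed
    then obtain \<gamma> \<alpha> where ga: "\<And>i. i\<in>I \<Longrightarrow> \<exists>k\<in>I. r i k \<and> x k \<in> multi_cyl B \<gamma> \<alpha>" by auto
    \<comment> \<open>A visited member is nonempty, and any point in it shows that both words occur
      in \<X>.\<close>
    obtain i where "i \<in> I" using dir unfolding directed_set_def by blast
    then obtain k where "x k \<in> multi_cyl B \<gamma> \<alpha>" using ga by blast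
    then obtain y where y: "\<alpha> \<frown> y \<in> \<X>" "\<forall>\<beta>\<in>B. \<beta> \<frown> \<gamma> \<frown> y \<in> \<X>"
      unfolding mem_multi_cyl[OF False] by auto
    obtain \<beta> where "\<beta> \<in> B" using False by blast
    then have "\<alpha> \<frown> y \<in> \<X>" "\<beta> \<frown> \<gamma> \<frown> y \<in> \<X>" using y by blast+
    then have "\<alpha> \<in> language \<X>" "\<gamma> \<in> language \<X>" unfolding language_iff using tail_in by blast+
    moreover have "\<forall>\<beta>\<in>B. y \<in> cyl \<X> (\<beta> @ \<gamma>) \<alpha>" if "y \<in> multi_cyl B \<gamma> \<alpha>" for y
      using that unfolding multi_cyl_def by simp
    ultimately show ?thesis using ga by meson
  qed
  then obtain \<alpha> \<gamma> where ag: "\<alpha>\<in>language \<X>" "\<gamma>\<in>language \<X>"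
    and c: "\<And>i. i\<in>I \<Longrightarrow> \<exists>k\<in>I. r i k \<and> (\<forall>\<beta>\<in>B. x k \<in> cyl \<X> (\<beta> @ \<gamma>) \<alpha>)" by blast
  define K where "K = {k \<in> I. \<forall>\<beta>\<in>B. x k \<in> cyl \<X> (\<beta> @ \<gamma>) \<alpha>}"
  have KI: "K \<subseteq> I" unfolding K_def by blast
  have cK: "\<exists>k\<in>K. r i k" if "i \<in> I" for i using c[OF that] unfolding K_def by blast
  have "\<exists>k\<in>K. r i k \<and> r j k" if ij: "i \<in> K" "j \<in> K" for i j
  proof -
    have ijI: "i \<in> I" "j \<in> I" using ij KI by auto
    obtain k where k: "k \<in> I" "r i k" "r j k" using ub[OF ijI] by auto
    obtain l where l: "l \<in> K" "r k l" using cK[OF k(1)] by auto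
    have "l \<in> I" using l KI by auto
    then have "r i l" "r j l" using trans[OF k(2) l(2)] trans[OF k(3) l(2)] ijI k(1) by auto
    then show ?thesis using l(1) by auto
  qed
  moreover have "K \<noteq> {}" using cK dir unfolding directed_set_def by blast
  moreover have "reflp_on K r" "transp_on K r"
    using dir KI unfolding directed_set_def reflp_on_def transp_on_def by blast+
  ultimately have "subnet_map I r K r (\<lambda>k. k)"
    unfolding subnet_map_def directed_set_def monotone_on_def using cK KI by blast
  moreover have "\<forall>j\<in>K. \<forall>\<beta>\<in>B. x ((\<lambda>k. k) j) \<in> cyl \<X> (\<beta> @ \<gamma>) \<alpha>" unfolding K_def by blast
  ultimately show "\<exists>\<alpha>\<in>language \<X>. \<exists>\<gamma>\<in>language \<X>. \<exists>(J :: ('a word \<times> 'a word set) set) r' h.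
      subnet_map I r J r' h \<and> (\<forall>j\<in>J. \<forall>\<beta>\<in>B. x (h j) \<in> cyl \<X> (\<beta> @ \<gamma>) \<alpha>)"
    using ag by blast
qed

end

section \<open>Computing modulo an ideal\<close>

text \<open>Stated over a type class ring instead of a record with carrier, so that ordinary ring
  rewriting is available for the congruence \<open>\<approx>\<close>.\<close>

locale two_sided_ideal =
  fixes J :: "'b::ring_1 set"
  assumes zero_mem: "0 \<in> J"
    and add_mem: "x \<in> J \<Longrightarrow> y \<in> J \<Longrightarrow> x + y \<in> J"
    and mult_left_mem: "x \<in> J \<Longrightarrow> r * x \<in> J"
    and mult_right_mem: "x \<in> J \<Longrightarrow> x * r \<in> J"
begin

definition eqv :: "'b \<Rightarrow> 'b \<Rightarrow> bool" (infix "\<approx>" 50) where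
  "x \<approx> y \<longleftrightarrow> x - y \<in> J"

lemma minus_mem: "x \<in> J \<Longrightarrow> - x \<in> J"
  using mult_left_mem[of x "- 1"] by simp

lemma diff_mem: "x \<in> J \<Longrightarrow> y \<in> J \<Longrightarrow> x - y \<in> J"
  using add_mem[of x "- y"] minus_mem by simp

lemma eqv_refl [simp]: "x \<approx> x"
  by (simp add: eqv_def zero_mem)

lemma eqv_sym: "x \<approx> y \<Longrightarrow> y \<approx> x"
  unfolding eqv_def using minus_mem[of "x - y"] by simp

lemma eqv_trans [trans]: "x \<approx> y \<Longrightarrow> y \<approx> z \<Longrightarrow> x \<approx> z"
  unfolding eqv_def using add_mem[of "x - y" "y - z"] by simp

lemma eqv_add: "x \<approx> x' \<Longrightarrow> y \<approx> y' \<Longrightarrow> x + y \<approx> x' + y'"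
  unfolding eqv_def using add_mem[of "x - x'" "y - y'"] by (simp add: algebra_simps)

lemma eqv_diff: "x \<approx> x' \<Longrightarrow> y \<approx> y' \<Longrightarrow> x - y \<approx> x' - y'"
  unfolding eqv_def using diff_mem[of "x - x'" "y - y'"] by (simp add: algebra_simps)

lemma eqv_mult: "x \<approx> x' \<Longrightarrow> y \<approx> y' \<Longrightarrow> x * y \<approx> x' * y'"
  unfolding eqv_def
  using add_mem[OF mult_right_mem[of "x - x'" y] mult_left_mem[of "y - y'" x']]
  by (simp add: algebra_simps)

lemma eqv_mult_left: "y \<approx> y' \<Longrightarrow> x * y \<approx> x * y'"
  by (rule eqv_mult) simp_all

lemma eqv_mult_right: "x \<approx> x' \<Longrightarrow> x * y \<approx> x' * y"
  by (rule eqv_mult) simp_all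

lemma eqv_zero_iff: "x \<approx> 0 \<longleftrightarrow> x \<in> J"
  by (simp add: eqv_def)

lemma eqv_mem_iff: "x \<approx> y \<Longrightarrow> x \<in> J \<longleftrightarrow> y \<in> J"
  using eqv_trans eqv_sym eqv_zero_iff by blast

end

lemma poly_mapping_add_induct [case_names single add]:
  fixes f :: "'k \<Rightarrow>\<^sub>0 'v::comm_monoid_add"
  assumes single: "\<And>k v. P (Poly_Mapping.single k v)" and add: "\<And>f g. P f \<Longrightarrow> P g \<Longrightarrow> P (f + g)"
  shows "P f"
proof (induction f rule: update_induct)
  case const
  show ?case using single[of undefined 0] by simp
next
  case (update f a b)
  have "Poly_Mapping.update a b f = f + Poly_Mapping.single a b"
    using update(1)
    by (intro poly_mapping_eqI) (auto simp: lookup_update lookup_add lookup_single when_def in_keys_iff)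
  then show ?case using add single update by simp
qed

lemma single_zero_commute:
  fixes f :: "'k::monoid_add \<Rightarrow>\<^sub>0 'r::comm_ring_1"
  shows "Poly_Mapping.single 0 c * f = f * Poly_Mapping.single 0 c"
  by (induction f rule: poly_mapping_add_induct)
    (simp_all add: mult_single mult.commute algebra_simps)

section \<open>Commutation relations modulo an ideal containing the relations\<close>

lemma s_word_Nil [simp]: "s_word [] = 1"
  by (simp add: s_word_def)

lemma s_word_Cons: "s_word (a # w) = gen_s a * s_word w"
  by (simp add: s_word_def)

lemma s_word_append: "s_word (u @ v) = s_word u * s_word v"
  by (simp add: s_word_def)

lemma s_star_word_Nil [simp]: "s_star_word [] = 1"
  by (simp add: s_star_word_def)

lemma s_star_word_Cons: "s_star_word (a # w) = s_star_word w * gen_s_star a"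
  by (simp add: s_star_word_def)

lemma s_star_word_append: "s_star_word (u @ v) = s_star_word v * s_star_word u"
  by (simp add: s_star_word_def)

text \<open>\<open>J\<close> stays arbitrary because the calculus is applied both to the ideal of
  the relations and to larger ideals. \<open>letters\<close> makes relation (iii) available for
  single letters, which yields \<open>s_a s_a\<^sup>*\<close> as a projection; \<open>junk\<close>
  absorbs the symbols of sets outside \<open>bool_alg \<X>\<close>.\<close>

locale subshift_ideal = shift_space \<X> + two_sided_ideal J
  for \<X> :: "'a word set" and J :: "('a, 'r::field) subshift_free set" +
  assumes letters: "[a] \<in> language \<X>"
    and relations: "subshift_relations \<X> \<subseteq> J"
    and junk: "A \<notin> bool_alg \<X> \<Longrightarrow> gen_p A \<in> J"
begin

lemma rel: "x - y \<in> subshift_relations \<X> \<Longrightarrow> x \<approx> y"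
  unfolding eqv_def using relations by blast

lemma Nil_language: "[] \<in> language \<X>"
  using letters unfolding language_iff by (metis conc_empty tail_in)

lemma p_whole: "gen_p \<X> \<approx> 1"
  by (rule rel) (rule subshift_relations.p_whole)

lemma p_empty: "gen_p {} \<approx> 0"
  unfolding eqv_zero_iff using relations subshift_relations.p_empty by blast

lemma p_inter: "A \<in> bool_alg \<X> \<Longrightarrow> B \<in> bool_alg \<X> \<Longrightarrow> gen_p A * gen_p B \<approx> gen_p (A \<inter> B)"
  by (rule eqv_sym, rule rel) (rule subshift_relations.p_inter)

lemma p_union: "A \<in> bool_alg \<X> \<Longrightarrow> B \<in> bool_alg \<X> \<Longrightarrow>
    gen_p (A \<union> B) \<approx> gen_p A + gen_p B - gen_p (A \<inter> B)"
  by (rule rel) (rule subshift_relations.p_union)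

lemma s_star_s: "gen_s a * gen_s_star a * gen_s a \<approx> gen_s a"
  by (rule rel) (rule subshift_relations.s_partial_iso)

lemma star_s_star: "gen_s_star a * gen_s a * gen_s_star a \<approx> gen_s_star a"
  by (rule rel) (rule subshift_relations.s_star_partial_iso)

lemma s_cyl: "\<alpha> \<in> language \<X> \<Longrightarrow> \<beta> \<in> language \<X> \<Longrightarrow>
    s_word \<beta> * s_star_word \<alpha> * s_word \<alpha> * s_star_word \<beta> \<approx> gen_p (cyl \<X> \<alpha> \<beta>)"
  by (rule rel) (rule subshift_relations.s_cyl)

lemma s_star: "gen_s a * gen_s_star a \<approx> gen_p (cyl \<X> [] [a])"
  using s_cyl[OF Nil_language letters[of a]] by (simp add: s_word_Cons s_star_word_Cons)

lemma star_s: "gen_s_star a * gen_s a \<approx> gen_p (cyl \<X> [a] [])"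
  using s_cyl[OF letters[of a] Nil_language] by (simp add: s_word_Cons s_star_word_Cons)

lemma p_commute: "A \<in> bool_alg \<X> \<Longrightarrow> B \<in> bool_alg \<X> \<Longrightarrow> gen_p A * gen_p B \<approx> gen_p B * gen_p A"
  using p_inter[of A B] p_inter[of B A] by (metis eqv_sym eqv_trans Int_commute)

lemma p_compl:
  assumes "A \<in> bool_alg \<X>" shows "gen_p (\<X> - A) \<approx> 1 - gen_p A"
proof -
  have "gen_p (A \<union> (\<X> - A)) \<approx> gen_p A + gen_p (\<X> - A) - gen_p (A \<inter> (\<X> - A))"
    using assms by (intro p_union bool_alg.compl)
  moreover have "A \<union> (\<X> - A) = \<X>" "A \<inter> (\<X> - A) = {}" using bool_alg_subset[OF assms] by auto
  ultimately have "gen_p \<X> \<approx> gen_p A + gen_p (\<X> - A) - gen_p {}" by simp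
  then have "1 \<approx> gen_p A + gen_p (\<X> - A) - gen_p {}" by (rule eqv_trans[OF eqv_sym[OF p_whole]])
  also have "\<dots> \<approx> gen_p A + gen_p (\<X> - A) - 0" by (intro eqv_diff eqv_refl p_empty)
  finally have "1 - gen_p A \<approx> gen_p A + gen_p (\<X> - A) - 0 - gen_p A" by (rule eqv_diff) simp
  then show ?thesis by (simp add: eqv_sym)
qed

lemma s_absorb: "gen_p (cyl \<X> [] [a]) * gen_s a \<approx> gen_s a"
  by (rule eqv_trans[OF eqv_mult_right[OF eqv_sym[OF s_star]] s_star_s])

lemma star_absorb: "gen_s_star a * gen_p (cyl \<X> [] [a]) \<approx> gen_s_star a"
  using eqv_trans[OF eqv_mult_left[OF eqv_sym[OF s_star]]] star_s_star
  by (metis mult.assoc)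

text \<open>Orthogonality is not among the relations; it follows because the ranges are the
  projections of two disjoint cylinders.\<close>

lemma star_s_orth:
  assumes "a \<noteq> b" shows "gen_s_star a * gen_s b \<approx> 0"
proof -
  have "gen_s_star a * gen_s b \<approx>
      (gen_s_star a * gen_p (cyl \<X> [] [a])) * (gen_p (cyl \<X> [] [b]) * gen_s b)"
    by (intro eqv_sym[OF eqv_mult] star_absorb s_absorb)
  also have "\<dots> = gen_s_star a * (gen_p (cyl \<X> [] [a]) * gen_p (cyl \<X> [] [b])) * gen_s b"
    by (simp add: mult.assoc)
  also have "\<dots> \<approx> gen_s_star a * gen_p (cyl \<X> [] [a] \<inter> cyl \<X> [] [b]) * gen_s b"
    by (intro eqv_mult eqv_refl p_inter cyl_bool_alg)
  also have "cyl \<X> [] [a] \<inter> cyl \<X> [] [b] = {}" using assms by (auto simp: cyl_def)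
  also have "gen_s_star a * gen_p {} * gen_s b \<approx> gen_s_star a * 0 * gen_s b"
    by (intro eqv_mult eqv_refl p_empty)
  finally show ?thesis by simp
qed

text \<open>The inner \<open>s_a s_a\<^sup>*\<close> is itself a projection of a cylinder, hence
  commutes with \<open>p_B\<close> and is absorbed by \<open>s_a\<close>.\<close>

lemma star_p_s_mult:
  assumes "A \<in> bool_alg \<X>" "B \<in> bool_alg \<X>"
  shows "gen_s_star a * gen_p (A \<inter> B) * gen_s a \<approx>
    (gen_s_star a * gen_p A * gen_s a) * (gen_s_star a * gen_p B * gen_s a)"
proof -
  let ?Z = "gen_p (cyl \<X> [] [a])"
  have "(gen_s_star a * gen_p A * gen_s a) * (gen_s_star a * gen_p B * gen_s a)
      = gen_s_star a * gen_p A * ((gen_s a * gen_s_star a) * gen_p B) * gen_s a"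
    by (simp add: mult.assoc)
  also have "\<dots> \<approx> gen_s_star a * gen_p A * (?Z * gen_p B) * gen_s a"
    by (intro eqv_mult eqv_refl s_star)
  also have "\<dots> \<approx> gen_s_star a * gen_p A * (gen_p B * ?Z) * gen_s a"
    using assms by (intro eqv_mult eqv_refl p_commute cyl_bool_alg)
  also have "\<dots> = gen_s_star a * (gen_p A * gen_p B) * (?Z * gen_s a)" by (simp add: mult.assoc)
  also have "\<dots> \<approx> gen_s_star a * gen_p (A \<inter> B) * gen_s a"
    using assms by (intro eqv_mult eqv_refl p_inter s_absorb)
  finally show ?thesis by (rule eqv_sym)
qed

text \<open>For cylinders this comes from relation (iii) with one letter added to \<alpha> or
  cancelled from \<beta>. Both sides then respect complements and unions, so induction over the
  generation of \<open>bool_alg \<X>\<close> gives the rest.\<close>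

lemma star_p_s:
  "A \<in> bool_alg \<X> \<Longrightarrow> gen_s_star a * gen_p A * gen_s a \<approx> gen_p (preshift \<X> [a] A)"
proof (induction rule: bool_alg.induct)
  case (cyl \<alpha> \<beta>)
  show ?case
  proof (cases \<beta>)
    case Nil
    have "gen_s_star a * gen_p (cyl \<X> \<alpha> []) * gen_s a \<approx> gen_p (cyl \<X> (\<alpha> @ [a]) [])"
    \<comment> \<open>Relation (iii) speaks only about words of the language; for other words both
      sides vanish.\<close>
    proof (cases "\<alpha> @ [a] \<in> language \<X>")
      case True
      have "gen_s_star a * gen_p (cyl \<X> \<alpha> []) * gen_s a \<approx>
          gen_s_star a * (s_word [] * s_star_word \<alpha> * s_word \<alpha> * s_star_word []) * gen_s a"
        by (intro eqv_mult eqv_refl eqv_sym[OF s_cyl] cyl(1) Nil_language)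
      also have "\<dots> = s_word [] * s_star_word (\<alpha> @ [a]) * s_word (\<alpha> @ [a]) * s_star_word []"
        by (simp add: s_word_append s_star_word_append s_word_Cons s_star_word_Cons mult.assoc)
      also have "\<dots> \<approx> gen_p (cyl \<X> (\<alpha> @ [a]) [])"
        by (intro s_cyl True Nil_language)
      finally show ?thesis .
    next
      case False
      then have no: "\<alpha> \<frown> a ## x \<notin> \<X>" for x unfolding language_iff by simp
      have e: "cyl \<X> \<alpha> [] \<inter> cyl \<X> [] [a] = {}" "cyl \<X> (\<alpha> @ [a]) [] = {}"
        using no by (auto simp: cyl_def)
      have "gen_s_star a * gen_p (cyl \<X> \<alpha> []) * gen_s a \<approx>
          gen_s_star a * gen_p (cyl \<X> \<alpha> []) * (gen_p (cyl \<X> [] [a]) * gen_s a)"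
        by (intro eqv_mult eqv_refl eqv_sym[OF s_absorb])
      also have "\<dots> = gen_s_star a * (gen_p (cyl \<X> \<alpha> []) * gen_p (cyl \<X> [] [a])) * gen_s a"
        by (simp add: mult.assoc)
      also have "\<dots> \<approx> gen_s_star a * gen_p (cyl \<X> \<alpha> [] \<inter> cyl \<X> [] [a]) * gen_s a"
        by (intro eqv_mult eqv_refl p_inter cyl_bool_alg)
      also have "\<dots> \<approx> gen_s_star a * 0 * gen_s a"
        unfolding e by (intro eqv_mult eqv_refl p_empty)
      also have "\<dots> \<approx> gen_p {}" using eqv_sym[OF p_empty] by simp
      finally show ?thesis unfolding e .
    qed
    then show ?thesis unfolding Nil preshift_cyl_Nil .
  next
    case (Cons b \<beta>')
    obtain x where "\<beta> \<frown> x \<in> \<X>" using cyl(2) unfolding language_iff by blast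
    then have "\<beta>' \<frown> x \<in> \<X>" unfolding Cons using tail_in_Cons by simp
    then have b': "\<beta>' \<in> language \<X>" unfolding language_iff by blast
    have "gen_s_star a * gen_p (cyl \<X> \<alpha> \<beta>) * gen_s a \<approx>
        gen_s_star a * (s_word \<beta> * s_star_word \<alpha> * s_word \<alpha> * s_star_word \<beta>) * gen_s a"
      by (intro eqv_mult eqv_refl eqv_sym[OF s_cyl] cyl)
    also have "\<dots> = (gen_s_star a * gen_s b) * (s_word \<beta>' * s_star_word \<alpha> * s_word \<alpha> * s_star_word \<beta>')
        * (gen_s_star b * gen_s a)"
      by (simp add: Cons s_word_Cons s_star_word_Cons mult.assoc)
    also have "\<dots> \<approx> gen_p (preshift \<X> [a] (cyl \<X> \<alpha> (b # \<beta>')))"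
    proof (cases "a = b")
      case True
      have "(gen_s_star a * gen_s b) * (s_word \<beta>' * s_star_word \<alpha> * s_word \<alpha> * s_star_word \<beta>')
        * (gen_s_star b * gen_s a) \<approx> gen_p (cyl \<X> [a] []) * gen_p (cyl \<X> \<alpha> \<beta>') * gen_p (cyl \<X> [a] [])"
        unfolding True by (intro eqv_mult star_s s_cyl cyl(1) b')
      also have "\<dots> \<approx> gen_p (cyl \<X> [a] [] \<inter> cyl \<X> \<alpha> \<beta>') * gen_p (cyl \<X> [a] [])"
        by (intro eqv_mult eqv_refl p_inter cyl_bool_alg)
      also have "\<dots> \<approx> gen_p (cyl \<X> [a] [] \<inter> cyl \<X> \<alpha> \<beta>' \<inter> cyl \<X> [a] [])"
        by (intro p_inter inter_bool_alg cyl_bool_alg)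
      also have "cyl \<X> [a] [] \<inter> cyl \<X> \<alpha> \<beta>' \<inter> cyl \<X> [a] [] = cyl \<X> [a] [] \<inter> cyl \<X> \<alpha> \<beta>'" by blast
      finally show ?thesis unfolding preshift_cyl_Cons using True by simp
    next
      case False
      have "(gen_s_star a * gen_s b) * (s_word \<beta>' * s_star_word \<alpha> * s_word \<alpha> * s_star_word \<beta>')
        * (gen_s_star b * gen_s a) \<approx> 0 * (s_word \<beta>' * s_star_word \<alpha> * s_word \<alpha> * s_star_word \<beta>')
        * (gen_s_star b * gen_s a)"
        by (intro eqv_mult eqv_refl star_s_orth False)
      also have "\<dots> \<approx> gen_p {}" using eqv_sym[OF p_empty] by simp
      finally show ?thesis unfolding preshift_cyl_Cons using False by simp
    qed
    finally show ?thesis unfolding Cons .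
  qed
next
  case whole
  have "gen_s_star a * gen_p \<X> * gen_s a \<approx> gen_s_star a * 1 * gen_s a"
    by (intro eqv_mult eqv_refl p_whole)
  also have "\<dots> \<approx> gen_p (cyl \<X> [a] [])" using star_s by simp
  finally show ?case unfolding preshift_whole .
next
  case (compl A)
  let ?P = "preshift \<X> [a] A" and ?F = "cyl \<X> [a] []"
  have P: "?P \<in> bool_alg \<X>" using compl.hyps by (rule preshift_letter_bool_alg)
  have "?F \<inter> ?P = ?P" using bool_alg_subset[OF compl.hyps]
    by (auto simp: preshift_def mem_cyl_Nil)
  \<comment> \<open>With this, \<open>p_F - p_P\<close> factors as \<open>p_F (1 - p_P)\<close>, the
    projection of the relative complement.\<close>
  then have FP: "gen_p ?F * gen_p ?P \<approx> gen_p ?P" using p_inter[OF cyl_bool_alg P, of "[a]" "[]"] by simp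
  have "gen_s_star a * gen_p (\<X> - A) * gen_s a \<approx> gen_s_star a * (1 - gen_p A) * gen_s a"
    by (intro eqv_mult eqv_refl p_compl compl.hyps)
  also have "\<dots> = gen_s_star a * gen_s a - gen_s_star a * gen_p A * gen_s a"
    by (simp add: algebra_simps)
  also have "\<dots> \<approx> gen_p ?F - gen_p ?P" by (intro eqv_diff star_s compl.IH)
  also have "\<dots> \<approx> gen_p ?F - gen_p ?F * gen_p ?P" by (intro eqv_diff eqv_refl eqv_sym[OF FP])
  also have "\<dots> = gen_p ?F * (1 - gen_p ?P)" by (simp add: algebra_simps)
  also have "\<dots> \<approx> gen_p ?F * gen_p (\<X> - ?P)" by (intro eqv_mult eqv_refl eqv_sym[OF p_compl] P)
  also have "\<dots> \<approx> gen_p (?F \<inter> (\<X> - ?P))" by (intro p_inter cyl_bool_alg bool_alg.compl P)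
  also have "?F \<inter> (\<X> - ?P) = preshift \<X> [a] (\<X> - A)"
    unfolding preshift_compl using bool_alg_subset[OF cyl_bool_alg] by blast
  finally show ?case .
next
  case (union A B)
  have P: "preshift \<X> [a] A \<in> bool_alg \<X>" "preshift \<X> [a] B \<in> bool_alg \<X>"
    using union.hyps by (simp_all add: preshift_letter_bool_alg)
  \<comment> \<open>The union relation involves the intersection, about which the induction says
    nothing; multiplicativity supplies it.\<close>
  have I: "gen_s_star a * gen_p (A \<inter> B) * gen_s a \<approx> gen_p (preshift \<X> [a] A \<inter> preshift \<X> [a] B)"
    using star_p_s_mult[OF union.hyps] eqv_mult[OF union.IH] p_inter[OF P] by (blast intro: eqv_trans)
  have "gen_s_star a * gen_p (A \<union> B) * gen_s a \<approx>
      gen_s_star a * (gen_p A + gen_p B - gen_p (A \<inter> B)) * gen_s a"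
    by (intro eqv_mult eqv_refl p_union union.hyps)
  also have "\<dots> = gen_s_star a * gen_p A * gen_s a + gen_s_star a * gen_p B * gen_s a
      - gen_s_star a * gen_p (A \<inter> B) * gen_s a" by (simp add: algebra_simps)
  also have "\<dots> \<approx> gen_p (preshift \<X> [a] A) + gen_p (preshift \<X> [a] B)
      - gen_p (preshift \<X> [a] A \<inter> preshift \<X> [a] B)"
    by (intro eqv_add eqv_diff union.IH I)
  also have "\<dots> \<approx> gen_p (preshift \<X> [a] (A \<union> B))"
    unfolding preshift_union by (rule eqv_sym[OF p_union[OF P]])
  finally show ?case .
qed

text \<open>Insert \<open>s_a s_a\<^sup>*\<close> before \<open>s_a\<close> and commute it past
  \<open>p_A\<close>. Together with its mirror image \<open>star_p\<close> this lets every
  projection be moved between the two words of a term.\<close>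

lemma p_s:
  assumes "A \<in> bool_alg \<X>"
  shows "gen_p A * gen_s a \<approx> gen_s a * gen_p (preshift \<X> [a] A)"
proof -
  let ?Z = "gen_p (cyl \<X> [] [a])"
  have "gen_p A * gen_s a \<approx> gen_p A * (?Z * gen_s a)"
    by (intro eqv_mult eqv_refl eqv_sym[OF s_absorb])
  also have "\<dots> = (gen_p A * ?Z) * gen_s a" by (simp add: mult.assoc)
  also have "\<dots> \<approx> (?Z * gen_p A) * gen_s a" by (intro eqv_mult eqv_refl p_commute assms cyl_bool_alg)
  also have "\<dots> \<approx> (gen_s a * gen_s_star a * gen_p A) * gen_s a"
    by (intro eqv_mult eqv_refl eqv_sym[OF s_star])
  also have "\<dots> = gen_s a * (gen_s_star a * gen_p A * gen_s a)" by (simp add: mult.assoc)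
  also have "\<dots> \<approx> gen_s a * gen_p (preshift \<X> [a] A)" by (intro eqv_mult eqv_refl star_p_s assms)
  finally show ?thesis .
qed

lemma star_p:
  assumes "A \<in> bool_alg \<X>"
  shows "gen_s_star a * gen_p A \<approx> gen_p (preshift \<X> [a] A) * gen_s_star a"
proof -
  let ?Z = "gen_p (cyl \<X> [] [a])"
  have "gen_s_star a * gen_p A \<approx> (gen_s_star a * ?Z) * gen_p A"
    by (intro eqv_mult eqv_refl eqv_sym[OF star_absorb])
  also have "\<dots> = gen_s_star a * (?Z * gen_p A)" by (simp add: mult.assoc)
  also have "\<dots> \<approx> gen_s_star a * (gen_p A * ?Z)" by (intro eqv_mult eqv_refl p_commute assms cyl_bool_alg)
  also have "\<dots> \<approx> gen_s_star a * (gen_p A * (gen_s a * gen_s_star a))"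
    by (intro eqv_mult eqv_refl eqv_sym[OF s_star])
  also have "\<dots> = (gen_s_star a * gen_p A * gen_s a) * gen_s_star a" by (simp add: mult.assoc)
  also have "\<dots> \<approx> gen_p (preshift \<X> [a] A) * gen_s_star a" by (intro eqv_mult eqv_refl star_p_s assms)
  finally show ?thesis .
qed

end

section \<open>Spanning terms and the removal of stars\<close>

type_synonym ('a, 'r) alg_term = "'r \<times> 'a list \<times> 'a word set \<times> 'a list"

definition term_val :: "('a, 'r::field) alg_term \<Rightarrow> ('a, 'r) subshift_free" where
  "term_val = (\<lambda>(r, \<alpha>, A, \<beta>). Poly_Mapping.single 0 r * s_word \<alpha> * gen_p A * s_star_word \<beta>)"

definition terms_val :: "('a, 'r::field) alg_term list \<Rightarrow> ('a, 'r) subshift_free" where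
  "terms_val ts = sum_list (map term_val ts)"

definition star_part :: "('a, 'r) alg_term \<Rightarrow> 'a list" where
  "star_part = (\<lambda>(r, \<alpha>, A, \<beta>). \<beta>)"

definition proj_part :: "('a, 'r) alg_term \<Rightarrow> 'a word set" where
  "proj_part = (\<lambda>(r, \<alpha>, A, \<beta>). A)"

text \<open>The measure that decreases in \<open>kill_stars\<close>.\<close>

definition star_size :: "('a, 'r) alg_term list \<Rightarrow> nat" where
  "star_size ts = sum_list (map (length \<circ> star_part) ts)"

lemma terms_val_simps [simp]:
  "terms_val [] = 0" "terms_val (t # ts) = term_val t + terms_val ts"
  "terms_val (ts @ us) = terms_val ts + terms_val us"
  by (simp_all add: terms_val_def)

lemma star_size_simps [simp]:
  "star_size [] = 0" "star_size (t # ts) = length (star_part t) + star_size ts"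
  "star_size (ts @ us) = star_size ts + star_size us"
  by (simp_all add: star_size_def)

lemma star_part_simp [simp]: "star_part (r, \<alpha>, A, \<beta>) = \<beta>" by (simp add: star_part_def)
lemma proj_part_simp [simp]: "proj_part (r, \<alpha>, A, \<beta>) = A" by (simp add: proj_part_def)

lemma prod_list_free_gen: "prod_list (map free_gen gs) = Poly_Mapping.single (Monomial gs) 1"
  by (induction gs) (simp_all add: free_gen_def mult_single plus_monomial_def flip: zero_monomial_def)

lemma single_eq_prod_list:
  "Poly_Mapping.single w r = Poly_Mapping.single 0 r * prod_list (map free_gen (factors w))"
  by (simp add: prod_list_free_gen mult_single)

context shift_space
begin

lemma preshift_Nil: "A \<subseteq> \<X> \<Longrightarrow> preshift \<X> [] A = A"
  by (auto simp: preshift_def)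

lemma cyl_Cons_Nil: "cyl \<X> w [] \<inter> preshift \<X> w (cyl \<X> [a] []) = cyl \<X> (a # w) []"
proof -
  have "w \<frown> x \<in> \<X>" "x \<in> \<X>" if "a ## w \<frown> x \<in> \<X>" for x
    using tail_in_Cons[OF that] tail_in by blast+
  then show ?thesis by (auto simp: mem_cyl_Nil preshift_def)
qed

end

context subshift_ideal
begin

lemma p_s_word: "A \<in> bool_alg \<X> \<Longrightarrow> gen_p A * s_word w \<approx> s_word w * gen_p (preshift \<X> w A)"
proof (induction w arbitrary: A)
  case Nil
  then show ?case by (simp add: preshift_Nil bool_alg_subset)
next
  case (Cons a w)
  let ?B = "preshift \<X> [a] A"
  have "gen_p A * s_word (a # w) = (gen_p A * gen_s a) * s_word w"
    by (simp add: s_word_Cons mult.assoc)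
  also have "\<dots> \<approx> (gen_s a * gen_p ?B) * s_word w"
    by (rule eqv_mult_right[OF p_s[OF Cons.prems]])
  also have "\<dots> = gen_s a * (gen_p ?B * s_word w)" by (simp add: mult.assoc)
  also have "\<dots> \<approx> gen_s a * (s_word w * gen_p (preshift \<X> w ?B))"
    by (rule eqv_mult_left[OF Cons.IH[OF preshift_letter_bool_alg[OF Cons.prems]]])
  also have "preshift \<X> w ?B = preshift \<X> (a # w) A"
    by (rule preshift_Cons[OF bool_alg_subset[OF Cons.prems], symmetric])
  finally show ?case by (simp add: s_word_Cons mult.assoc)
qed

lemma star_word_p: "A \<in> bool_alg \<X> \<Longrightarrow> s_star_word w * gen_p A \<approx> gen_p (preshift \<X> w A) * s_star_word w"
proof (induction w arbitrary: A)
  case Nil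
  then show ?case by (simp add: preshift_Nil bool_alg_subset)
next
  case (Cons a w)
  let ?B = "preshift \<X> [a] A"
  have "s_star_word (a # w) * gen_p A = s_star_word w * (gen_s_star a * gen_p A)"
    by (simp add: s_star_word_Cons mult.assoc)
  also have "\<dots> \<approx> s_star_word w * (gen_p ?B * gen_s_star a)"
    by (rule eqv_mult_left[OF star_p[OF Cons.prems]])
  also have "\<dots> = (s_star_word w * gen_p ?B) * gen_s_star a" by (simp add: mult.assoc)
  also have "\<dots> \<approx> (gen_p (preshift \<X> w ?B) * s_star_word w) * gen_s_star a"
    by (rule eqv_mult_right[OF Cons.IH[OF preshift_letter_bool_alg[OF Cons.prems]]])
  also have "preshift \<X> w ?B = preshift \<X> (a # w) A"
    by (rule preshift_Cons[OF bool_alg_subset[OF Cons.prems], symmetric])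
  finally show ?case by (simp add: s_star_word_Cons mult.assoc)
qed

text \<open>Built up from the single-letter case and not read off from relation (iii), so that it
  also covers words outside the language.\<close>

lemma star_word_s_word: "s_star_word w * s_word w \<approx> gen_p (cyl \<X> w [])"
proof (induction w)
  case Nil
  have "cyl \<X> [] [] = \<X>" by (auto simp: mem_cyl_Nil)
  then show ?case using eqv_sym[OF p_whole] by simp
next
  case (Cons a w)
  have "s_star_word (a # w) * s_word (a # w) = s_star_word w * ((gen_s_star a * gen_s a) * s_word w)"
    by (simp add: s_word_Cons s_star_word_Cons mult.assoc)
  also have "\<dots> \<approx> s_star_word w * (gen_p (cyl \<X> [a] []) * s_word w)"
    by (intro eqv_mult eqv_refl star_s)
  also have "\<dots> \<approx> s_star_word w * (s_word w * gen_p (preshift \<X> w (cyl \<X> [a] [])))"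
    by (intro eqv_mult eqv_refl p_s_word cyl_bool_alg)
  also have "\<dots> = (s_star_word w * s_word w) * gen_p (preshift \<X> w (cyl \<X> [a] []))"
    by (simp add: mult.assoc)
  also have "\<dots> \<approx> gen_p (cyl \<X> w []) * gen_p (preshift \<X> w (cyl \<X> [a] []))"
    by (intro eqv_mult eqv_refl Cons.IH)
  also have "\<dots> \<approx> gen_p (cyl \<X> w [] \<inter> preshift \<X> w (cyl \<X> [a] []))"
    by (intro p_inter cyl_bool_alg preshift_bool_alg)
  finally show ?case unfolding cyl_Cons_Nil .
qed

lemma s_word_absorb: "s_word w * gen_p (cyl \<X> w []) \<approx> s_word w"
proof (induction w)
  case Nil
  have "cyl \<X> [] [] = \<X>" by (auto simp: mem_cyl_Nil)
  then show ?case using p_whole by simp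
next
  case (Cons a w)
  let ?P = "preshift \<X> w (cyl \<X> [a] [])"
  have a: "gen_s a * gen_p (cyl \<X> [a] []) \<approx> gen_s a"
    using eqv_trans[OF eqv_mult_left[OF eqv_sym[OF star_s]]] s_star_s by (metis mult.assoc)
  have "s_word (a # w) * gen_p (cyl \<X> (a # w) []) = gen_s a * (s_word w * gen_p (cyl \<X> w [] \<inter> ?P))"
    by (simp add: s_word_Cons mult.assoc cyl_Cons_Nil)
  also have "\<dots> \<approx> gen_s a * (s_word w * (gen_p (cyl \<X> w []) * gen_p ?P))"
    by (intro eqv_mult eqv_refl eqv_sym[OF p_inter] cyl_bool_alg preshift_bool_alg)
  also have "\<dots> = gen_s a * ((s_word w * gen_p (cyl \<X> w [])) * gen_p ?P)" by (simp add: mult.assoc)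
  also have "\<dots> \<approx> gen_s a * (s_word w * gen_p ?P)" by (intro eqv_mult eqv_refl Cons.IH)
  also have "\<dots> \<approx> gen_s a * (gen_p (cyl \<X> [a] []) * s_word w)"
    by (intro eqv_mult eqv_refl eqv_sym[OF p_s_word] cyl_bool_alg)
  also have "\<dots> = (gen_s a * gen_p (cyl \<X> [a] [])) * s_word w" by (simp add: mult.assoc)
  also have "\<dots> \<approx> s_word (a # w)" unfolding s_word_Cons by (rule eqv_mult_right[OF a])
  finally show ?case .
qed

lemma s_word_p_restrict:
  assumes "A \<in> bool_alg \<X>"
  shows "s_word w * gen_p A \<approx> s_word w * gen_p (cyl \<X> w [] \<inter> A)"
proof -
  have "s_word w * gen_p A \<approx> (s_word w * gen_p (cyl \<X> w [])) * gen_p A"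
    by (intro eqv_mult eqv_refl eqv_sym[OF s_word_absorb])
  also have "\<dots> = s_word w * (gen_p (cyl \<X> w []) * gen_p A)" by (simp add: mult.assoc)
  also have "\<dots> \<approx> s_word w * gen_p (cyl \<X> w [] \<inter> A)"
    by (intro eqv_mult eqv_refl p_inter assms cyl_bool_alg)
  finally show ?thesis .
qed

text \<open>Equal leading letters leave only a projection, which moves out of the way to the left;
  for words neither of which extends the other a mismatch is reached, and there
  \<open>star_s_orth\<close> applies.\<close>

lemma star_word_s_word_orth:
  "(\<And>z. v \<noteq> u @ z) \<Longrightarrow> (\<And>z. u \<noteq> v @ z) \<Longrightarrow> s_star_word u * s_word v \<approx> 0"
proof (induction u arbitrary: v)
  case Nil
  then show ?case by force
next
  case (Cons a u)
  then obtain b v' where v: "v = b # v'" by (cases v) auto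
  have eq: "s_star_word (a # u) * s_word v = s_star_word u * (gen_s_star a * gen_s b) * s_word v'"
    by (simp add: v s_word_Cons s_star_word_Cons mult.assoc)
  show ?case
  proof (cases "a = b")
    case True
    have IH: "s_star_word u * s_word v' \<approx> 0"
      using Cons.prems unfolding v True by (intro Cons.IH) auto
    have "s_star_word u * (gen_s_star a * gen_s b) * s_word v'
        \<approx> s_star_word u * gen_p (cyl \<X> [b] []) * s_word v'"
      unfolding True by (intro eqv_mult eqv_refl star_s)
    also have "\<dots> \<approx> (gen_p (preshift \<X> u (cyl \<X> [b] [])) * s_star_word u) * s_word v'"
      by (intro eqv_mult eqv_refl star_word_p cyl_bool_alg)
    also have "\<dots> = gen_p (preshift \<X> u (cyl \<X> [b] [])) * (s_star_word u * s_word v')"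
      by (simp add: mult.assoc)
    also have "\<dots> \<approx> gen_p (preshift \<X> u (cyl \<X> [b] [])) * 0" by (intro eqv_mult eqv_refl IH)
    finally show ?thesis unfolding eq by simp
  next
    case False
    have "s_star_word u * (gen_s_star a * gen_s b) * s_word v' \<approx> s_star_word u * 0 * s_word v'"
      by (intro eqv_mult eqv_refl star_s_orth False)
    then show ?thesis unfolding eq by simp
  qed
qed

lemma term_mult_p:
  assumes "A \<in> bool_alg \<X>" "B \<in> bool_alg \<X>"
  shows "term_val (r, \<alpha>, A, \<beta>) * gen_p B \<approx> term_val (r, \<alpha>, A \<inter> preshift \<X> \<beta> B, \<beta>)"
proof -
  let ?c = "Poly_Mapping.single 0 r"
  have "term_val (r, \<alpha>, A, \<beta>) * gen_p B = (?c * s_word \<alpha> * gen_p A) * (s_star_word \<beta> * gen_p B)"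
    by (simp add: term_val_def mult.assoc)
  also have "\<dots> \<approx> (?c * s_word \<alpha> * gen_p A) * (gen_p (preshift \<X> \<beta> B) * s_star_word \<beta>)"
    by (intro eqv_mult eqv_refl star_word_p assms)
  also have "\<dots> = (?c * s_word \<alpha>) * (gen_p A * gen_p (preshift \<X> \<beta> B)) * s_star_word \<beta>"
    by (simp add: mult.assoc)
  also have "\<dots> \<approx> (?c * s_word \<alpha>) * gen_p (A \<inter> preshift \<X> \<beta> B) * s_star_word \<beta>"
    by (intro eqv_mult eqv_refl p_inter preshift_bool_alg assms)
  finally show ?thesis by (simp add: term_val_def)
qed

lemma term_mult_star: "term_val (r, \<alpha>, A, \<beta>) * gen_s_star b = term_val (r, \<alpha>, A, b # \<beta>)"
  by (simp add: term_val_def s_star_word_Cons mult.assoc)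

lemma term_mult_s_Nil:
  assumes "A \<in> bool_alg \<X>"
  shows "term_val (r, \<alpha>, A, []) * gen_s a \<approx> term_val (r, \<alpha> @ [a], preshift \<X> [a] A, [])"
  using eqv_mult_left[OF p_s[OF assms, of a], of "Poly_Mapping.single 0 r * s_word \<alpha>"]
  by (simp add: term_val_def s_word_append s_word_Cons mult.assoc)

lemma term_mult_s_Cons:
  assumes "A \<in> bool_alg \<X>"
  shows "term_val (r, \<alpha>, A, a # \<beta>) * gen_s a \<approx> term_val (r, \<alpha>, A \<inter> preshift \<X> \<beta> (cyl \<X> [a] []), \<beta>)"
proof -
  have "term_val (r, \<alpha>, A, a # \<beta>) * gen_s a = term_val (r, \<alpha>, A, \<beta>) * (gen_s_star a * gen_s a)"
    by (simp add: term_val_def s_star_word_Cons mult.assoc)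
  also have "\<dots> \<approx> term_val (r, \<alpha>, A, \<beta>) * gen_p (cyl \<X> [a] [])"
    by (intro eqv_mult eqv_refl star_s)
  also have "\<dots> \<approx> term_val (r, \<alpha>, A \<inter> preshift \<X> \<beta> (cyl \<X> [a] []), \<beta>)"
    by (intro term_mult_p assms cyl_bool_alg)
  finally show ?thesis .
qed

lemma term_mult_s_orth:
  assumes "a \<noteq> b"
  shows "term_val (r, \<alpha>, A, b # \<beta>) * gen_s a \<approx> 0"
proof -
  have "term_val (r, \<alpha>, A, b # \<beta>) * gen_s a = term_val (r, \<alpha>, A, \<beta>) * (gen_s_star b * gen_s a)"
    by (simp add: term_val_def s_star_word_Cons mult.assoc)
  also have "\<dots> \<approx> term_val (r, \<alpha>, A, \<beta>) * 0"
    using assms by (intro eqv_mult eqv_refl star_s_orth) simp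
  finally show ?thesis by simp
qed

text \<open>\<open>s_a\<^sup>* s_a s_a\<^sup>* = s_a\<^sup>*\<close> says that
  \<open>s_a\<^sup>*\<close> annihilates the complement of the range of \<open>s_a\<close>.\<close>

lemma term_mult_compl_orth: "term_val (r, \<alpha>, A, a # \<beta>) * gen_p (\<X> - cyl \<X> [] [a]) \<approx> 0"
proof -
  have "gen_s_star a * gen_p (\<X> - cyl \<X> [] [a]) \<approx> gen_s_star a * (1 - gen_p (cyl \<X> [] [a]))"
    by (intro eqv_mult eqv_refl p_compl cyl_bool_alg)
  also have "\<dots> = gen_s_star a - gen_s_star a * gen_p (cyl \<X> [] [a])" by (simp add: algebra_simps)
  also have "\<dots> \<approx> gen_s_star a - gen_s_star a" by (intro eqv_diff eqv_refl star_absorb)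
  finally have "gen_s_star a * gen_p (\<X> - cyl \<X> [] [a]) \<approx> 0" by simp
  then have "term_val (r, \<alpha>, A, \<beta>) * (gen_s_star a * gen_p (\<X> - cyl \<X> [] [a])) \<approx> term_val (r, \<alpha>, A, \<beta>) * 0"
    by (rule eqv_mult_left)
  then show ?thesis by (simp add: term_val_def s_star_word_Cons mult.assoc)
qed

definition good :: "('a, 'r) alg_term list \<Rightarrow> bool" where
  "good ts \<longleftrightarrow> (\<forall>t\<in>set ts. proj_part t \<in> bool_alg \<X>)"

lemma good_simps [simp]: "good []" "good (t # ts) \<longleftrightarrow> proj_part t \<in> bool_alg \<X> \<and> good ts"
    "good (ts @ us) \<longleftrightarrow> good ts \<and> good us"
  by (auto simp: good_def)

definition starts_with :: "'a \<Rightarrow> ('a, 'r) alg_term \<Rightarrow> bool" where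
  "starts_with a t \<longleftrightarrow> (\<exists>\<beta>. star_part t = a # \<beta>)"

text \<open>The letter cancels against a leading \<open>a\<close>, annihilates a term with another
  leading letter, or joins the left word if there is no star. Only the first case forces progress,
  and no case lengthens a star word.\<close>

lemma term_mult_s:
  assumes "proj_part t \<in> bool_alg \<X>"
  shows "\<exists>us. good us \<and> term_val t * gen_s a \<approx> terms_val us \<and>
    (if starts_with a t then star_size us < length (star_part t) else star_size us \<le> length (star_part t))"
proof -
  obtain r \<alpha> A \<beta> where t: "t = (r, \<alpha>, A, \<beta>)" by (cases t)
  have A: "A \<in> bool_alg \<X>" using assms t by simp
  show ?thesis
  proof (cases \<beta>)
    case Nil
    then show ?thesis using term_mult_s_Nil[OF A, of r \<alpha> a] preshift_letter_bool_alg[OF A, of a]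
      by (intro exI[of _ "[(r, \<alpha> @ [a], preshift \<X> [a] A, [])]"]) (simp add: t starts_with_def)
  next
    case (Cons b \<beta>')
    show ?thesis
    proof (cases "a = b")
      case True
      have "A \<inter> preshift \<X> \<beta>' (cyl \<X> [a] []) \<in> bool_alg \<X>"
        by (intro inter_bool_alg A preshift_bool_alg cyl_bool_alg)
      then show ?thesis using term_mult_s_Cons[OF A, of r \<alpha> a \<beta>'] True Cons
        by (intro exI[of _ "[(r, \<alpha>, A \<inter> preshift \<X> \<beta>' (cyl \<X> [a] []), \<beta>')]"]) (simp add: t starts_with_def)
    next
      case False
      then show ?thesis using term_mult_s_orth[OF False, of r \<alpha> A \<beta>'] Cons
        by (intro exI[of _ "[]"]) (simp add: t starts_with_def)
    qed
  qed
qed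

lemma term_mult_compl:
  assumes "proj_part t \<in> bool_alg \<X>"
  shows "\<exists>us. good us \<and> term_val t * gen_p (\<X> - cyl \<X> [] [a]) \<approx> terms_val us \<and>
    (if starts_with a t then star_size us < length (star_part t) else star_size us \<le> length (star_part t))"
proof -
  obtain r \<alpha> A \<beta> where t: "t = (r, \<alpha>, A, \<beta>)" by (cases t)
  have A: "A \<in> bool_alg \<X>" using assms t by simp
  have Z: "\<X> - cyl \<X> [] [a] \<in> bool_alg \<X>" by (intro bool_alg.compl cyl_bool_alg)
  show ?thesis
  proof (cases "starts_with a t")
    case True
    then obtain \<beta>' where "\<beta> = a # \<beta>'" unfolding starts_with_def t by auto
    then show ?thesis using term_mult_compl_orth[of r \<alpha> A a \<beta>'] True
      by (intro exI[of _ "[]"]) (simp add: t)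
  next
    case False
    have "A \<inter> preshift \<X> \<beta> (\<X> - cyl \<X> [] [a]) \<in> bool_alg \<X>"
      by (intro inter_bool_alg A preshift_bool_alg Z)
    then show ?thesis using term_mult_p[OF A Z, of r \<alpha> \<beta>] False
      by (intro exI[of _ "[(r, \<alpha>, A \<inter> preshift \<X> \<beta> (\<X> - cyl \<X> [] [a]), \<beta>)]"]) (simp add: t)
  qed
qed

lemma terms_mult:
  assumes step: "\<And>t. proj_part t \<in> bool_alg \<X> \<Longrightarrow> \<exists>us. good us \<and> term_val t * g \<approx> terms_val us \<and>
    (if starts_with a t then star_size us < length (star_part t) else star_size us \<le> length (star_part t))"
    and "good ts"
  shows "\<exists>us. good us \<and> terms_val ts * g \<approx> terms_val us \<and>
    (if \<exists>t\<in>set ts. starts_with a t then star_size us < star_size ts else star_size us \<le> star_size ts)"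
  using \<open>good ts\<close>
proof (induction ts)
  case Nil
  then show ?case by (intro exI[of _ "[]"]) simp
next
  case (Cons t ts)
  obtain us where us: "good us" "terms_val ts * g \<approx> terms_val us"
    "if \<exists>t\<in>set ts. starts_with a t then star_size us < star_size ts else star_size us \<le> star_size ts"
    using Cons by auto
  obtain vs where vs: "good vs" "term_val t * g \<approx> terms_val vs"
    "if starts_with a t then star_size vs < length (star_part t) else star_size vs \<le> length (star_part t)"
    using step[of t] Cons.prems by auto
  have "terms_val (t # ts) * g \<approx> terms_val (vs @ us)"
    using eqv_add[OF vs(2) us(2)] by (simp add: algebra_simps)
  then show ?case using us(1,3) vs(1,3)
    by (intro exI[of _ "vs @ us"]) (auto split: if_splits)
qed

text \<open>Take \<open>a\<close> as the leading letter of some remaining star word: multiplication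
  by \<open>s_a\<close> and by the complement of its range both lower the measure, and whichever
  leaves \<open>f\<close> outside \<open>J\<close> is used.\<close>

lemma kill_stars:
  assumes "good ts" "f \<approx> terms_val ts" "f \<notin> J"
  shows "\<exists>g us. good us \<and> f * g \<approx> terms_val us \<and> f * g \<notin> J \<and> (\<forall>t\<in>set us. star_part t = [])"
  using assms
proof (induction "star_size ts" arbitrary: ts f rule: less_induct)
  case less
  show ?case
  proof (cases "\<forall>t\<in>set ts. star_part t = []")
    case True
    then show ?thesis using less.prems by (intro exI[of _ 1] exI[of _ ts]) simp
  next
    case False
    then obtain t a \<beta> where "t \<in> set ts" "star_part t = a # \<beta>" by (meson neq_Nil_conv)
    then have ex: "\<exists>t\<in>set ts. starts_with a t" unfolding starts_with_def by blast
    have step: ?thesis if g: "f * g \<notin> J"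
      and us: "\<exists>us. good us \<and> terms_val ts * g \<approx> terms_val us \<and>
        (if \<exists>t\<in>set ts. starts_with a t then star_size us < star_size ts else star_size us \<le> star_size ts)" for g
    proof -
      obtain us where us: "good us" "terms_val ts * g \<approx> terms_val us" "star_size us < star_size ts"
        using us ex by auto
      have "f * g \<approx> terms_val us"
        by (rule eqv_trans[OF eqv_mult_right[OF less.prems(2)] us(2)])
      from less.hyps[OF us(3,1) this g] obtain h vs where
        "good vs" "f * g * h \<approx> terms_val vs" "f * g * h \<notin> J" "\<forall>t\<in>set vs. star_part t = []" by blast
      then show ?thesis by (intro exI[of _ "g * h"] exI[of _ vs]) (simp add: mult.assoc)
    qed
    show ?thesis
    proof (cases "f * gen_p (\<X> - cyl \<X> [] [a]) \<in> J")
      case False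
      then show ?thesis by (rule step) (rule terms_mult[OF term_mult_compl less.prems(1)])
    next
      case True
      \<comment> \<open>Otherwise \<open>f s_a s_a\<^sup>*\<close> and
        \<open>f (1 - s_a s_a\<^sup>* )\<close> both lie in \<open>J\<close>, and their sum is
        \<open>f\<close>.\<close>
      have "f * gen_s a \<notin> J"
      proof
        assume "f * gen_s a \<in> J"
        then have "f * gen_s a * gen_s_star a \<approx> 0" unfolding eqv_zero_iff by (rule mult_right_mem)
        then have "f * (gen_s a * gen_s_star a) \<approx> 0" by (simp add: mult.assoc)
        then have Z: "f * gen_p (cyl \<X> [] [a]) \<approx> 0"
          by (rule eqv_trans[OF eqv_mult_left[OF eqv_sym[OF s_star]]])
        have "f = f * (1 - gen_p (cyl \<X> [] [a])) + f * gen_p (cyl \<X> [] [a])" by (simp add: algebra_simps)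
        also have "\<dots> \<approx> f * gen_p (\<X> - cyl \<X> [] [a]) + 0"
          by (intro eqv_add eqv_mult eqv_refl eqv_sym[OF p_compl] cyl_bool_alg Z)
        also have "\<dots> \<approx> 0" using True by (simp add: eqv_zero_iff)
        finally show False using less.prems(3) by (simp add: eqv_zero_iff)
      qed
      then show ?thesis by (rule step) (rule terms_mult[OF term_mult_s less.prems(1)])
    qed
  qed
qed

lemma span_mult_gen:
  assumes "good ts" "f \<approx> terms_val ts"
  shows "\<exists>us. good us \<and> f * free_gen g \<approx> terms_val us"
proof -
  have "\<exists>us. good us \<and> terms_val ts * free_gen g \<approx> terms_val us" using assms(1)
  proof (induction ts)
    case Nil
    then show ?case by (intro exI[of _ "[]"]) simp
  next
    case (Cons t ts)
    obtain us where us: "good us" "terms_val ts * free_gen g \<approx> terms_val us" using Cons by auto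
    obtain r \<alpha> A \<beta> where t: "t = (r, \<alpha>, A, \<beta>)" by (cases t)
    have A: "A \<in> bool_alg \<X>" using Cons.prems t by simp
    have "\<exists>vs. good vs \<and> term_val t * free_gen g \<approx> terms_val vs"
    proof (cases g)
      case (Proj B)
      show ?thesis
      proof (cases "B \<in> bool_alg \<X>")
        case True
        have "A \<inter> preshift \<X> \<beta> B \<in> bool_alg \<X>" by (intro inter_bool_alg A preshift_bool_alg True)
        then show ?thesis unfolding t Proj using term_mult_p[OF A True, of r \<alpha> \<beta>]
          by (intro exI[of _ "[(r, \<alpha>, A \<inter> preshift \<X> \<beta> B, \<beta>)]"]) simp
      next
        case False
        then have "term_val t * free_gen g \<in> J" unfolding Proj by (intro mult_left_mem junk)
        then show ?thesis by (intro exI[of _ "[]"]) (simp add: eqv_zero_iff)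
      qed
    next
      case (Iso a)
      then show ?thesis using term_mult_s[of t a] Cons.prems by auto
    next
      case (Iso_star a)
      then show ?thesis unfolding t using A
        by (intro exI[of _ "[(r, \<alpha>, A, a # \<beta>)]"]) (simp add: term_mult_star)
    qed
    then obtain vs where vs: "good vs" "term_val t * free_gen g \<approx> terms_val vs" by blast
    have "terms_val (t # ts) * free_gen g \<approx> terms_val (vs @ us)"
      using eqv_add[OF vs(2) us(2)] by (simp add: algebra_simps)
    then show ?case using us(1) vs(1) by (intro exI[of _ "vs @ us"]) simp
  qed
  then obtain us where "good us" "terms_val ts * free_gen g \<approx> terms_val us" by blast
  then show ?thesis using eqv_trans[OF eqv_mult_right[OF assms(2)]] by blast
qed

text \<open>Each monomial is reached from a scalar, written with \<open>1 \<approx> p_\<X>\<close>,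
  by appending generators on the right; surplus projection symbols contribute zero.\<close>

lemma span: "\<exists>ts. good ts \<and> f \<approx> terms_val ts"
proof (induction f rule: poly_mapping_add_induct)
  case (single w r)
  have "\<exists>ts. good ts \<and> Poly_Mapping.single 0 r * prod_list (map free_gen gs) \<approx> terms_val ts" for gs
  proof (induction gs rule: rev_induct)
    case Nil
    have "Poly_Mapping.single 0 r * 1 \<approx> Poly_Mapping.single 0 r * gen_p \<X>"
      by (intro eqv_mult eqv_refl eqv_sym[OF p_whole])
    then show ?case
      by (intro exI[of _ "[(r, [], \<X>, [])]"]) (simp add: term_val_def bool_alg.whole)
  next
    case (snoc g gs)
    then show ?case using span_mult_gen by (fastforce simp: mult.assoc[symmetric])
  qed
  then show ?case by (subst single_eq_prod_list)
next
  case (add f g)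
  then obtain ts us where "good ts" "f \<approx> terms_val ts" "good us" "g \<approx> terms_val us" by blast
  then show ?case by (intro exI[of _ "ts @ us"]) (simp add: eqv_add)
qed

end

section \<open>From an element outside the ideal to a projection\<close>

lemma append_overlap:
  assumes "u @ m @ z = v @ m"
  shows "\<exists>d. v = u @ d \<and> m @ z = d @ m"
proof -
  have "length u \<le> length v" using arg_cong[OF assms, of length] by simp
  then show ?thesis using assms by (auto simp: append_eq_append_conv2)
qed

text \<open>A word that overlaps itself with shift \<open>d\<close> satisfies
  \<open>m ! i = m ! (i - length d)\<close> beyond the first \<open>length d\<close> letters, so it
  is a beginning of the periodic sequence of \<open>d\<close>.\<close>

lemma overlap_iter:
  assumes "m @ z = d @ m" "d \<noteq> []" "i < length m"
  shows "m ! i = d\<^sup>\<omega> i"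
  using assms(3)
proof (induction i rule: less_induct)
  case (less i)
  have "m ! i = (d @ m) ! i" using assms(1) less.prems by (metis nth_append)
  have pos: "0 < length d" using assms(2) by simp
  show ?case
  proof (cases "i < length d")
    case True
    then show ?thesis using \<open>m ! i = (d @ m) ! i\<close> pos by (simp add: nth_append)
  next
    case False
    then have "m ! i = m ! (i - length d)" using \<open>m ! i = (d @ m) ! i\<close> by (simp add: nth_append)
    also have "\<dots> = d\<^sup>\<omega> (i - length d)" using False less.prems pos by (intro less.IH) linarith+
    also have "\<dots> = d\<^sup>\<omega> i" using False pos by (simp add: le_mod_geq)
    finally show ?thesis .
  qed
qed

lemma (in two_sided_ideal) eqv_sum:
  "finite D \<Longrightarrow> (\<And>a. a \<in> D \<Longrightarrow> f a \<approx> g a) \<Longrightarrow> sum f D \<approx> sum g D"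
  by (induction D rule: finite_induct) (simp_all add: eqv_add)

lemma (in two_sided_ideal) sum_mem:
  "finite D \<Longrightarrow> (\<And>a. a \<in> D \<Longrightarrow> f a \<in> J) \<Longrightarrow> sum f D \<in> J"
  by (induction D rule: finite_induct) (simp_all add: add_mem zero_mem)

context subshift_ideal
begin

lemma p_split:
  assumes "A \<in> bool_alg \<X>" "B \<in> bool_alg \<X>"
  shows "gen_p A \<approx> gen_p (A \<inter> B) + gen_p (A - B)"
proof -
  have "gen_p ((A \<inter> B) \<union> (A - B)) \<approx> gen_p (A \<inter> B) + gen_p (A - B) - gen_p ((A \<inter> B) \<inter> (A - B))"
    by (intro p_union inter_bool_alg diff_bool_alg assms)
  moreover have "(A \<inter> B) \<union> (A - B) = A" "(A \<inter> B) \<inter> (A - B) = {}" by auto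
  ultimately have "gen_p A \<approx> gen_p (A \<inter> B) + gen_p (A - B) - gen_p {}" by simp
  also have "\<dots> \<approx> gen_p (A \<inter> B) + gen_p (A - B) - 0" by (intro eqv_diff eqv_refl p_empty)
  finally show ?thesis by simp
qed

lemma p_mono_mem:
  assumes "gen_p B \<in> J" "A \<subseteq> B" "A \<in> bool_alg \<X>" "B \<in> bool_alg \<X>"
  shows "gen_p A \<in> J"
proof -
  have "gen_p A * gen_p B \<approx> gen_p A"
    using p_inter[OF assms(3,4)] assms(2) by (simp add: Int_absorb2)
  then show ?thesis using eqv_mem_iff mult_left_mem[OF assms(1)] by blast
qed

text \<open>Each set splits the current projection into two, and both halves cannot send
  \<open>f\<close> into \<open>J\<close>. The result is an atom only relative to the finitely many
  listed sets.\<close>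

lemma atom_exists:
  assumes "f \<notin> J" "\<And>A. A \<in> set As \<Longrightarrow> A \<in> bool_alg \<X>"
  shows "\<exists>P\<in>bool_alg \<X>. f * gen_p P \<notin> J \<and> (\<forall>A\<in>set As. P \<subseteq> A \<or> P \<inter> A = {})"
  using assms(2)
proof (induction As)
  case Nil
  have "f * gen_p \<X> \<approx> f * 1" by (rule eqv_mult_left[OF p_whole])
  then have "f * gen_p \<X> \<notin> J" using assms(1) eqv_mem_iff by simp
  then show ?case using bool_alg.whole by auto
next
  case (Cons A As)
  then obtain P where P: "P \<in> bool_alg \<X>" "f * gen_p P \<notin> J" "\<forall>A\<in>set As. P \<subseteq> A \<or> P \<inter> A = {}"
    by auto
  have A: "A \<in> bool_alg \<X>" using Cons.prems by simp
  have "f * gen_p P \<approx> f * (gen_p (P \<inter> A) + gen_p (P - A))"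
    by (rule eqv_mult_left[OF p_split[OF P(1) A]])
  then have "f * gen_p (P \<inter> A) + f * gen_p (P - A) \<notin> J"
    using P(2) eqv_mem_iff by (simp add: distrib_left)
  then consider "f * gen_p (P \<inter> A) \<notin> J" | "f * gen_p (P - A) \<notin> J" using add_mem by blast
  then show ?case
  proof cases
    case 1
    have "\<forall>A'\<in>set (A # As). P \<inter> A \<subseteq> A' \<or> P \<inter> A \<inter> A' = {}" using P(3) by auto
    then show ?thesis using 1 inter_bool_alg[OF P(1) A] by blast
  next
    case 2
    have "\<forall>A'\<in>set (A # As). P - A \<subseteq> A' \<or> (P - A) \<inter> A' = {}" using P(3) by auto
    then show ?thesis using 2 diff_bool_alg[OF P(1) A] by blast
  qed
qed

definition word_part :: "('a, 'r) alg_term \<Rightarrow> 'a list" where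
  "word_part = (\<lambda>(r, \<alpha>, A, \<beta>). \<alpha>)"

text \<open>On \<open>P\<close> a term either vanishes, because \<open>P\<close> misses its set or
  the domain \<open>cyl \<X> \<alpha> []\<close> of \<open>s_\<alpha>\<close>, or becomes a multiple
  of \<open>s_\<alpha> p_P\<close>. Terms with the same word are merged, so that distinct summands
  have distinct words.\<close>

lemma terms_mult_atom:
  assumes P: "P \<in> bool_alg \<X>" and us: "good us" "\<forall>t\<in>set us. star_part t = []"
    and at: "\<forall>t\<in>set us. P \<subseteq> proj_part t \<or> P \<inter> proj_part t = {}"
      "\<forall>t\<in>set us. P \<subseteq> cyl \<X> (word_part t) [] \<or> P \<inter> cyl \<X> (word_part t) [] = {}"
  shows "\<exists>D c. finite D \<and> (\<forall>\<alpha>\<in>D. P \<subseteq> cyl \<X> \<alpha> []) \<and>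
    terms_val us * gen_p P \<approx> (\<Sum>\<alpha>\<in>D. Poly_Mapping.single 0 (c \<alpha>) * s_word \<alpha> * gen_p P)"
  using us at
proof (induction us)
  case Nil
  show ?case by (intro exI[of _ "{}"] exI[of _ "\<lambda>_. 0"]) simp
next
  case (Cons t us)
  let ?S = "\<lambda>D c. \<Sum>\<alpha>\<in>D. Poly_Mapping.single 0 (c \<alpha>) * s_word \<alpha> * gen_p P"
  obtain D c where D: "finite D" "\<forall>\<alpha>\<in>D. P \<subseteq> cyl \<X> \<alpha> []" and eq: "terms_val us * gen_p P \<approx> ?S D c"
    using Cons by auto
  obtain r \<alpha> A where t: "t = (r, \<alpha>, A, [])" using Cons.prems(2) by (cases t) simp
  have A: "A \<in> bool_alg \<X>" using Cons.prems t by simp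
  let ?k = "Poly_Mapping.single 0 r * s_word \<alpha>"
  have tP: "term_val t * gen_p P \<approx> ?k * gen_p (A \<inter> P)"
    using term_mult_p[OF A P, of r \<alpha> "[]"] P by (simp add: t term_val_def preshift_Nil bool_alg_subset)
  have split: "terms_val (t # us) * gen_p P = term_val t * gen_p P + terms_val us * gen_p P"
    by (simp add: distrib_right)
  have zero: ?case if "term_val t * gen_p P \<approx> 0"
  proof -
    have "terms_val (t # us) * gen_p P \<approx> 0 + ?S D c" unfolding split by (rule eqv_add[OF that eq])
    then show ?thesis using D by (intro exI[of _ D] exI[of _ c]) simp
  qed
  show ?case
  proof (cases "P \<inter> A = {} \<or> P \<inter> cyl \<X> \<alpha> [] = {}")
    case True
    show ?thesis
    proof (rule zero)
      have "?k * gen_p (A \<inter> P) \<approx> Poly_Mapping.single 0 r * (s_word \<alpha> * gen_p (cyl \<X> \<alpha> [] \<inter> (A \<inter> P)))"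
        unfolding mult.assoc by (intro eqv_mult eqv_refl s_word_p_restrict inter_bool_alg A P)
      also have "cyl \<X> \<alpha> [] \<inter> (A \<inter> P) = {}" using True by auto
      also have "Poly_Mapping.single 0 r * (s_word \<alpha> * gen_p {}) \<approx> Poly_Mapping.single 0 r * (s_word \<alpha> * 0)"
        by (intro eqv_mult eqv_refl p_empty)
      finally show "term_val t * gen_p P \<approx> 0" using eqv_trans[OF tP] by simp
    qed
  next
    case False
    then have sub: "P \<subseteq> A" "P \<subseteq> cyl \<X> \<alpha> []" using Cons.prems(3,4) by (auto simp: t word_part_def)
    \<comment> \<open>Extending \<open>c\<close> by zero treats a new word and a repeated word
      alike.\<close>
    define e where "e = (\<lambda>\<beta>. if \<beta> \<in> D then c \<beta> else 0)"
    define c' where "c' = e(\<alpha> := e \<alpha> + r)"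
    have "?S D c = ?S (insert \<alpha> D) e"
      using D(1) by (cases "\<alpha> \<in> D") (auto simp: e_def insert_absorb intro!: sum.cong)
    moreover have "?S (insert \<alpha> D) c' = ?k * gen_p P + ?S (insert \<alpha> D) e"
    proof -
      have ins: "?S (insert \<alpha> D) d = Poly_Mapping.single 0 (d \<alpha>) * s_word \<alpha> * gen_p P + ?S (D - {\<alpha>}) d" for d
        using D(1) by (simp add: sum.insert_remove)
      have rest: "?S (D - {\<alpha>}) c' = ?S (D - {\<alpha>}) e" by (rule sum.cong) (auto simp: c'_def)
      have coef: "Poly_Mapping.single 0 (c' \<alpha>) = Poly_Mapping.single 0 r + Poly_Mapping.single 0 (e \<alpha>)"
        by (simp add: c'_def single_add add.commute)
      show ?thesis unfolding ins rest coef by (simp only: distrib_right add.assoc)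
    qed
    moreover have "terms_val (t # us) * gen_p P \<approx> ?k * gen_p P + ?S D c"
      unfolding split using tP sub by (intro eqv_add eq) (simp add: Int_absorb1)
    ultimately have "terms_val (t # us) * gen_p P \<approx> ?S (insert \<alpha> D) c'" by simp
    then show ?thesis using D sub by (intro exI[of _ "insert \<alpha> D"] exI[of _ c']) simp
  qed
qed

text \<open>
  Sandwiching by \<open>s\<^sub>\<mu>\<close> on the right and \<open>s\<^sub>\<alpha>\<^sub>\<mu>\<^sup>*\<close> on the left
  isolates the coefficient at \<open>\<alpha>\<close>, provided that \<open>\<mu>\<close> is the beginning of a point of \<open>P\<close> that is not
  periodic with one of the finitely many periods by which words of \<open>D\<close> differ.
\<close>

lemma sum_isolate:
  assumes L: "condition_L \<X>" and P: "P \<in> bool_alg \<X>" "P \<noteq> {}"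
    and D: "finite D" "\<alpha> \<in> D" "P \<subseteq> cyl \<X> \<alpha> []"
  shows "\<exists>g h. \<exists>Q\<in>bool_alg \<X>. Q \<noteq> {} \<and>
    g * (\<Sum>\<beta>\<in>D. Poly_Mapping.single 0 (c \<beta>) * s_word \<beta> * gen_p P) * h \<approx> Poly_Mapping.single 0 (c \<alpha>) * gen_p Q"
proof -
  \<comment> \<open>The nonempty words by which another element of \<open>D\<close> extends \<alpha>
    or is extended by it: the only possible shifts of an overlap.\<close>
  define E where "E = {d. d \<noteq> [] \<and> (\<exists>\<beta>\<in>D. \<beta> = \<alpha> @ d \<or> \<alpha> = \<beta> @ d)}"
  have "E \<subseteq> (\<lambda>\<beta>. drop (length \<alpha>) \<beta>) ` D \<union> (\<lambda>\<beta>. drop (length \<beta>) \<alpha>) ` D"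
  proof
    fix d assume "d \<in> E"
    then obtain \<beta> where b: "\<beta> \<in> D" "\<beta> = \<alpha> @ d \<or> \<alpha> = \<beta> @ d" unfolding E_def by blast
    then have "d = drop (length \<alpha>) \<beta> \<or> d = drop (length \<beta>) \<alpha>" by auto
    then show "d \<in> (\<lambda>\<beta>. drop (length \<alpha>) \<beta>) ` D \<union> (\<lambda>\<beta>. drop (length \<beta>) \<alpha>) ` D" using b(1) by blast
  qed
  then have E: "finite E" using D(1) by (meson finite_UnI finite_imageI finite_subset)
  have "[] \<notin> E" by (simp add: E_def)
  then obtain x where x: "x \<in> P" "\<forall>d\<in>E. x \<noteq> d\<^sup>\<omega>"
    using condition_L_nonperiodic[OF L P E] by blast
  then have "\<forall>d\<in>E. \<exists>i. x i \<noteq> d\<^sup>\<omega> i" by auto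
  then obtain i where i: "\<And>d. d \<in> E \<Longrightarrow> x (i d) \<noteq> d\<^sup>\<omega> (i d)" by metis
  \<comment> \<open>Long enough for the prefix to reveal, for each \<open>d \<in> E\<close>, a place
    where \<open>x\<close> differs from the periodic sequence. For empty \<open>E\<close> any length
    would do.\<close>
  define n where "n = Suc (Max (i ` E))"
  have n: "i d < n" if "d \<in> E" for d using that E by (simp add: n_def less_Suc_eq_le)
  define \<mu> where "\<mu> = prefix n x"
  define Q where "Q = preshift \<X> \<mu> P"
  have Q: "Q \<in> bool_alg \<X>" unfolding Q_def by (rule preshift_bool_alg[OF P(1)])
  have "x \<in> \<X>" using x bool_alg_subset[OF P(1)] by blast
  then have "suffix n x \<in> Q" using x(1) suffix_in[of x n]
    unfolding Q_def \<mu>_def preshift_def by (simp flip: prefix_suffix)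
  then have "Q \<noteq> {}" by blast
  have nonper: False if "d \<in> E" "\<mu> @ z = d @ \<mu>" for d z
  proof -
    have "\<mu> ! i d = d\<^sup>\<omega> (i d)"
      using that n[OF that(1)] by (intro overlap_iter[of \<mu> z]) (auto simp: E_def \<mu>_def)
    then show False using i[OF that(1)] n[OF that(1)] by (simp add: \<mu>_def)
  qed
  have orth: "s_star_word (\<alpha> @ \<mu>) * s_word (\<beta> @ \<mu>) \<approx> 0" if \<beta>: "\<beta> \<in> D" "\<beta> \<noteq> \<alpha>" for \<beta>
  proof (rule star_word_s_word_orth)
    show "\<beta> @ \<mu> \<noteq> (\<alpha> @ \<mu>) @ z" for z
    proof
      assume "\<beta> @ \<mu> = (\<alpha> @ \<mu>) @ z"
      then obtain d where d: "\<beta> = \<alpha> @ d" "\<mu> @ z = d @ \<mu>" using append_overlap[of \<alpha> \<mu> z \<beta>] by auto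
      then show False using \<beta> nonper[of d z] by (auto simp: E_def)
    qed
    show "\<alpha> @ \<mu> \<noteq> (\<beta> @ \<mu>) @ z" for z
    proof
      assume "\<alpha> @ \<mu> = (\<beta> @ \<mu>) @ z"
      then obtain d where d: "\<alpha> = \<beta> @ d" "\<mu> @ z = d @ \<mu>" using append_overlap[of \<beta> \<mu> z \<alpha>] by auto
      then show False using \<beta> nonper[of d z] by (auto simp: E_def)
    qed
  qed
  have "Q \<subseteq> cyl \<X> (\<alpha> @ \<mu>) []" using D(3) by (auto simp: Q_def preshift_def mem_cyl_Nil)
  then have same: "s_star_word (\<alpha> @ \<mu>) * s_word (\<alpha> @ \<mu>) * gen_p Q \<approx> gen_p Q"
    using eqv_trans[OF eqv_mult_right[OF star_word_s_word, of "\<alpha> @ \<mu>"] p_inter[OF cyl_bool_alg Q]]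
    by (simp add: Int_absorb1)
  have summand: "s_star_word (\<alpha> @ \<mu>) * (Poly_Mapping.single 0 (c \<beta>) * s_word \<beta> * gen_p P) * s_word \<mu>
      \<approx> (if \<beta> = \<alpha> then Poly_Mapping.single 0 (c \<alpha>) * gen_p Q else 0)" if "\<beta> \<in> D" for \<beta>
  proof -
    let ?c = "Poly_Mapping.single 0 (c \<beta>)"
    have "s_star_word (\<alpha> @ \<mu>) * (?c * s_word \<beta> * gen_p P) * s_word \<mu>
        = (s_star_word (\<alpha> @ \<mu>) * ?c) * (s_word \<beta> * (gen_p P * s_word \<mu>))" by (simp add: mult.assoc)
    also have "\<dots> = (?c * s_star_word (\<alpha> @ \<mu>)) * (s_word \<beta> * (gen_p P * s_word \<mu>))"
      by (simp only: single_zero_commute)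
    also have "\<dots> \<approx> (?c * s_star_word (\<alpha> @ \<mu>)) * (s_word \<beta> * (s_word \<mu> * gen_p Q))"
      unfolding Q_def by (intro eqv_mult eqv_refl p_s_word P)
    also have "\<dots> = ?c * (s_star_word (\<alpha> @ \<mu>) * s_word (\<beta> @ \<mu>) * gen_p Q)"
      by (simp add: s_word_append mult.assoc)
    also have "\<dots> \<approx> (if \<beta> = \<alpha> then Poly_Mapping.single 0 (c \<alpha>) * gen_p Q else 0)"
    proof (cases "\<beta> = \<alpha>")
      case True
      then show ?thesis using same by (simp add: eqv_mult_left)
    next
      case False
      then show ?thesis
        using eqv_mult_left[OF eqv_mult_right[OF orth[OF that False], of "gen_p Q"], of ?c] by simp
    qed
    finally show ?thesis .
  qed
  have "s_star_word (\<alpha> @ \<mu>) * (\<Sum>\<beta>\<in>D. Poly_Mapping.single 0 (c \<beta>) * s_word \<beta> * gen_p P) * s_word \<mu>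
      = (\<Sum>\<beta>\<in>D. s_star_word (\<alpha> @ \<mu>) * (Poly_Mapping.single 0 (c \<beta>) * s_word \<beta> * gen_p P) * s_word \<mu>)"
    by (simp add: sum_distrib_left sum_distrib_right)
  also have "\<dots> \<approx> (\<Sum>\<beta>\<in>D. if \<beta> = \<alpha> then Poly_Mapping.single 0 (c \<alpha>) * gen_p Q else 0)"
    by (rule eqv_sum[OF D(1) summand])
  also have "\<dots> = Poly_Mapping.single 0 (c \<alpha>) * gen_p Q" using D by simp
  finally show ?thesis using Q \<open>Q \<noteq> {}\<close> by blast
qed

text \<open>Stars are removed first, then \<open>P\<close> makes all surviving terms share one
  projection, and one of them is isolated. Some summand lies outside \<open>J\<close>, which makes
  both its coefficient and \<open>P\<close> nonzero.\<close>

lemma exists_projection: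
  assumes L: "condition_L \<X>" and f: "f \<notin> J"
  shows "\<exists>g h. \<exists>Q\<in>bool_alg \<X>. Q \<noteq> {} \<and> g * f * h \<approx> gen_p Q"
proof -
  obtain ts where "good ts" "f \<approx> terms_val ts" using span by blast
  then obtain g us where us: "good us" "f * g \<approx> terms_val us" "f * g \<notin> J" "\<forall>t\<in>set us. star_part t = []"
    using kill_stars f by blast
  define As where "As = map proj_part us @ map (\<lambda>t. cyl \<X> (word_part t) []) us"
  have "A \<in> bool_alg \<X>" if "A \<in> set As" for A
    using that us(1) by (auto simp: As_def good_def cyl_bool_alg)
  then obtain P where P: "P \<in> bool_alg \<X>" "f * g * gen_p P \<notin> J" "\<forall>A\<in>set As. P \<subseteq> A \<or> P \<inter> A = {}"
    using atom_exists[OF us(3)] by blast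
  have "\<forall>t\<in>set us. P \<subseteq> proj_part t \<or> P \<inter> proj_part t = {}"
    "\<forall>t\<in>set us. P \<subseteq> cyl \<X> (word_part t) [] \<or> P \<inter> cyl \<X> (word_part t) [] = {}"
    using P(3) by (auto simp: As_def)
  then obtain D c where D: "finite D" "\<forall>\<alpha>\<in>D. P \<subseteq> cyl \<X> \<alpha> []"
    "terms_val us * gen_p P \<approx> (\<Sum>\<alpha>\<in>D. Poly_Mapping.single 0 (c \<alpha>) * s_word \<alpha> * gen_p P)" (is "_ \<approx> ?H")
    using terms_mult_atom[OF P(1) us(1,4)] by blast
  have fH: "f * g * gen_p P \<approx> ?H" by (rule eqv_trans[OF eqv_mult_right[OF us(2)] D(3)])
  then have "?H \<notin> J" using P(2) eqv_mem_iff by blast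
  then obtain \<alpha> where \<alpha>: "\<alpha> \<in> D" "Poly_Mapping.single 0 (c \<alpha>) * s_word \<alpha> * gen_p P \<notin> J"
    using sum_mem[OF D(1), of "\<lambda>\<alpha>. Poly_Mapping.single 0 (c \<alpha>) * s_word \<alpha> * gen_p P"] by auto
  have "P \<noteq> {}"
  proof
    assume "P = {}"
    then have "gen_p P \<in> J" using p_empty by (simp add: eqv_zero_iff)
    then show False using \<alpha>(2) mult_left_mem by blast
  qed
  have c: "c \<alpha> \<noteq> 0" using \<alpha>(2) zero_mem by auto
  obtain g' h Q where Q: "Q \<in> bool_alg \<X>" "Q \<noteq> {}" "g' * ?H * h \<approx> Poly_Mapping.single 0 (c \<alpha>) * gen_p Q"
    using sum_isolate[OF L P(1) \<open>P \<noteq> {}\<close> D(1) \<alpha>(1), of c] D(2) \<alpha>(1) by auto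
  \<comment> \<open>The isolated coefficient is inverted; here the scalars have to form a
    field.\<close>
  let ?i = "Poly_Mapping.single 0 (inverse (c \<alpha>))"
  have "?i * (g' * (f * g * gen_p P) * h) \<approx> ?i * (g' * ?H * h)"
    by (intro eqv_mult eqv_refl fH)
  also have "\<dots> \<approx> ?i * (Poly_Mapping.single 0 (c \<alpha>) * gen_p Q)" by (rule eqv_mult_left[OF Q(3)])
  also have "\<dots> = (?i * Poly_Mapping.single 0 (c \<alpha>)) * gen_p Q" by (simp add: mult.assoc)
  also have "\<dots> = gen_p Q" using c by (simp add: mult_single)
  finally have "(?i * g') * f * (g * gen_p P * h) \<approx> gen_p Q" by (simp add: mult.assoc)
  then show ?thesis using Q(1,2) by auto
qed

section \<open>From a projection in the ideal to the unit\<close>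

lemma compress_mem:
  assumes "gen_p A \<in> J" "A \<in> bool_alg \<X>" "T \<in> bool_alg \<X>" "\<And>x. x \<in> T \<Longrightarrow> w \<frown> x \<in> A"
  shows "gen_p T \<in> J"
proof -
  \<comment> \<open>Conjugation by \<open>s_w\<close> stays in the ideal and turns
    \<open>p_A\<close> into the projection of all \<open>x\<close> with
    \<open>w \<frown> x \<in> A\<close>, a set containing \<open>T\<close>.\<close>
  have "s_star_word w * gen_p A * s_word w = s_star_word w * (gen_p A * s_word w)" by (simp add: mult.assoc)
  also have "\<dots> \<approx> s_star_word w * (s_word w * gen_p (preshift \<X> w A))"
    by (intro eqv_mult eqv_refl p_s_word assms)
  also have "\<dots> = (s_star_word w * s_word w) * gen_p (preshift \<X> w A)" by (simp add: mult.assoc)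
  also have "\<dots> \<approx> gen_p (cyl \<X> w []) * gen_p (preshift \<X> w A)"
    by (intro eqv_mult eqv_refl star_word_s_word)
  also have "\<dots> \<approx> gen_p (cyl \<X> w [] \<inter> preshift \<X> w A)"
    by (intro p_inter cyl_bool_alg preshift_bool_alg assms)
  finally have "gen_p (cyl \<X> w [] \<inter> preshift \<X> w A) \<in> J"
    using eqv_mem_iff mult_left_mem[OF assms(1)] mult_right_mem by blast
  moreover have "T \<subseteq> cyl \<X> w [] \<inter> preshift \<X> w A"
  proof
    fix x assume "x \<in> T"
    then have "x \<in> \<X>" "w \<frown> x \<in> A" "w \<frown> x \<in> \<X>"
      using assms(4) bool_alg_subset[OF assms(2)] bool_alg_subset[OF assms(3)] by blast+
    then show "x \<in> cyl \<X> w [] \<inter> preshift \<X> w A" by (simp add: mem_cyl_Nil preshift_def)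
  qed
  ultimately show ?thesis
    by (rule p_mono_mem) (intro assms inter_bool_alg cyl_bool_alg preshift_bool_alg)+
qed

text \<open>The reverse of \<open>compress_mem\<close>: when all points of \<open>T\<close> begin
  with \<open>w\<close>, \<open>p_T\<close> equals \<open>s_w p s_w\<^sup>*\<close> with
  \<open>p\<close> the projection of the remaining tails.\<close>

lemma expand_mem:
  assumes "gen_p A \<in> J" "A \<in> bool_alg \<X>" "T \<in> bool_alg \<X>" "preshift \<X> w T \<subseteq> A"
    and "\<And>y. y \<in> T \<Longrightarrow> \<exists>x. y = w \<frown> x"
  shows "gen_p T \<in> J"
\<comment> \<open>\<open>s_w s_w\<^sup>*\<close> is known as a projection only through relation
  (iii), hence for words of the language; otherwise \<open>T\<close> is empty.\<close>
proof (cases "w \<in> language \<X>")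
  case True
  have Z: "s_word w * s_star_word w \<approx> gen_p (cyl \<X> [] w)"
    using s_cyl[OF Nil_language True] by simp
  have "T \<subseteq> cyl \<X> [] w"
  proof
    fix y assume "y \<in> T"
    then obtain x where "y = w \<frown> x" "y \<in> \<X>" using assms(5) bool_alg_subset[OF assms(3)] by blast
    then show "y \<in> cyl \<X> [] w" using tail_in by (simp add: conc_mem_cyl)
  qed
  then have "gen_p T \<approx> gen_p T * gen_p (cyl \<X> [] w)"
    using eqv_sym[OF p_inter[OF assms(3) cyl_bool_alg, of "[]" w]] by (simp add: Int_absorb2)
  also have "\<dots> \<approx> gen_p T * (s_word w * s_star_word w)" by (intro eqv_mult eqv_refl eqv_sym[OF Z])
  also have "\<dots> = (gen_p T * s_word w) * s_star_word w" by (simp add: mult.assoc)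
  also have "\<dots> \<approx> (s_word w * gen_p (preshift \<X> w T)) * s_star_word w"
    by (intro eqv_mult eqv_refl p_s_word assms)
  finally have "gen_p T \<approx> s_word w * gen_p (preshift \<X> w T) * s_star_word w" .
  moreover have "gen_p (preshift \<X> w T) \<in> J"
    by (rule p_mono_mem[OF assms(1,4)]) (intro preshift_bool_alg assms)+
  ultimately show ?thesis using eqv_mem_iff mult_left_mem mult_right_mem by blast
next
  case False
  have "T = {}"
  proof (rule ccontr)
    assume "T \<noteq> {}"
    then obtain x where "w \<frown> x \<in> T" using assms(5) by fastforce
    then show False using False bool_alg_subset[OF assms(3)] unfolding language_iff by blast
  qed
  then show ?thesis using p_empty by (simp add: eqv_zero_iff)
qed

lemma p_Union_mem:
  assumes "finite C" "\<And>c. c \<in> C \<Longrightarrow> f c \<in> bool_alg \<X> \<and> gen_p (f c) \<in> J"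
  shows "(\<Union>c\<in>C. f c) \<in> bool_alg \<X> \<and> gen_p (\<Union>c\<in>C. f c) \<in> J"
  using assms
proof (induction C rule: finite_induct)
  case empty
  then show ?case using empty_bool_alg p_empty by (simp add: eqv_zero_iff)
next
  case (insert c C)
  let ?A = "f c" and ?B = "\<Union>c\<in>C. f c"
  have A: "?A \<in> bool_alg \<X>" "gen_p ?A \<in> J" "?B \<in> bool_alg \<X>" "gen_p ?B \<in> J" using insert by auto
  have "gen_p (?A \<inter> ?B) \<in> J" by (rule p_mono_mem[OF A(2) Int_lower1 inter_bool_alg[OF A(1,3)] A(1)])
  then have "gen_p ?A + gen_p ?B - gen_p (?A \<inter> ?B) \<in> J" using A by (intro add_mem diff_mem) auto
  then have "gen_p (?A \<union> ?B) \<in> J" using p_union[OF A(1,3)] eqv_mem_iff by blast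
  then show ?case using A by (simp add: bool_alg.union)
qed

lemma projection_one_mem:
  assumes cc: "compactly_cofinal \<X>" and Q: "Q \<in> bool_alg \<X>" "Q \<noteq> {}" "gen_p Q \<in> J"
  shows "1 \<in> J"
proof -
  obtain x where x: "x \<in> Q" "x \<in> \<X>" using Q bool_alg_subset by blast
  then obtain n B where B: "decides x Q n B" using bool_alg_local[OF Q(1)] by blast
  then have fin: "finite B" "B \<subseteq> language \<X>" "followers \<X> B \<noteq> {}" "B \<noteq> {}"
    and QB: "\<And>z. z \<in> followers \<X> B \<Longrightarrow> prefix n x \<frown> z \<in> Q"
    using x unfolding decides_def by auto
  have FB: "followers \<X> B \<in> bool_alg \<X>" by (rule followers_bool_alg[OF fin(1)])
  have F: "gen_p (followers \<X> B) \<in> J" by (rule compress_mem[OF Q(3,1) FB QB])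
  \<comment> \<open>Stripping \<alpha> leaves points \<open>x\<close> with
    \<open>\<gamma> \<frown> x\<close> in the follower set, so compression along \<gamma> and
    expansion along \<alpha> carry membership from the follower set to this set.\<close>
  have mc: "multi_cyl B \<gamma> \<alpha> \<in> bool_alg \<X> \<and> gen_p (multi_cyl B \<gamma> \<alpha>) \<in> J" for \<gamma> \<alpha>
  proof
    show M: "multi_cyl B \<gamma> \<alpha> \<in> bool_alg \<X>" by (rule multi_cyl_bool_alg[OF fin(1)])
    have pre: "preshift \<X> \<alpha> (multi_cyl B \<gamma> \<alpha>) \<in> bool_alg \<X>" by (rule preshift_bool_alg[OF M])
    have "\<gamma> \<frown> x \<in> followers \<X> B" if "x \<in> preshift \<X> \<alpha> (multi_cyl B \<gamma> \<alpha>)" for x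
    proof -
      have *: "\<forall>\<beta>\<in>B. \<beta> \<frown> \<gamma> \<frown> x \<in> \<X>"
        using that mem_multi_cyl[OF fin(4)] unfolding preshift_def by auto
      obtain \<beta> where "\<beta> \<in> B" using fin(4) by blast
      then have "\<gamma> \<frown> x \<in> \<X>" using * tail_in by blast
      then show ?thesis using * unfolding followers_iff by blast
    qed
    then have "gen_p (preshift \<X> \<alpha> (multi_cyl B \<gamma> \<alpha>)) \<in> J"
      by (rule compress_mem[OF F FB pre])
    then show "gen_p (multi_cyl B \<gamma> \<alpha>) \<in> J"
      by (rule expand_mem[OF _ pre M]) (use mem_multi_cyl[OF fin(4)] in blast)+
  qed
  obtain C where C: "finite C" "\<X> \<subseteq> (\<Union>(\<gamma>, \<alpha>)\<in>C. multi_cyl B \<gamma> \<alpha>)"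
    using compactly_cofinal_cover[OF cc fin] unfolding covered_def by blast
  have "(\<Union>(\<gamma>, \<alpha>)\<in>C. multi_cyl B \<gamma> \<alpha>) \<in> bool_alg \<X> \<and> gen_p (\<Union>(\<gamma>, \<alpha>)\<in>C. multi_cyl B \<gamma> \<alpha>) \<in> J"
    using mc by (intro p_Union_mem[OF C(1)]) auto
  then have "gen_p \<X> \<in> J" using p_mono_mem[OF _ C(2) bool_alg.whole] by blast
  then show ?thesis using p_whole eqv_mem_iff by blast
qed

end

text \<open>The reduction to a projection is done modulo the smaller ideal, where \<open>f\<close>
  is nonzero; the congruence then persists modulo \<open>J\<close>, where \<open>f\<close>
  vanishes.\<close>

lemma ideal_above_trivial:
  assumes I: "subshift_ideal \<X> I" and J: "subshift_ideal \<X> J" and "I \<subseteq> J" "f \<in> J" "f \<notin> I"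
    and L: "condition_L \<X>" and cc: "compactly_cofinal \<X>"
  shows "1 \<in> J"
proof -
  interpret I: subshift_ideal \<X> I by (rule I)
  interpret J: subshift_ideal \<X> J by (rule J)
  obtain g h Q where Q: "Q \<in> bool_alg \<X>" "Q \<noteq> {}" "I.eqv (g * f * h) (gen_p Q)"
    using I.exists_projection[OF L \<open>f \<notin> I\<close>] by blast
  have "gen_p Q - g * f * h \<in> J" using I.eqv_sym[OF Q(3)] \<open>I \<subseteq> J\<close> unfolding I.eqv_def by blast
  moreover have "g * f * h \<in> J" using \<open>f \<in> J\<close> by (intro J.mult_left_mem J.mult_right_mem)
  ultimately have "gen_p Q \<in> J" using J.add_mem[of "gen_p Q - g * f * h" "g * f * h"] by simp
  then show ?thesis by (rule J.projection_one_mem[OF cc Q(1,2)])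
qed

section \<open>Representations on functions\<close>

context shift_space
begin

text \<open>
  The generators act on functions on \<open>\<X> \<times> \<int>\<close> through partial maps of the points; the second
  coordinate records the degree, scaled by \<open>d\<close>. For \<open>d = 0\<close> this is the usual representation on functions
  on \<open>\<X>\<close>, for \<open>d = 1\<close> it distinguishes elements of different degrees.
\<close>

fun gen_map :: "int \<Rightarrow> 'a generator \<Rightarrow> 'a word \<times> int \<Rightarrow> ('a word \<times> int) option" where
  "gen_map d (Proj A) (x, k) = (if x \<in> A then Some (x, k) else None)"
| "gen_map d (Iso a) (x, k) = (if x 0 = a then Some (suffix 1 x, k + d) else None)"
| "gen_map d (Iso_star a) (x, k) = (if a ## x \<in> \<X> then Some (a ## x, k - d) else None)"

primrec path_map :: "int \<Rightarrow> 'a generator list \<Rightarrow> 'a word \<times> int \<Rightarrow> ('a word \<times> int) option" where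
  "path_map d [] p = Some p"
| "path_map d (g # gs) p = Option.bind (gen_map d g p) (path_map d gs)"

lemma path_map_append: "path_map d (u @ v) p = Option.bind (path_map d u p) (path_map d v)"
  by (induction u arbitrary: p) (auto split: bind_splits)

definition mono_act :: "int \<Rightarrow> 'a generator list \<Rightarrow> ('a word \<times> int \<Rightarrow> 'r) \<Rightarrow> 'a word \<times> int \<Rightarrow> 'r::comm_ring_1" where
  "mono_act d w \<phi> p = (case path_map d w p of None \<Rightarrow> 0 | Some q \<Rightarrow> \<phi> q)"

definition act :: "int \<Rightarrow> ('a, 'r) subshift_free \<Rightarrow> ('a word \<times> int \<Rightarrow> 'r) \<Rightarrow> 'a word \<times> int \<Rightarrow> 'r::comm_ring_1" where
  "act d f \<phi> p = (\<Sum>w\<in>Poly_Mapping.keys f. Poly_Mapping.lookup f w * mono_act d (factors w) \<phi> p)"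

lemma act_superset:
  assumes "finite K" "Poly_Mapping.keys f \<subseteq> K"
  shows "act d f \<phi> p = (\<Sum>w\<in>K. Poly_Mapping.lookup f w * mono_act d (factors w) \<phi> p)"
  unfolding act_def using assms by (intro sum.mono_neutral_left) (auto simp: in_keys_iff)

lemma act_single: "act d (Poly_Mapping.single w r) \<phi> p = r * mono_act d (factors w) \<phi> p"
  by (subst act_superset[of "{w}"]) auto

lemma act_add: "act d (f + g) \<phi> p = act d f \<phi> p + act d g \<phi> p"
proof -
  let ?K = "Poly_Mapping.keys f \<union> Poly_Mapping.keys g"
  have "act d f \<phi> p = (\<Sum>w\<in>?K. Poly_Mapping.lookup f w * mono_act d (factors w) \<phi> p)"
    "act d g \<phi> p = (\<Sum>w\<in>?K. Poly_Mapping.lookup g w * mono_act d (factors w) \<phi> p)"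
    "act d (f + g) \<phi> p = (\<Sum>w\<in>?K. Poly_Mapping.lookup (f + g) w * mono_act d (factors w) \<phi> p)"
    using Poly_Mapping.keys_add[of f g] by (auto intro!: act_superset)
  then show ?thesis by (simp add: lookup_add distrib_right sum.distrib)
qed

lemma act_diff: "act d (f - g) \<phi> p = act d f \<phi> p - act d g \<phi> p"
  using act_add[of d "f - g" g \<phi> p] by simp

lemma act_zero: "act d 0 \<phi> p = 0"
  by (simp add: act_def)

lemma act_add_right: "act d f (\<lambda>q. \<phi> q + \<psi> q) p = act d f \<phi> p + act d f \<psi> p"
  by (simp add: act_def mono_act_def distrib_left sum.distrib[symmetric] cong: option.case_cong)
    (rule sum.cong, auto split: option.split simp: distrib_left)

text \<open>Functions are pulled back along the point maps, so the first factor of a monomial moves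
  the point first and products become compositions in the same order.\<close>

lemma act_mult: "act d (f * g) \<phi> p = act d f (act d g \<phi>) p"
proof (induction f rule: poly_mapping_add_induct)
  case (single u r)
  show ?case
  proof (induction g rule: poly_mapping_add_induct)
    case (single v t)
    show ?case
      by (simp add: mult_single act_single mono_act_def plus_monomial_def path_map_append mult.assoc
        split: option.split bind_split)
  next
    case (add f g)
    have "act d (f + g) \<phi> = (\<lambda>p. act d f \<phi> p + act d g \<phi> p)" by (rule ext) (rule act_add)
    then show ?case using add by (simp add: distrib_left act_add act_add_right)
  qed
next
  case (add f g)
  then show ?case by (simp add: distrib_right act_add)
qed

lemma act_one: "act d 1 \<phi> p = \<phi> p"
proof -
  have "factors (0 :: 'a generator monomial) = []" by (simp add: zero_monomial_def)
  then show ?thesis using act_single[of d 0 1 \<phi> p] by (simp add: mono_act_def)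
qed

lemma act_p: "act d (gen_p A) \<phi> (x, k) = (if x \<in> A then \<phi> (x, k) else 0)"
  by (simp add: free_gen_def act_single mono_act_def)

lemma act_s: "act d (gen_s a) \<phi> (x, k) = (if x 0 = a then \<phi> (suffix 1 x, k + d) else 0)"
  by (simp add: free_gen_def act_single mono_act_def)

lemma act_s_star: "act d (gen_s_star a) \<phi> (x, k) = (if a ## x \<in> \<X> then \<phi> (a ## x, k - d) else 0)"
  by (simp add: free_gen_def act_single mono_act_def)

lemma act_s_word: "act d (s_word w) \<phi> (w \<frown> x, k) = \<phi> (x, k + d * int (length w))"
proof (induction w arbitrary: k)
  case Nil
  then show ?case by (simp add: act_one)
next
  case (Cons a w)
  have "suffix 1 (a ## w \<frown> x) = w \<frown> x" by (rule ext) simp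
  then show ?case using Cons[of "k + d"] by (simp add: s_word_Cons act_mult act_s algebra_simps)
qed

lemma act_s_word_other: "(\<And>y. x \<noteq> w \<frown> y) \<Longrightarrow> act d (s_word w) \<phi> (x, k) = 0"
proof (induction w arbitrary: x k)
  case Nil
  then show ?case by force
next
  case (Cons a w)
  show ?case
  proof (cases "x 0 = a")
    case True
    then have x: "x = a ## suffix 1 x" by auto
    have "suffix 1 x \<noteq> w \<frown> y" for y
      using Cons.prems[of y] x by auto
    then have "act d (s_word w) \<phi> (suffix 1 x, j) = 0" for j by (rule Cons.IH)
    then show ?thesis by (simp add: s_word_Cons act_mult act_s)
  qed (simp add: s_word_Cons act_mult act_s)
qed

lemma act_s_star_word:
  "x \<in> \<X> \<Longrightarrow> act d (s_star_word w) \<phi> (x, k)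
    = (if w \<frown> x \<in> \<X> then \<phi> (w \<frown> x, k - d * int (length w)) else 0)"
proof (induction w arbitrary: \<phi>)
  case Nil
  then show ?case by (simp add: act_one)
next
  case (Cons a w)
  have "w \<frown> x \<in> \<X>" if "a ## w \<frown> x \<in> \<X>" using that by (rule tail_in_Cons)
  then show ?case using Cons by (simp add: s_star_word_Cons act_mult act_s_star algebra_simps)
qed

text \<open>Functions live on all pairs of the type, but relations such as \<open>p_\<X> = 1\<close>
  hold only over \<X>. For this reason \<open>supp\<close> ignores points outside.\<close>

lemma act_relation:
  assumes "f \<in> subshift_relations \<X>" "x \<in> \<X>"
  shows "act d f \<phi> (x, k) = 0"
  using assms(1)
proof cases
  case (p_inter A B)
  then show ?thesis by (simp add: act_diff act_mult act_p)
next
  case (p_union A B)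
  then show ?thesis by (simp add: act_diff act_add act_mult act_p)
next
  case (s_partial_iso a)
  have "a ## suffix 1 x = x" if "x 0 = a" using that by auto
  then show ?thesis using assms(2) s_partial_iso
    by (simp add: act_diff act_mult act_s act_s_star)
next
  case (s_star_partial_iso a)
  have "suffix 1 (a ## x) = x" by (rule ext) simp
  then show ?thesis using s_star_partial_iso by (simp add: act_diff act_mult act_s act_s_star)
next
  case (s_cyl \<alpha> \<beta>)
  show ?thesis
  proof (cases "\<exists>y. x = \<beta> \<frown> y")
    case True
    then obtain y where x: "x = \<beta> \<frown> y" by blast
    have y: "y \<in> \<X>" using assms(2) tail_in x by blast
    have "act d (s_word \<beta> * s_star_word \<alpha> * s_word \<alpha> * s_star_word \<beta>) \<phi> (x, k)
      = (if \<alpha> \<frown> y \<in> \<X> then \<phi> (x, k) else 0)"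
      using assms(2) y unfolding x by (simp add: act_mult act_s_word act_s_star_word)
    then show ?thesis using assms(2) unfolding s_cyl(1) x
      by (simp add: act_diff act_p conc_mem_cyl)
  next
    case False
    then have "x \<notin> cyl \<X> \<alpha> \<beta>" by (auto simp: cyl_def)
    then show ?thesis using False unfolding s_cyl(1)
      by (simp add: act_diff act_p act_mult act_s_word_other)
  qed
qed (use assms(2) in \<open>simp_all add: act_diff act_one act_p\<close>)

definition supp :: "('a word \<times> int \<Rightarrow> 'r::zero) \<Rightarrow> 'a word set" where
  "supp \<phi> = {x \<in> \<X>. \<exists>k. \<phi> (x, k) \<noteq> 0}"

text \<open>\<open>W\<close> lists negligible sets. For \<open>{{}}\<close> this is the annihilator
  of functions over \<X>; for a larger invariant family it is the annihilator of functions modulo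
  those of negligible support.\<close>

definition kernel :: "int \<Rightarrow> 'a word set set \<Rightarrow> ('a, 'r::comm_ring_1) subshift_free set" where
  "kernel d W = {f. \<forall>\<phi>. supp (act d f \<phi>) \<in> W}"

lemma relations_kernel: "{} \<in> W \<Longrightarrow> (subshift_relations \<X> :: ('a, 'r::comm_ring_1) subshift_free set) \<subseteq> kernel d W"
proof
  fix f :: "('a, 'r) subshift_free"
  assume W: "{} \<in> W" and f: "f \<in> subshift_relations \<X>"
  have "supp (act d f \<phi>) = {}" for \<phi> using act_relation[OF f] by (simp add: supp_def)
  then show "f \<in> kernel d W" using W by (simp add: kernel_def)
qed

lemma one_not_kernel:
  assumes "\<X> \<notin> W" shows "(1 :: ('a, 'r::comm_ring_1) subshift_free) \<notin> kernel d W"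
proof
  assume "(1 :: ('a, 'r) subshift_free) \<in> kernel d W"
  then have "supp (act d 1 (\<lambda>_. 1 :: 'r)) \<in> W" unfolding kernel_def by blast
  moreover have "supp (act d 1 (\<lambda>_. 1 :: 'r)) = \<X>" by (simp add: supp_def act_one)
  ultimately show False using assms by simp
qed

text \<open>An ideal of sets stable under preimages by the point maps of \<open>Iso\<close> and
  \<open>Iso_star\<close>; a \<open>Proj\<close> generator only shrinks sets, which the subset
  clause covers.\<close>

definition invariant :: "'a word set set \<Rightarrow> bool" where
  "invariant W \<longleftrightarrow> {} \<in> W \<and> (\<forall>T\<in>W. \<forall>T'. T' \<subseteq> T \<longrightarrow> T' \<in> W) \<and> (\<forall>T\<in>W. \<forall>T'\<in>W. T \<union> T' \<in> W) \<and>
    (\<forall>T\<in>W. \<forall>a. {x \<in> \<X>. x 0 = a \<and> suffix 1 x \<in> T} \<in> W) \<and> (\<forall>T\<in>W. \<forall>a. {x \<in> \<X>. a ## x \<in> T} \<in> W)"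

lemma gen_map_in: "gen_map d g (x, k) = Some (y, l) \<Longrightarrow> x \<in> \<X> \<Longrightarrow> y \<in> \<X>"
  by (cases g) (auto split: if_splits intro: suffix_in)

lemma invariant_preimage:
  assumes W: "invariant W" and T: "T \<in> W"
  shows "{x \<in> \<X>. \<exists>k y l. path_map d gs (x, k) = Some (y, l) \<and> y \<in> T} \<in> W"
proof (induction gs)
  case Nil
  have "{x \<in> \<X>. \<exists>k y l. path_map d [] (x, k) = Some (y, l) \<and> y \<in> T} \<subseteq> T" by auto
  then show ?case using W T unfolding invariant_def by blast
next
  case (Cons g gs)
  define U where "U = {x \<in> \<X>. \<exists>k y l. path_map d gs (x, k) = Some (y, l) \<and> y \<in> T}"
  have "U \<in> W" using Cons unfolding U_def .
  have sub: "{x \<in> \<X>. \<exists>k y l. path_map d (g # gs) (x, k) = Some (y, l) \<and> y \<in> T}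
      \<subseteq> {x \<in> \<X>. \<exists>k z l. gen_map d g (x, k) = Some (z, l) \<and> z \<in> U}" (is "?L \<subseteq> ?R")
  proof
    fix x assume "x \<in> ?L"
    then obtain k y l where x: "x \<in> \<X>" "path_map d (g # gs) (x, k) = Some (y, l)" "y \<in> T" by blast
    then obtain q where q: "gen_map d g (x, k) = Some q" "path_map d gs q = Some (y, l)"
      by (auto split: bind_splits)
    obtain z m where zm: "q = (z, m)" by (cases q)
    have "z \<in> U" using q x gen_map_in[of d g x k z m] unfolding U_def zm by auto
    then show "x \<in> ?R" using q x zm by blast
  qed
  have "?R \<in> W"
  proof (cases g)
    case (Proj A)
    then have "?R \<subseteq> U" by (auto split: if_splits)
    then show ?thesis using W \<open>U \<in> W\<close> unfolding invariant_def by blast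
  next
    case (Iso a)
    then have "?R \<subseteq> {x \<in> \<X>. x 0 = a \<and> suffix 1 x \<in> U}" by (auto split: if_splits)
    then show ?thesis using W \<open>U \<in> W\<close> unfolding invariant_def by meson
  next
    case (Iso_star a)
    then have "?R \<subseteq> {x \<in> \<X>. a ## x \<in> U}" by (auto split: if_splits)
    then show ?thesis using W \<open>U \<in> W\<close> unfolding invariant_def by meson
  qed
  then show ?case using W sub unfolding invariant_def by meson
qed

text \<open>Functions of negligible support form a submodule. This is what makes the kernel absorb
  left factors; right factors are absorbed by its definition.\<close>

lemma supp_act:
  assumes W: "invariant W" and \<phi>: "supp \<phi> \<in> W"
  shows "supp (act d f \<phi>) \<in> W"
proof (induction f rule: poly_mapping_add_induct)
  case (single w r)
  have "supp (act d (Poly_Mapping.single w r) \<phi>)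
    \<subseteq> {x \<in> \<X>. \<exists>k y l. path_map d (factors w) (x, k) = Some (y, l) \<and> y \<in> supp \<phi>}" (is "_ \<subseteq> ?R")
  proof
    fix x assume "x \<in> supp (act d (Poly_Mapping.single w r) \<phi>)"
    then obtain k where x: "x \<in> \<X>" "r * mono_act d (factors w) \<phi> (x, k) \<noteq> 0"
      by (auto simp: supp_def act_single)
    then have "mono_act d (factors w) \<phi> (x, k) \<noteq> 0" by auto
    then obtain y l where y: "path_map d (factors w) (x, k) = Some (y, l)" "\<phi> (y, l) \<noteq> 0"
      by (auto simp: mono_act_def split: option.splits)
    have "path_map d gs (u, i) = Some (y, l) \<Longrightarrow> u \<in> \<X> \<Longrightarrow> y \<in> \<X>" for gs u i
    proof (induction gs arbitrary: u i)
      case (Cons g gs)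
      then obtain z m where "gen_map d g (u, i) = Some (z, m)" "path_map d gs (z, m) = Some (y, l)"
        by (auto split: bind_splits)
      then show ?case using Cons gen_map_in by blast
    qed simp
    then have "y \<in> supp \<phi>" using x y unfolding supp_def by blast
    then show "x \<in> ?R" using x y by blast
  qed
  moreover have "?R \<in> W" by (rule invariant_preimage[OF W \<phi>])
  ultimately show ?case using W unfolding invariant_def by meson
next
  case (add f g)
  have "supp (act d (f + g) \<phi>) \<subseteq> supp (act d f \<phi>) \<union> supp (act d g \<phi>)"
    by (auto simp: supp_def act_add)
  moreover have "supp (act d f \<phi>) \<union> supp (act d g \<phi>) \<in> W" using W add unfolding invariant_def by blast
  ultimately show ?case using W unfolding invariant_def by meson
qed

lemma kernel_ideal:
  assumes W: "invariant W"
  shows "two_sided_ideal (kernel d W :: ('a, 'r::comm_ring_1) subshift_free set)"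
proof
  show "0 \<in> kernel d W" using W by (simp add: kernel_def supp_def act_zero invariant_def)
next
  fix x y r :: "('a, 'r) subshift_free"
  assume x: "x \<in> kernel d W"
  show "r * x \<in> kernel d W" unfolding kernel_def
  proof (intro CollectI allI)
    fix \<phi>
    have "act d (r * x) \<phi> = act d r (act d x \<phi>)" by (rule ext) (rule act_mult)
    moreover have "supp (act d r (act d x \<phi>)) \<in> W"
      using x by (subst (asm) kernel_def) (rule supp_act[OF W], blast)
    ultimately show "supp (act d (r * x) \<phi>) \<in> W" by (simp only:)
  qed
  show "x * r \<in> kernel d W" unfolding kernel_def
  proof (intro CollectI allI)
    fix \<phi>
    have "act d (x * r) \<phi> = act d x (act d r \<phi>)" by (rule ext) (rule act_mult)
    then show "supp (act d (x * r) \<phi>) \<in> W" using x unfolding kernel_def by simp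
  qed
  assume y: "y \<in> kernel d W"
  show "x + y \<in> kernel d W" unfolding kernel_def
  proof (intro CollectI allI)
    fix \<phi>
    have "supp (act d (x + y) \<phi>) \<subseteq> supp (act d x \<phi>) \<union> supp (act d y \<phi>)"
      by (auto simp: supp_def act_add)
    moreover have "supp (act d x \<phi>) \<union> supp (act d y \<phi>) \<in> W"
      using W x y unfolding invariant_def kernel_def by blast
    ultimately show "supp (act d (x + y) \<phi>) \<in> W" using W unfolding invariant_def by meson
  qed
qed

lemma invariant_empty: "invariant {{}}"
  unfolding invariant_def by auto

section \<open>Finitely covered sets and isolated periodic points\<close>

lemma covered_Un: "covered B T \<Longrightarrow> covered B T' \<Longrightarrow> covered B (T \<union> T')"
proof -
  assume "covered B T" "covered B T'"
  then obtain C C' where "finite C" "T \<subseteq> (\<Union>(\<gamma>, \<alpha>)\<in>C. multi_cyl B \<gamma> \<alpha>)"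
    "finite C'" "T' \<subseteq> (\<Union>(\<gamma>, \<alpha>)\<in>C'. multi_cyl B \<gamma> \<alpha>)" unfolding covered_def by blast
  then show "covered B (T \<union> T')" unfolding covered_def by (intro exI[of _ "C \<union> C'"]) auto
qed

text \<open>Prepending or deleting a letter turns each set of the cover into a subset of another one
  of the same kind, with the letter moved into or out of \<alpha>, or into \<gamma> when \<alpha> is
  empty.\<close>

lemma invariant_covered:
  assumes B: "B \<noteq> {}"
  shows "invariant {T. covered B T}"
  unfolding invariant_def
proof (intro conjI ballI allI impI)
  show "{} \<in> {T. covered B T}" unfolding covered_def by blast
next
  fix T T' assume "T \<in> {T. covered B T}" "T' \<subseteq> T"
  then show "T' \<in> {T. covered B T}" unfolding covered_def by blast
next
  fix T T' assume "T \<in> {T. covered B T}" "T' \<in> {T. covered B T}"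
  then show "T \<union> T' \<in> {T. covered B T}" using covered_Un by blast
next
  fix T and a :: 'a assume "T \<in> {T. covered B T}"
  then obtain C where C: "finite C" "T \<subseteq> (\<Union>(\<gamma>, \<alpha>)\<in>C. multi_cyl B \<gamma> \<alpha>)" unfolding covered_def by blast
  let ?C = "(\<lambda>(\<gamma>, \<alpha>). (\<gamma>, a # \<alpha>)) ` C"
  have "{x \<in> \<X>. x 0 = a \<and> suffix 1 x \<in> T} \<subseteq> (\<Union>(\<gamma>, \<alpha>)\<in>?C. multi_cyl B \<gamma> \<alpha>)"
  proof
    fix x assume x: "x \<in> {x \<in> \<X>. x 0 = a \<and> suffix 1 x \<in> T}"
    then obtain \<gamma> \<alpha> where c: "(\<gamma>, \<alpha>) \<in> C" "suffix 1 x \<in> multi_cyl B \<gamma> \<alpha>" using C(2) by blast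
    then obtain y where y: "suffix 1 x = \<alpha> \<frown> y" "\<forall>\<beta>\<in>B. (\<beta> @ \<gamma>) \<frown> y \<in> \<X>"
      unfolding mem_multi_cyl[OF B] by blast
    have "x = a ## suffix 1 x" using x by auto
    then have "x = (a # \<alpha>) \<frown> y" unfolding y(1) by simp
    then have "x \<in> multi_cyl B \<gamma> (a # \<alpha>)" using x y(2) unfolding mem_multi_cyl[OF B] by blast
    then show "x \<in> (\<Union>(\<gamma>, \<alpha>)\<in>?C. multi_cyl B \<gamma> \<alpha>)" using c(1) by force
  qed
  then show "{x \<in> \<X>. x 0 = a \<and> suffix 1 x \<in> T} \<in> {T. covered B T}"
    unfolding covered_def using C(1) by blast
next
  fix T and a :: 'a assume "T \<in> {T. covered B T}"
  then obtain C where C: "finite C" "T \<subseteq> (\<Union>(\<gamma>, \<alpha>)\<in>C. multi_cyl B \<gamma> \<alpha>)" unfolding covered_def by blast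
  \<comment> \<open>If \<alpha> is empty, the tail is \<open>a ## x\<close> itself and
    \<open>a\<close> is absorbed by \<gamma>; otherwise \<open>a\<close> is the first letter of
    \<alpha> and is dropped.\<close>
  let ?h = "\<lambda>(\<gamma>, \<alpha>). if \<alpha> = [] then (\<gamma> @ [a], []) else (\<gamma>, tl \<alpha>)"
  have "{x \<in> \<X>. a ## x \<in> T} \<subseteq> (\<Union>(\<gamma>, \<alpha>)\<in>?h ` C. multi_cyl B \<gamma> \<alpha>)"
  proof
    fix x assume x: "x \<in> {x \<in> \<X>. a ## x \<in> T}"
    then obtain \<gamma> \<alpha> where c: "(\<gamma>, \<alpha>) \<in> C" "a ## x \<in> multi_cyl B \<gamma> \<alpha>" using C(2) by blast
    then obtain y where y: "a ## x = \<alpha> \<frown> y" "\<forall>\<beta>\<in>B. (\<beta> @ \<gamma>) \<frown> y \<in> \<X>"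
      unfolding mem_multi_cyl[OF B] by blast
    have "x \<in> multi_cyl B (fst (?h (\<gamma>, \<alpha>))) (snd (?h (\<gamma>, \<alpha>)))"
    proof (cases \<alpha>)
      case Nil
      then have "y = a ## x" using y(1) by simp
      moreover have "(\<beta> @ \<gamma> @ [a]) \<frown> x = (\<beta> @ \<gamma>) \<frown> a ## x" for \<beta>
        using conc_conc[of "\<beta> @ \<gamma>" "[a]" x] by simp
      ultimately show ?thesis using x y(2) Nil unfolding mem_multi_cyl[OF B] by simp
    next
      case (Cons b \<alpha>')
      then have "x = \<alpha>' \<frown> y" using y(1) by simp
      then show ?thesis using x y(2) Cons unfolding mem_multi_cyl[OF B] by auto
    qed
    moreover have "?h (\<gamma>, \<alpha>) \<in> ?h ` C" using c(1) by (rule imageI)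
    ultimately show "x \<in> (\<Union>(\<gamma>, \<alpha>)\<in>?h ` C. multi_cyl B \<gamma> \<alpha>)"
      unfolding case_prod_beta by (rule UN_I[rotated])
  qed
  then show "{x \<in> \<X>. a ## x \<in> T} \<in> {T. covered B T}"
    unfolding covered_def using C(1) by blast
qed

lemma followers_in_kernel:
  assumes "B \<noteq> {}"
  shows "(gen_p (followers \<X> B) :: ('a, 'r::comm_ring_1) subshift_free) \<in> kernel d {T. covered B T}"
  unfolding kernel_def
proof (intro CollectI allI)
  fix \<phi> :: "'a word \<times> int \<Rightarrow> 'r"
  have "supp (act d (gen_p (followers \<X> B)) \<phi>) \<subseteq> multi_cyl B [] []"
    unfolding supp_def mem_multi_cyl[OF assms] subset_iff
    by (auto simp: act_p followers_iff split: if_splits)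
  then show "covered B (supp (act d (gen_p (followers \<X> B)) \<phi>))"
    unfolding covered_def by (intro exI[of _ "{([], [])}"]) simp
qed

lemma projection_not_in_kernel:
  assumes "x \<in> A" "x \<in> \<X>"
  shows "(gen_p A :: ('a, 'r::comm_ring_1) subshift_free) \<notin> kernel d {{}}"
proof
  assume "(gen_p A :: ('a, 'r) subshift_free) \<in> kernel d {{}}"
  then have "supp (act d (gen_p A) (\<lambda>_. 1 :: 'r)) = {}" unfolding kernel_def by blast
  moreover have "x \<in> supp (act d (gen_p A) (\<lambda>_. 1 :: 'r))" using assms by (simp add: supp_def act_p)
  ultimately show False by blast
qed

text \<open>An isolated periodic point gives an inhomogeneous element that the grading detects but \<open>d = 0\<close> does not.\<close>

lemma periodic_kernel:
  assumes g: "\<gamma> \<noteq> []" and F: "F = {\<gamma>\<^sup>\<omega>}" "\<gamma>\<^sup>\<omega> \<in> \<X>"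
  shows "(s_word \<gamma> * gen_p F - gen_p F :: ('a, 'r::comm_ring_1) subshift_free) \<in> kernel 0 {{}}"
    and "(s_word \<gamma> * gen_p F - gen_p F :: ('a, 'r) subshift_free) \<notin> kernel 1 {{}}"
proof -
  let ?x = "\<gamma>\<^sup>\<omega>"
  have x: "?x = \<gamma> \<frown> ?x" using g by (intro iter_unroll) simp
  \<comment> \<open>\<open>s_\<gamma>\<close> returns the periodic point to itself and changes only
    the degree, by \<open>d\<close> times the length of \<gamma>.\<close>
  have at: "act d (s_word \<gamma> * gen_p F - gen_p F) \<phi> (?x, k) = \<phi> (?x, k + d * int (length \<gamma>)) - \<phi> (?x, k)"
    for d k and \<phi> :: "'a word \<times> int \<Rightarrow> 'r"
  proof -
    have "act d (s_word \<gamma>) (act d (gen_p F) \<phi>) (?x, k) = act d (gen_p F) \<phi> (?x, k + d * int (length \<gamma>))"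
      using act_s_word[of d \<gamma> "act d (gen_p F) \<phi>" ?x k] x by simp
    then show ?thesis by (simp add: act_diff act_mult act_p F)
  qed
  have off: "act 0 (s_word \<gamma> * gen_p F - gen_p F) \<phi> (y, k) = 0" if "y \<noteq> ?x"
    for y k and \<phi> :: "'a word \<times> int \<Rightarrow> 'r"
  proof (cases "\<exists>z. y = \<gamma> \<frown> z")
    case True
    then obtain z where z: "y = \<gamma> \<frown> z" by blast
    then have "z \<noteq> ?x" using that x by metis
    then show ?thesis using that
      by (simp add: act_diff act_mult act_p F(1)) (simp add: z act_s_word act_p)
  next
    case False
    then show ?thesis using that by (simp add: act_diff act_mult act_p F(1) act_s_word_other)
  qed
  have "act 0 (s_word \<gamma> * gen_p F - gen_p F) \<phi> (y, k) = 0"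
    for y k and \<phi> :: "'a word \<times> int \<Rightarrow> 'r"
    using off at[of 0] by (cases "y = ?x") simp_all
  then show "(s_word \<gamma> * gen_p F - gen_p F :: ('a, 'r) subshift_free) \<in> kernel 0 {{}}"
    by (simp add: kernel_def supp_def)
  show "(s_word \<gamma> * gen_p F - gen_p F :: ('a, 'r) subshift_free) \<notin> kernel 1 {{}}"
  proof
    \<comment> \<open>Concentrated in degree 0, so at degree 0 the difference is
      \<open>0 - 1\<close>, because \<gamma> has positive length.\<close>
    let ?\<phi> = "\<lambda>(y, k). if k = 0 then 1 else 0 :: 'r"
    assume "(s_word \<gamma> * gen_p F - gen_p F :: ('a, 'r) subshift_free) \<in> kernel 1 {{}}"
    then have "supp (act 1 (s_word \<gamma> * gen_p F - gen_p F) ?\<phi>) = {}" unfolding kernel_def by blast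
    then have "act 1 (s_word \<gamma> * gen_p F - gen_p F) ?\<phi> (?x, 0) = 0" using F(2) unfolding supp_def by blast
    then show False using g unfolding at by simp
  qed
qed

end

section \<open>The subshift algebra as a quotient\<close>

text \<open>The ideal correspondence of the quotient; it reduces simplicity to a statement about
  ideals of the free algebra above the relations.\<close>

lemma (in ring) simple_ring_quot_iff:
  assumes I: "ideal I R"
  shows "simple_ring (R Quot I) \<longleftrightarrow>
    I \<noteq> carrier R \<and> (\<forall>J. ideal J R \<and> I \<subseteq> J \<longrightarrow> J = I \<or> J = carrier R)"
proof -
  interpret I: ideal I R by (rule I)
  let ?\<Phi> = "\<lambda>J. (+>) I ` J"
  have bij: "bij_betw ?\<Phi> {J. ideal J R \<and> I \<subseteq> J} {J. ideal J (R Quot I)}"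
    by (rule quot_ideal_correspondence[OF I])
  have "I \<noteq> {}" using I.zero_closed by blast
  then have "?\<Phi> I = {I}" using I.a_rcos_const by auto
  then have zero: "?\<Phi> I = {\<zero>\<^bsub>R Quot I\<^esub>}" by (simp add: FactRing_def)
  have carr: "?\<Phi> (carrier R) = carrier (R Quot I)"
    by (auto simp: FactRing_def A_RCOSETS_def')
  have above: "I \<in> {J. ideal J R \<and> I \<subseteq> J}" "carrier R \<in> {J. ideal J R \<and> I \<subseteq> J}"
    using I oneideal I.a_subset by auto
  have inj: "J = J'" if "?\<Phi> J = ?\<Phi> J'" "J \<in> {J. ideal J R \<and> I \<subseteq> J}" "J' \<in> {J. ideal J R \<and> I \<subseteq> J}" for J J'
    using bij that unfolding bij_betw_def inj_on_def by blast
  show ?thesis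
  proof
    assume S: "simple_ring (R Quot I)"
    then have "I \<noteq> carrier R" using zero carr unfolding simple_ring_def by auto
    moreover have "J = I \<or> J = carrier R" if J: "ideal J R \<and> I \<subseteq> J" for J
    proof -
      have "ideal (?\<Phi> J) (R Quot I)" using bij J unfolding bij_betw_def by blast
      then have "?\<Phi> J = ?\<Phi> I \<or> ?\<Phi> J = ?\<Phi> (carrier R)"
        using S unfolding simple_ring_def zero carr by blast
      then show ?thesis using inj[of J I] inj[of J "carrier R"] J above by blast
    qed
    ultimately show "I \<noteq> carrier R \<and> (\<forall>J. ideal J R \<and> I \<subseteq> J \<longrightarrow> J = I \<or> J = carrier R)" by blast
  next
    assume A: "I \<noteq> carrier R \<and> (\<forall>J. ideal J R \<and> I \<subseteq> J \<longrightarrow> J = I \<or> J = carrier R)"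
    have "?\<Phi> I \<noteq> ?\<Phi> (carrier R)" using A inj[OF _ above] by blast
    moreover have "J = ?\<Phi> I \<or> J = ?\<Phi> (carrier R)" if "ideal J (R Quot I)" for J
    proof -
      have "J \<in> ?\<Phi> ` {J. ideal J R \<and> I \<subseteq> J}" using bij that unfolding bij_betw_def by blast
      then show ?thesis using A by blast
    qed
    ultimately show "simple_ring (R Quot I)"
      unfolding simple_ring_def zero carr using I.quotient_is_ring by auto
  qed
qed

section \<open>Ideals of the free algebra and of the full polynomial type\<close>

lemma free_algebra_simps [simp]:
  "carrier (free_algebra G) = {f. \<forall>w\<in>Poly_Mapping.keys f. set (factors w) \<subseteq> G}"
  "monoid.mult (free_algebra G) = (*)" "add (free_algebra G) = (+)"
  "one (free_algebra G) = 1" "zero (free_algebra G) = 0"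
  by (simp_all add: free_algebra_def ring_of_type_algebra_def fun_eq_iff)

lemma free_gen_in_carrier: "g \<in> G \<Longrightarrow> free_gen g \<in> carrier (free_algebra G)"
  by (simp add: free_gen_def)

lemma carrier_free_algebra_mult:
  "f \<in> carrier (free_algebra G) \<Longrightarrow> g \<in> carrier (free_algebra G) \<Longrightarrow> f * g \<in> carrier (free_algebra G)"
  using monoid.m_closed[OF ring.is_monoid[OF ring_free_algebra, of G], of f g] by simp

lemma carrier_free_algebra_add:
  "f \<in> carrier (free_algebra G) \<Longrightarrow> g \<in> carrier (free_algebra G) \<Longrightarrow> f + g \<in> carrier (free_algebra G)"
  using Poly_Mapping.keys_add[of f g] by fastforce

lemma carrier_free_algebra_diff:
  "f \<in> carrier (free_algebra G) \<Longrightarrow> g \<in> carrier (free_algebra G) \<Longrightarrow> f - g \<in> carrier (free_algebra G)"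
proof -
  have "Poly_Mapping.keys (f - g) \<subseteq> Poly_Mapping.keys f \<union> Poly_Mapping.keys g"
    by (auto simp: in_keys_iff lookup_minus)
  then show "f \<in> carrier (free_algebra G) \<Longrightarrow> g \<in> carrier (free_algebra G) \<Longrightarrow> ?thesis"
    by fastforce
qed

lemma carrier_free_algebra_one: "1 \<in> carrier (free_algebra G)"
  by (simp add: zero_monomial_def)

lemma carrier_free_algebra_prod_list:
  "set fs \<subseteq> carrier (free_algebra G) \<Longrightarrow> prod_list fs \<in> carrier (free_algebra G)"
  by (induction fs) (auto simp del: free_algebra_simps simp: carrier_free_algebra_one carrier_free_algebra_mult)

context shift_space
begin

lemma relations_in_carrier:
  "(subshift_relations \<X> :: ('a, 'r::comm_ring_1) subshift_free set) \<subseteq> carrier (free_algebra (generators \<X>))"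
proof
  fix f :: "('a, 'r) subshift_free"
  let ?C = "carrier (free_algebra (generators \<X>)) :: ('a, 'r) subshift_free set"
  assume f: "f \<in> subshift_relations \<X>"
  have p: "gen_p A \<in> ?C" if "A \<in> bool_alg \<X>" for A
    using that by (intro free_gen_in_carrier) (simp add: generators_def)
  have s: "gen_s a \<in> ?C" "gen_s_star a \<in> ?C" for a
    by (intro free_gen_in_carrier; simp add: generators_def)+
  have w: "s_word u \<in> ?C" "s_star_word u \<in> ?C" for u
    unfolding s_word_def s_star_word_def using s by (intro carrier_free_algebra_prod_list; auto simp del: free_algebra_simps)+
  note closed = carrier_free_algebra_mult carrier_free_algebra_add carrier_free_algebra_diff carrier_free_algebra_one
  from f show "f \<in> ?C"
  proof cases
    case p_whole
    then show ?thesis by (simp only:) (intro closed p bool_alg.whole)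
  next
    case p_empty
    then show ?thesis by (simp only:) (intro p empty_bool_alg)
  next
    case (p_inter A B)
    then show ?thesis by (simp only:) (intro closed p inter_bool_alg)
  next
    case (p_union A B)
    then show ?thesis by (simp only:) (intro closed p inter_bool_alg bool_alg.union)
  next
    case (s_partial_iso a)
    then show ?thesis by (simp only:) (intro closed s)
  next
    case (s_star_partial_iso a)
    then show ?thesis by (simp only:) (intro closed s)
  next
    case (s_cyl \<alpha> \<beta>)
    then show ?thesis by (simp only:) (intro closed w p cyl_bool_alg)
  qed
qed

end

text \<open>
  The type of noncommutative polynomials has more generators than \<open>free_algebra G\<close>. It is the direct sum of
  \<open>carrier (free_algebra G)\<close> and the ideal \<open>outside G\<close>, so that ideals extend by adding \<open>outside G\<close>.
\<close>

definition outside :: "'g set \<Rightarrow> ('g monomial \<Rightarrow>\<^sub>0 'r::comm_ring_1) set" where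
  "outside G = {f. \<forall>w\<in>Poly_Mapping.keys f. \<not> set (factors w) \<subseteq> G}"

text \<open>A letter outside \<open>G\<close> in one factor remains in every product of
  monomials.\<close>

lemma outside_ideal: "two_sided_ideal (outside G :: ('g monomial \<Rightarrow>\<^sub>0 'r::comm_ring_1) set)"
proof
  fix x y r :: "'g monomial \<Rightarrow>\<^sub>0 'r"
  assume x: "x \<in> outside G"
  show "r * x \<in> outside G" "x * r \<in> outside G"
    using x keys_mult[of r x] keys_mult[of x r] unfolding outside_def
    by (fastforce simp: plus_monomial_def)+
  assume "y \<in> outside G"
  then show "x + y \<in> outside G"
    using x Poly_Mapping.keys_add[of x y] unfolding outside_def by blast
qed (simp add: outside_def)

lemma carrier_outside_decomp:
  fixes f :: "'g monomial \<Rightarrow>\<^sub>0 'r::comm_ring_1"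
  shows "\<exists>g\<in>carrier (free_algebra G). \<exists>h\<in>outside G. f = g + h"
proof (induction f rule: poly_mapping_add_induct)
  case (single w r)
  have zero: "0 \<in> carrier (free_algebra G)" "0 \<in> outside G" by (simp_all add: outside_def)
  show ?case
  proof (cases "set (factors w) \<subseteq> G")
    case True
    then have "Poly_Mapping.single w r \<in> carrier (free_algebra G)" by simp
    then show ?thesis using zero by (intro bexI[of _ "Poly_Mapping.single w r"] bexI[of _ 0]) auto
  next
    case False
    then have "Poly_Mapping.single w r \<in> outside G" by (simp add: outside_def)
    then show ?thesis using zero by (intro bexI[of _ "Poly_Mapping.single w r"] bexI[of _ 0]) auto
  qed
next
  case (add f f')
  interpret two_sided_ideal "outside G :: ('g monomial \<Rightarrow>\<^sub>0 'r) set" by (rule outside_ideal)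
  obtain g h g' h' where "g \<in> carrier (free_algebra G)" "h \<in> outside G" "f = g + h"
    "g' \<in> carrier (free_algebra G)" "h' \<in> outside G" "f' = g' + h'" using add by blast
  then show ?case
    by (intro bexI[of _ "g + g'"] bexI[of _ "h + h'"] carrier_free_algebra_add add_mem) auto
qed

lemma carrier_inter_outside:
  assumes "f \<in> carrier (free_algebra G)" "f \<in> outside G" shows "f = 0"
proof -
  have "Poly_Mapping.keys f = {}" using assms by (auto simp: outside_def)
  then show ?thesis by (intro poly_mapping_eqI) (simp add: in_keys_iff flip: not_in_keys_iff_lookup_eq_zero)
qed

definition extend_ideal ::
  "'g set \<Rightarrow> ('g monomial \<Rightarrow>\<^sub>0 'r::comm_ring_1) set \<Rightarrow> ('g monomial \<Rightarrow>\<^sub>0 'r) set" where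
  "extend_ideal G J = {g + h | g h. g \<in> J \<and> h \<in> outside G}"

lemma extend_idealI: "g \<in> J \<Longrightarrow> h \<in> outside G \<Longrightarrow> g + h \<in> extend_ideal G J"
  unfolding extend_ideal_def by blast

lemma zero_in_ideal: "ideal J (free_algebra G) \<Longrightarrow> 0 \<in> J"
  using additive_subgroup.zero_closed[OF ideal.axioms(1), of J "free_algebra G"] by simp

lemma extend_ideal_ideal:
  fixes J :: "('g monomial \<Rightarrow>\<^sub>0 'r::comm_ring_1) set"
  assumes J: "ideal J (free_algebra G)"
  shows "two_sided_ideal (extend_ideal G J)"
proof
  interpret O: two_sided_ideal "outside G :: ('g monomial \<Rightarrow>\<^sub>0 'r) set" by (rule outside_ideal)
  interpret J: ideal J "free_algebra G" by (rule J)
  show "0 \<in> extend_ideal G J"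
    using extend_idealI[OF zero_in_ideal[OF J] O.zero_mem] by simp
  fix x y r :: "'g monomial \<Rightarrow>\<^sub>0 'r"
  assume "x \<in> extend_ideal G J"
  then obtain g h where x: "x = g + h" "g \<in> J" "h \<in> outside G" unfolding extend_ideal_def by blast
  \<comment> \<open>Only the products of \<open>k\<close> with \<open>g\<close> use the ideal
    property of \<open>J\<close>; everything with a factor \<open>n\<close> or \<open>h\<close>
    stays in \<open>outside G\<close>.\<close>
  obtain k n where r: "k \<in> carrier (free_algebra G)" "n \<in> outside G" "r = k + n"
    using carrier_outside_decomp by blast
  have "k * g \<in> J" "g * k \<in> J"
    using J.I_l_closed[OF x(2) r(1)] J.I_r_closed[OF x(2) r(1)] by simp_all
  moreover have "n * g + r * h \<in> outside G" "g * n + h * r \<in> outside G"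
    using x r by (auto intro: O.add_mem O.mult_left_mem O.mult_right_mem)
  moreover have "r * x = k * g + (n * g + r * h)" "x * r = g * k + (g * n + h * r)"
    unfolding x r by (simp_all add: algebra_simps)
  ultimately show "r * x \<in> extend_ideal G J" "x * r \<in> extend_ideal G J"
    by (simp_all only: extend_idealI)
  assume "y \<in> extend_ideal G J"
  then obtain g' h' where y: "y = g' + h'" "g' \<in> J" "h' \<in> outside G" unfolding extend_ideal_def by blast
  have "g + g' \<in> J" using additive_subgroup.a_closed[OF ideal.axioms(1)[OF J] x(2) y(2)] by simp
  moreover have "h + h' \<in> outside G" using x y by (intro O.add_mem)
  moreover have "x + y = (g + g') + (h + h')" unfolding x y by (simp add: algebra_simps)
  ultimately show "x + y \<in> extend_ideal G J" by (simp only: extend_idealI)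
qed

lemma mem_extend_ideal:
  assumes J: "ideal J (free_algebra G)" and f: "f \<in> carrier (free_algebra G)"
  shows "f \<in> extend_ideal G J \<longleftrightarrow> f \<in> J"
proof
  interpret J: ideal J "free_algebra G" by (rule J)
  assume "f \<in> extend_ideal G J"
  then obtain g h where fgh: "f = g + h" "g \<in> J" "h \<in> outside G" unfolding extend_ideal_def by blast
  have "g \<in> carrier (free_algebra G)" using fgh(2) J.Icarr by blast
  then have "f - g \<in> carrier (free_algebra G)" using f by (rule carrier_free_algebra_diff[rotated])
  then have "h = 0" using fgh by (intro carrier_inter_outside[of h G]) simp_all
  then show "f \<in> J" using fgh by simp
next
  assume "f \<in> J"
  then show "f \<in> extend_ideal G J"
    using extend_idealI[OF _ two_sided_ideal.zero_mem[OF outside_ideal], of f J G] by simp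
qed

lemma carrier_inter_ideal:
  fixes J :: "('g monomial \<Rightarrow>\<^sub>0 'r::comm_ring_1) set"
  assumes J: "two_sided_ideal J"
  shows "ideal (J \<inter> carrier (free_algebra G)) (free_algebra G)"
proof (rule idealI)
  interpret two_sided_ideal J by (rule J)
  interpret R: ring "free_algebra G" by (rule ring_free_algebra)
  show "ring (free_algebra G)" by (rule ring_free_algebra)
  show "subgroup (J \<inter> carrier (free_algebra G)) (add_monoid (free_algebra G))"
  proof (rule R.add.subgroupI)
    show "J \<inter> carrier (free_algebra G) \<noteq> {}" using zero_mem R.zero_closed by fastforce
    fix a assume a: "a \<in> J \<inter> carrier (free_algebra G)"
    then have "a \<oplus>\<^bsub>free_algebra G\<^esub> (- a) = \<zero>\<^bsub>free_algebra G\<^esub>" "- a \<in> carrier (free_algebra G)"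
      using carrier_free_algebra_diff[of 0 G a] by (simp_all add: in_keys_iff)
    then have "\<ominus>\<^bsub>free_algebra G\<^esub> a = - a"
      using a R.minus_equality[of "- a" a] by (simp add: R.a_comm)
    then show "\<ominus>\<^bsub>free_algebra G\<^esub> a \<in> J \<inter> carrier (free_algebra G)"
      using a minus_mem \<open>- a \<in> carrier (free_algebra G)\<close> by auto
  next
    fix a b assume "a \<in> J \<inter> carrier (free_algebra G)" "b \<in> J \<inter> carrier (free_algebra G)"
    then show "a \<oplus>\<^bsub>free_algebra G\<^esub> b \<in> J \<inter> carrier (free_algebra G)"
      using add_mem carrier_free_algebra_add[of a G b] by auto
  qed auto
  fix a x :: "'g monomial \<Rightarrow>\<^sub>0 'r" assume "a \<in> J \<inter> carrier (free_algebra G)" "x \<in> carrier (free_algebra G)"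
  then show "x \<otimes>\<^bsub>free_algebra G\<^esub> a \<in> J \<inter> carrier (free_algebra G)"
    "a \<otimes>\<^bsub>free_algebra G\<^esub> x \<in> J \<inter> carrier (free_algebra G)"
    using mult_left_mem mult_right_mem carrier_free_algebra_mult[of x G a] carrier_free_algebra_mult[of a G x]
    by auto
qed

text \<open>The alphabet is a whole type; the second assumption says that each letter occurs in
  \<X>. It excludes letters bound only by the two partial isometry relations.\<close>

theorem theorem5p25:
  fixes \<X> :: "'a word set"
  assumes "subshift \<X>"
    and "\<forall>a. [a] \<in> language \<X>"
  shows "simple_ring (unital_subshift_algebra \<X> :: ('a, 'r::field) subshift_free set ring)
    \<longleftrightarrow> condition_L \<X> \<and> compactly_cofinal \<X>"
proof -
  interpret shift_space \<X> by unfold_locales (rule assms(1))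
  define G where "G = generators \<X>"
  define K :: "('a, 'r) subshift_free ring" where "K = free_algebra G"
  define Rel :: "('a, 'r) subshift_free set" where "Rel = subshift_relations \<X>"
  define I where "I = genideal K Rel"
  interpret K: ring K unfolding K_def by (rule ring_free_algebra)
  have RelK: "Rel \<subseteq> carrier K" unfolding Rel_def K_def G_def by (rule relations_in_carrier)
  have I: "ideal I K" unfolding I_def by (rule K.genideal_ideal[OF RelK])
  have RelI: "Rel \<subseteq> I" unfolding I_def by (rule K.genideal_self[OF RelK])
  have K1: "1 \<in> carrier K" unfolding K_def by (rule carrier_free_algebra_one)
  have simple: "simple_ring (unital_subshift_algebra \<X> :: ('a, 'r) subshift_free set ring) \<longleftrightarrow>
      I \<noteq> carrier K \<and> (\<forall>J. ideal J K \<and> I \<subseteq> J \<longrightarrow> J = I \<or> J = carrier K)"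
    unfolding unital_subshift_algebra_def G_def[symmetric] K_def[symmetric] Rel_def[symmetric] I_def[symmetric]
    by (rule K.simple_ring_quot_iff[OF I])
  \<comment> \<open>The type of letters is inhabited, so some one-letter word occurs in a
    point.\<close>
  obtain z where "z \<in> \<X>" using assms(2) unfolding language_def by blast
  have kernel: "ideal (kernel d W \<inter> carrier K) K" "I \<subseteq> kernel d W \<inter> carrier K" if "invariant W" for d W
  proof -
    show id: "ideal (kernel d W \<inter> carrier K) K"
      unfolding K_def by (rule carrier_inter_ideal[OF kernel_ideal[OF that]])
    have "{} \<in> W" using that unfolding invariant_def by blast
    then have "Rel \<subseteq> kernel d W \<inter> carrier K" using relations_kernel RelK unfolding Rel_def by blast
    then show "I \<subseteq> kernel d W \<inter> carrier K" unfolding I_def by (rule K.genideal_minimal[OF id])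
  qed
  have W0: "1 \<notin> (kernel d {{}} :: ('a, 'r) subshift_free set)" for d
    using \<open>z \<in> \<X>\<close> by (intro one_not_kernel) auto
  have IK: "I \<noteq> carrier K" using kernel(2)[OF invariant_empty, of 0] W0[of 0] K1 by blast
  have pK: "gen_p A \<in> carrier K" if "A \<in> bool_alg \<X>" for A
    unfolding K_def using that by (intro free_gen_in_carrier) (simp add: G_def generators_def)
  show ?thesis
  proof
    assume "simple_ring (unital_subshift_algebra \<X> :: ('a, 'r) subshift_free set ring)"
    then have S: "J = I \<or> J = carrier K" if "ideal J K" "I \<subseteq> J" for J using simple that by blast
    \<comment> \<open>Such a kernel contains the relations but not \<open>1\<close>, so simplicity
      leaves only \<open>I\<close>, for every degree scale \<open>d\<close>.\<close>
    have ker_eq: "kernel d W \<inter> carrier K = I" if W: "invariant W" "\<X> \<notin> W" for d W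
      using S[OF kernel[OF W(1)], of d] one_not_kernel[OF W(2), of d] K1 by blast
    show "condition_L \<X> \<and> compactly_cofinal \<X>"
    proof
      show "condition_L \<X>" unfolding condition_L_def
      proof (intro allI impI, elim conjE, rule ccontr)
        fix B \<gamma>
        assume B: "finite B" "B \<subseteq> language \<X>" and \<gamma>: "\<gamma> \<noteq> []" "\<gamma>\<^sup>\<omega> \<in> followers \<X> B"
          and no: "\<not> (\<exists>y\<in>followers \<X> B. y \<noteq> \<gamma>\<^sup>\<omega>)"
        define F where "F = followers \<X> B"
        have F: "F = {\<gamma>\<^sup>\<omega>}" "\<gamma>\<^sup>\<omega> \<in> \<X>" using \<gamma> no unfolding F_def followers_def by blast+
        let ?f = "s_word \<gamma> * gen_p F - gen_p F :: ('a, 'r) subshift_free"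
        have "s_word \<gamma> \<in> carrier K" unfolding s_word_def K_def
          by (intro carrier_free_algebra_prod_list) (auto simp del: free_algebra_simps simp: G_def generators_def intro!: free_gen_in_carrier)
        then have "?f \<in> carrier K" using pK[OF followers_bool_alg[OF B(1)], folded F_def]
          unfolding K_def by (intro carrier_free_algebra_diff carrier_free_algebra_mult)
        moreover have "\<X> \<notin> {{}}" using \<open>z \<in> \<X>\<close> by blast
        \<comment> \<open>Both the ungraded and the graded kernel meet the carrier in
          \<open>I\<close>, yet \<open>?f\<close> belongs to the first and not to the
          second.\<close>
        ultimately show False
          using periodic_kernel[OF \<gamma>(1) F, where 'r = 'r] ker_eq[OF invariant_empty, of 0] ker_eq[OF invariant_empty, of 1]
          by blast
      qed
      show "compactly_cofinal \<X>"
      proof (rule cover_compactly_cofinal, rule ccontr)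
        fix B assume B: "finite B" "B \<subseteq> language \<X>" "followers \<X> B \<noteq> {}" "B \<noteq> {}"
          and no: "\<not> covered B \<X>"
        let ?p = "gen_p (followers \<X> B) :: ('a, 'r) subshift_free"
        obtain y where y: "y \<in> followers \<X> B" using B(3) by blast
        then have "y \<in> \<X>" unfolding followers_def by blast
        have "?p \<in> kernel 0 {T. covered B T} \<inter> carrier K"
          using followers_in_kernel[OF B(4)] pK[OF followers_bool_alg[OF B(1)]] by blast
        \<comment> \<open>Simplicity makes the kernel for covered sets as small as \<open>I\<close>,
          so \<open>?p\<close> would act as zero on all functions over \<X>, although its set is
          nonempty.\<close>
        then have "?p \<in> I" using ker_eq[OF invariant_covered[OF B(4)], of 0] no by blast
        then have "?p \<in> kernel 0 {{}}" using kernel(2)[OF invariant_empty, of 0] by blast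
        then show False using projection_not_in_kernel[OF y \<open>y \<in> \<X>\<close>] by blast
      qed
    qed
  next
    assume L: "condition_L \<X> \<and> compactly_cofinal \<X>"
    \<comment> \<open>The part \<open>outside G\<close> of the extension contains the projection
      symbols of sets that are not in \<open>bool_alg \<X>\<close>, as \<open>junk\<close>
      requires.\<close>
    have ext: "subshift_ideal \<X> (extend_ideal G J)" if J: "ideal J K" "I \<subseteq> J" for J
    proof -
      have "f \<in> extend_ideal G J" if "f \<in> Rel" for f
        using that J(2) RelI RelK mem_extend_ideal[OF J(1)[unfolded K_def], of f] unfolding K_def by blast
      moreover have "gen_p A \<in> extend_ideal G J" if "A \<notin> bool_alg \<X>" for A
      proof -
        have "gen_p A \<in> (outside G :: ('a, 'r) subshift_free set)"
          using that by (auto simp: outside_def free_gen_def G_def generators_def)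
        then show ?thesis using extend_idealI[OF zero_in_ideal[OF J(1)[unfolded K_def]]] by simp
      qed
      ultimately show ?thesis
        using extend_ideal_ideal[OF J(1)[unfolded K_def]] assms shift_space_axioms
        unfolding Rel_def subshift_ideal_def subshift_ideal_axioms_def by blast
    qed
    have "J = I \<or> J = carrier K" if J: "ideal J K" "I \<subseteq> J" for J
    proof (cases "J = I")
      case False
      then obtain f where f: "f \<in> J" "f \<notin> I" using J(2) by blast
      have fK: "f \<in> carrier K" using f(1) ideal.Icarr[OF J(1)] by blast
      have ME: "g \<in> extend_ideal G J' \<longleftrightarrow> g \<in> J'" if "ideal J' K" "g \<in> carrier K" for J' g
        using that unfolding K_def by (rule mem_extend_ideal)
      have "extend_ideal G I \<subseteq> extend_ideal G J" using J(2) unfolding extend_ideal_def by blast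
      then have "1 \<in> extend_ideal G J"
        using ideal_above_trivial[OF ext[OF I order_refl] ext[OF J]] ME[OF J(1) fK] ME[OF I fK] f L by blast
      then have "\<one>\<^bsub>K\<^esub> \<in> J" using ME[OF J(1) K1] by (simp add: K_def)
      then show ?thesis using ideal.one_imp_carrier[OF J(1)] by blast
    qed simp
    then show "simple_ring (unital_subshift_algebra \<X> :: ('a, 'r) subshift_free set ring)"
      using simple IK by blast
  qed
qed

end
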